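(* Any complete $+$isotropic surface in the pseudohyperbolic space $\mathbf{H}^4_1$ is isometric to the hyperbolic plane $\mathbf{H}^2$, and, up to an isometry of $\mathbf{H}^4_1$, a $+$isotropic surface in $\mathbf{H}^4_1$ has (locally) the form $$i_\lambda:\mathbf{H}^2\hookrightarrow\mathbf{H}^4_1\subset\mathbb{R}^5_2,\qquad (y_1,y_2,y_3)\mapsto(y_1,\lambda,\lambda,y_2,y_3),\quad y_1>0,\ -y_1^2+y_2^2+y_3^2=-1,$$ where $\lambda=\lambda(y_1,y_2,y_3)$ is a smooth function on $\mathbf{H}^2$.
   Context: $\mathbb{R}^5_2$ is $\mathbb{R}^5$ with metric $\langle x,x\rangle^5_2=-x_1^2-x_2^2+x_3^2+x_4^2+x_5^2$, and $\mathbf{H}^4_1=\{x\in\mathbb{R}^5_2:\langle x,x\rangle^5_2=-1\}$ with the induced Lorentzian metric (constant sectional curvature $-1$), oriented. $\mathbf{H}^2=\{y\in\mathbb{R}^3: -y_1^2+y_2^2+y_3^2=-1,\ y_1>0\}$ with the metric induced from $-dy_1^2+dy_2^2+dy_3^2$. Surfaces are oriented, immersed and spacelike (the induced metric is positive definite); completeness refers to the induced Riemannian metric. For an oriented spacelike immersed surface $N^2$ in an oriented Lorentzian 4-manifold $(M,g)$, take a local Darboux frame $e=(e_1,\dots,e_4)$: positively oriented in $M$, pseudo-orthonormal with $g(e_1,e_1)=-1$, and $(e_3,e_4)$ a positively oriented orthonormal frame of $TN$. The normal bundle splits into null line bundles $TN^\perp=TN_+^\perp\oplus TN_-^\perp$,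 $TN^\perp_\pm=\mathbb{R}(e_1\pm e_2)$. The surface is $+$isotropic if its second fundamental form takes values in $TN_+^\perp$, i.e. $II(V,W)\in TN^\perp_+$ for all tangent $V,W$. *)

theory Defs
  imports "HOL-Analysis.Analysis"
begin

section \<open>Smooth maps\<close>

text \<open>Class \<open>C\<^sup>n\<close> on an open set, through iterated directional derivatives.\<close>

primrec Ck_on :: "nat \<Rightarrow> 'a::euclidean_space set \<Rightarrow> ('a \<Rightarrow> 'b::real_normed_vector) \<Rightarrow> bool" where
  "Ck_on 0 S f \<longleftrightarrow> continuous_on S f"
| "Ck_on (Suc n) S f \<longleftrightarrow> (\<forall>x\<in>S. f differentiable (at x)) \<and>
     (\<forall>v. Ck_on n S (\<lambda>x. frechet_derivative f (at x) v))"

text \<open>Smoothness on an arbitrary subset of a Euclidean space: local existence of smooth extensions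
  to open sets. On an open set this is ordinary smoothness; on an embedded submanifold it is
  smoothness with respect to the submanifold structure.\<close>

definition smooth_on :: "'a::euclidean_space set \<Rightarrow> ('a \<Rightarrow> 'b::real_normed_vector) \<Rightarrow> bool" where
  "smooth_on S f \<longleftrightarrow> (\<forall>x\<in>S. \<exists>W g. open W \<and> x \<in> W \<and> (\<forall>n. Ck_on n W g) \<and> (\<forall>y\<in>S \<inter> W. g y = f y))"

section \<open>The model spaces\<close>

definition inner52 :: "real^5 \<Rightarrow> real^5 \<Rightarrow> real" where
  "inner52 x y = - x$1 * y$1 - x$2 * y$2 + x$3 * y$3 + x$4 * y$4 + x$5 * y$5"

definition H41 :: "(real^5) set" where
  "H41 = {x. inner52 x x = -1}"

definition tangent_H41 :: "real^5 \<Rightarrow> (real^5) set" where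
  "tangent_H41 x = {v. inner52 x v = 0}"

text \<open>\<^term>\<open>H41\<close> is connected, so it has exactly two orientations; they correspond to
  \<open>\<sigma> = 1\<close> and \<open>\<sigma> = -1\<close>. The position vector \<open>x\<close> spans the normal line of \<^term>\<open>H41\<close> at \<open>x\<close>.\<close>

definition pos_oriented_H41 :: "real \<Rightarrow> real^5 \<Rightarrow> (nat \<Rightarrow> real^5) \<Rightarrow> bool" where
  "pos_oriented_H41 \<sigma> x e \<longleftrightarrow> \<sigma> * det (vector [x, e 1, e 2, e 3, e 4] :: real^5^5) > 0"

text \<open>The derivative of \<open>\<Phi>\<close> within \<^term>\<open>H41\<close> is only determined on the tangent space, and only its
  values there are used.\<close>

definition isometry_H41 :: "(real^5 \<Rightarrow> real^5) \<Rightarrow> bool" where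
  "isometry_H41 \<Phi> \<longleftrightarrow> bij_betw \<Phi> H41 H41 \<and> smooth_on H41 \<Phi> \<and> smooth_on H41 (inv_into H41 \<Phi>) \<and>
     (\<forall>x\<in>H41. \<exists>D. (\<Phi> has_derivative D) (at x within H41) \<and>
        (\<forall>v\<in>tangent_H41 x. \<forall>w\<in>tangent_H41 x. inner52 (D v) (D w) = inner52 v w))"

definition inner31 :: "real^3 \<Rightarrow> real^3 \<Rightarrow> real" where
  "inner31 x y = - x$1 * y$1 + x$2 * y$2 + x$3 * y$3"

definition H2 :: "(real^3) set" where
  "H2 = {y. inner31 y y = -1 \<and> y$1 > 0}"

definition i_map :: "(real^3 \<Rightarrow> real) \<Rightarrow> real^3 \<Rightarrow> real^5" where
  "i_map l y = vector [y$1, l y, l y, y$2, y$3]"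

section \<open>Oriented surfaces\<close>

text \<open>A surface is a topological space \<open>X\<close> with an atlas \<open>A\<close> of local parametrisations: a member
  \<open>(V, \<psi>)\<close> is a homeomorphism \<open>\<psi>\<close> from an open set \<open>V\<close> of the plane onto an open subset of \<open>X\<close>
  (the inverse of a chart). Surfaces are connected and nonempty.\<close>

type_synonym 'a atlas = "((real^2) set \<times> (real^2 \<Rightarrow> 'a)) set"

definition oriented_surface :: "'a topology \<Rightarrow> 'a atlas \<Rightarrow> bool" where
  "oriented_surface X A \<longleftrightarrow>
     Hausdorff_space X \<and> second_countable X \<and> connected_space X \<and> topspace X \<noteq> {} \<and>
     (\<forall>(V, \<psi>)\<in>A. open V \<and> openin X (\<psi> ` V) \<and>
        homeomorphic_map (top_of_set V) (subtopology X (\<psi> ` V)) \<psi>) \<and>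
     topspace X = (\<Union>(V, \<psi>)\<in>A. \<psi> ` V) \<and>
     (\<forall>(V, \<psi>)\<in>A. \<forall>(V', \<psi>')\<in>A.
        smooth_on {u\<in>V. \<psi> u \<in> \<psi>' ` V'} (inv_into V' \<psi>' \<circ> \<psi>) \<and>
        (\<forall>u\<in>V. \<psi> u \<in> \<psi>' ` V' \<longrightarrow>
           det (matrix (frechet_derivative (inv_into V' \<psi>' \<circ> \<psi>) (at u))) > 0))"

definition spacelike_surface_H41 :: "'a topology \<Rightarrow> 'a atlas \<Rightarrow> ('a \<Rightarrow> real^5) \<Rightarrow> bool" where
  "spacelike_surface_H41 X A f \<longleftrightarrow> oriented_surface X A \<and> f ` topspace X \<subseteq> H41 \<and>
     (\<forall>(V, \<psi>)\<in>A. smooth_on V (f \<circ> \<psi>) \<and>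
        (\<forall>u\<in>V. inj (frechet_derivative (f \<circ> \<psi>) (at u)) \<and>
           (\<forall>a. a \<noteq> 0 \<longrightarrow>
              inner52 (frechet_derivative (f \<circ> \<psi>) (at u) a) (frechet_derivative (f \<circ> \<psi>) (at u) a) > 0)))"

section \<open>Second fundamental form and +isotropy\<close>

text \<open>\<open>F\<close> stands for \<open>f \<circ> \<psi>\<close>, and tangent vectors of the surface are given by their coordinates in
  \<open>\<real>\<^sup>2\<close>. The Levi-Civita connection of \<^term>\<open>H41\<close> is the flat derivative of the ambient space
  followed by the orthogonal projection \<open>w \<mapsto> w + \<langle>w,x\<rangle> x\<close> onto the tangent space at \<open>x\<close>
  (recall \<open>\<langle>x,x\<rangle> = -1\<close>); it is applied in direction \<open>a\<close> to the tangent field along the surface with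
  constant coordinates \<open>b\<close>.\<close>

definition cov_deriv :: "(real^2 \<Rightarrow> real^5) \<Rightarrow> real^2 \<Rightarrow> real^2 \<Rightarrow> real^2 \<Rightarrow> real^5" where
  "cov_deriv F u a b =
     (let w = frechet_derivative (\<lambda>u'. frechet_derivative F (at u') b) (at u) a
      in w + inner52 w (F u) *\<^sub>R F u)"

definition normal_space :: "(real^2 \<Rightarrow> real^5) \<Rightarrow> real^2 \<Rightarrow> (real^5) set" where
  "normal_space F u =
     {n \<in> tangent_H41 (F u). \<forall>a. inner52 n (frechet_derivative F (at u) a) = 0}"

definition second_ff :: "(real^2 \<Rightarrow> real^5) \<Rightarrow> real^2 \<Rightarrow> real^2 \<Rightarrow> real^2 \<Rightarrow> real^5" where
  "second_ff F u a b =
     (THE n. n \<in> normal_space F u \<and> cov_deriv F u a b - n \<in> range (frechet_derivative F (at u)))"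

definition darboux_frame :: "real \<Rightarrow> (real^2 \<Rightarrow> real^5) \<Rightarrow> real^2 \<Rightarrow> (nat \<Rightarrow> real^5) \<Rightarrow> bool" where
  "darboux_frame \<sigma> F u e \<longleftrightarrow>
     (\<forall>i\<in>{1..4}. e i \<in> tangent_H41 (F u)) \<and>
     (\<forall>i\<in>{1..4}. \<forall>j\<in>{1..4}.
        inner52 (e i) (e j) = (if i = j then (if i = 1 then -1 else 1) else 0)) \<and>
     pos_oriented_H41 \<sigma> (F u) e \<and>
     (\<exists>a b. e 3 = frechet_derivative F (at u) a \<and> e 4 = frechet_derivative F (at u) b \<and>
        det (vector [a, b] :: real^2^2) > 0)"

text \<open>The line \<open>\<real>(e\<^sub>1 + e\<^sub>2)\<close> is the same for all Darboux frames at a point.\<close>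

definition TN_plus :: "real \<Rightarrow> (real^2 \<Rightarrow> real^5) \<Rightarrow> real^2 \<Rightarrow> (real^5) set" where
  "TN_plus \<sigma> F u = {c *\<^sub>R (e 1 + e 2) | c e. darboux_frame \<sigma> F u e}"

definition plus_isotropic :: "real \<Rightarrow> 'a atlas \<Rightarrow> ('a \<Rightarrow> real^5) \<Rightarrow> bool" where
  "plus_isotropic \<sigma> A f \<longleftrightarrow>
     (\<forall>(V, \<psi>)\<in>A. \<forall>u\<in>V. \<forall>a b. second_ff (f \<circ> \<psi>) u a b \<in> TN_plus \<sigma> (f \<circ> \<psi>) u)"

section \<open>Completeness of the induced metric\<close>

definition piecewise_smooth_curve :: "'a topology \<Rightarrow> 'a atlas \<Rightarrow> (real \<Rightarrow> 'a) \<Rightarrow> bool" where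
  "piecewise_smooth_curve X A \<gamma> \<longleftrightarrow> pathin X \<gamma> \<and>
     (\<exists>(n::nat) \<tau>. \<tau> 0 = 0 \<and> \<tau> n = 1 \<and>
        (\<forall>i<n. \<tau> i < \<tau> (Suc i) \<and>
           (\<forall>(V, \<psi>)\<in>A. smooth_on {t\<in>{\<tau> i..\<tau> (Suc i)}. \<gamma> t \<in> \<psi> ` V} (inv_into V \<psi> \<circ> \<gamma>))))"

text \<open>By definition of the induced metric, the speed of \<open>\<gamma>\<close> is computed from \<open>f \<circ> \<gamma>\<close>.\<close>

definition curve_length :: "('a \<Rightarrow> real^5) \<Rightarrow> (real \<Rightarrow> 'a) \<Rightarrow> real" where
  "curve_length f \<gamma> = integral {0..1} (\<lambda>t. sqrt (inner52
     (vector_derivative (f \<circ> \<gamma>) (at t)) (vector_derivative (f \<circ> \<gamma>) (at t))))"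

definition induced_dist :: "'a topology \<Rightarrow> 'a atlas \<Rightarrow> ('a \<Rightarrow> real^5) \<Rightarrow> 'a \<Rightarrow> 'a \<Rightarrow> real" where
  "induced_dist X A f p q =
     Inf {curve_length f \<gamma> | \<gamma>. piecewise_smooth_curve X A \<gamma> \<and> \<gamma> 0 = p \<and> \<gamma> 1 = q}"

definition complete_surface :: "'a topology \<Rightarrow> 'a atlas \<Rightarrow> ('a \<Rightarrow> real^5) \<Rightarrow> bool" where
  "complete_surface X A f \<longleftrightarrow>
     (\<forall>s::nat \<Rightarrow> 'a. range s \<subseteq> topspace X \<and>
        (\<forall>\<epsilon>>0. \<exists>N. \<forall>m\<ge>N. \<forall>n\<ge>N. induced_dist X A f (s m) (s n) < \<epsilon>) \<longrightarrow>
        (\<exists>p\<in>topspace X. (\<lambda>n. induced_dist X A f (s n) p) \<longlonglongrightarrow> 0))"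

section \<open>Maps to the hyperbolic plane\<close>

text \<open>\<open>h\<close> is a diffeomorphism from the open subset \<open>U\<close> of the surface onto the open subset \<open>W\<close> of
  \<^term>\<open>H2\<close>.\<close>

definition diffeo_H2 ::
  "'a topology \<Rightarrow> 'a atlas \<Rightarrow> 'a set \<Rightarrow> ('a \<Rightarrow> real^3) \<Rightarrow> (real^3) set \<Rightarrow> bool" where
  "diffeo_H2 X A U h W \<longleftrightarrow> openin X U \<and> openin (top_of_set H2) W \<and> bij_betw h U W \<and>
     (\<forall>(V, \<psi>)\<in>A. smooth_on {u\<in>V. \<psi> u \<in> U} (h \<circ> \<psi>) \<and>
        smooth_on (h ` (U \<inter> \<psi> ` V)) (inv_into V \<psi> \<circ> inv_into U h))"

definition isometric_to_H2 :: "'a topology \<Rightarrow> 'a atlas \<Rightarrow> ('a \<Rightarrow> real^5) \<Rightarrow> bool" where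
  "isometric_to_H2 X A f \<longleftrightarrow> (\<exists>h. diffeo_H2 X A (topspace X) h H2 \<and>
     (\<forall>(V, \<psi>)\<in>A. \<forall>u\<in>V. \<forall>a b.
        inner31 (frechet_derivative (h \<circ> \<psi>) (at u) a) (frechet_derivative (h \<circ> \<psi>) (at u) b) =
        inner52 (frechet_derivative (f \<circ> \<psi>) (at u) a) (frechet_derivative (f \<circ> \<psi>) (at u) b)))"

end

theory Submission
  imports Defs "HOL-Computational_Algebra.Polynomial"
begin

text \<open>The theorem holds because a +isotropic surface has a constant null normal direction. Let \<open>N\<close> be a local
field spanning the null line \<^const>\<open>TN_plus\<close>. Differentiating \<open>\<langle>N,N\<rangle> = 0\<close> and \<open>\<langle>N,f\<rangle> = 0\<close> shows that
\<open>dN\<close> is orthogonal to \<open>N\<close> and to \<open>f\<close>; differentiating \<open>\<langle>N,df(b)\<rangle> = 0\<close> shows that \<open>\<langle>dN(a),df(b)\<rangle>\<close> is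
\<open>-\<langle>N,D\<^sup>2f(a,b)\<rangle>\<close>, which vanishes since the second fundamental form is a multiple of the null vector
\<open>N\<close>. The vectors orthogonal to \<open>f\<close>, to the tangent plane and to \<open>N\<close> are the multiples of \<open>N\<close>, so
\<open>dN\<close> is a multiple of \<open>N\<close> and the line \<open>\<real>N\<close> is locally constant. The orientations make the choice
between the two null normal lines at each point independent of the chart, so on a connected surface
there is a single null vector \<open>N\<close> orthogonal to all positions \<open>f(p)\<close> (\<open>constant_null_normal\<close>).

A linear isometry takes \<open>N\<close> to a multiple of \<open>(0,1,1,0,0)\<close>, and then \<open>f\<close> takes the form
\<open>(y\<^sub>1,\<mu>,\<mu>,y\<^sub>2,y\<^sub>3)\<close> with \<open>-y\<^sub>1\<^sup>2 + y\<^sub>2\<^sup>2 + y\<^sub>3\<^sup>2 = -1\<close>; the sign of \<open>y\<^sub>1\<close> is constant and can be made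
positive (\<open>normal_form\<close>). In the induced metric the two terms \<open>d\<mu>\<^sup>2\<close> cancel, so
\<open>h = (y\<^sub>1,y\<^sub>2,y\<^sub>3)\<close> is a local isometry to the hyperbolic plane. Its local inverses exhibit the surface
as the graph of a function \<open>\<lambda>\<close>, which a cut-off extends to the whole plane (\<open>local_graph\<close>).

If the surface is complete, this local isometry is a bijection. The hyperbolic plane is a graph over
\<open>\<real>\<^sup>2\<close>, so the claim concerns the local diffeomorphism \<open>P = (y\<^sub>2,y\<^sub>3)\<close>. A section of \<open>P\<close> over an open
disc extends across each boundary point: the lift of a radius has finite length, hence converges in
the induced distance by completeness, and this is convergence in the topology of the surface because
the length of a curve controls the displacement of \<open>P\<close>. Hence there is a section over all of
\<open>\<real>\<^sup>2\<close>, and its image is open and closed.\<close>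

section \<open>Calculus of maps of class \<open>C\<^sup>n\<close>\<close>

lemma Ck_on_cong:
  assumes "open S" "\<And>x. x \<in> S \<Longrightarrow> f x = g x"
  shows "Ck_on n S f \<longleftrightarrow> Ck_on n S g"
  using assms(2)
proof (induction n arbitrary: f g)
  case 0
  then show ?case by (simp cong: continuous_on_cong)
next
  case (Suc n)
  have ev: "\<forall>\<^sub>F y in at x. f y = g y" if "x \<in> S" for x
    using that assms(1) Suc.prems by (auto simp: eventually_at_topological)
  have D: "(f has_derivative D) (at x) \<longleftrightarrow> (g has_derivative D) (at x)" if "x \<in> S" for x D
    using has_derivative_transform_within_open[of f D x UNIV S g]
      has_derivative_transform_within_open[of g D x UNIV S f] assms(1) Suc.prems that by auto
  then have fr: "frechet_derivative f (at x) = frechet_derivative g (at x)" if "x \<in> S" for x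
    unfolding frechet_derivative_def using that by presburger
  have "f differentiable at x \<longleftrightarrow> g differentiable at x" if "x \<in> S" for x
    unfolding differentiable_def using D that by auto
  moreover have "Ck_on n S (\<lambda>x. frechet_derivative f (at x) v) \<longleftrightarrow>
       Ck_on n S (\<lambda>x. frechet_derivative g (at x) v)" for v
    by (rule Suc.IH) (simp add: fr)
  ultimately show ?case by auto
qed

lemma Ck_on_subset: "Ck_on n S f \<Longrightarrow> T \<subseteq> S \<Longrightarrow> Ck_on n T f"
  by (induction n arbitrary: f) (auto intro: continuous_on_subset)

lemma Ck_on_local:
  assumes "open S" "\<And>x. x \<in> S \<Longrightarrow> \<exists>W. open W \<and> x \<in> W \<and> Ck_on n (S \<inter> W) f"
  shows "Ck_on n S f"
  using assms(2)
proof (induction n arbitrary: f)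
  case 0
  have "\<exists>\<U>. (\<forall>W\<in>\<U>. open W \<and> continuous_on (S \<inter> W) f) \<and> S \<subseteq> \<Union>\<U>"
    using 0 by (intro exI[of _ "{W. open W \<and> continuous_on (S \<inter> W) f}"]) fastforce
  then obtain \<U> where U: "\<And>W. W \<in> \<U> \<Longrightarrow> open W \<and> continuous_on (S \<inter> W) f" "S \<subseteq> \<Union>\<U>"
    by blast
  have "continuous_on (\<Union>W\<in>\<U>. S \<inter> W) f"
    using U assms(1) by (intro continuous_on_open_UN) auto
  moreover have "(\<Union>W\<in>\<U>. S \<inter> W) = S" using U by auto
  ultimately show ?case by simp
next
  case (Suc n)
  have "f differentiable at x" if "x \<in> S" for x
    using Suc.prems[OF that] that by auto
  moreover have "Ck_on n S (\<lambda>x. frechet_derivative f (at x) v)" for v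
  proof (rule Suc.IH)
    fix x assume "x \<in> S"
    then obtain W where "open W" "x \<in> W" "Ck_on (Suc n) (S \<inter> W) f" using Suc.prems by blast
    then show "\<exists>W. open W \<and> x \<in> W \<and> Ck_on n (S \<inter> W) (\<lambda>x. frechet_derivative f (at x) v)" by auto
  qed
  ultimately show ?case by simp
qed

lemma Ck_on_SucD: "Ck_on (Suc n) S f \<Longrightarrow> Ck_on n S f"
proof (induction n arbitrary: f)
  case 0
  then show ?case
    by (auto intro!: continuous_at_imp_continuous_on differentiable_imp_continuous_within)
next
  case (Suc n)
  have "Ck_on n S (\<lambda>x. frechet_derivative f (at x) v)" for v
    by (rule Suc.IH) (use Suc.prems in simp)
  then show ?case using Suc.prems by simp
qed

text \<open>Any family of derivatives serves to climb one class, since on an open set it agrees with the one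
chosen by \<^const>\<open>frechet_derivative\<close>.\<close>

lemma Ck_on_SucI:
  assumes "open S" "\<And>x. x \<in> S \<Longrightarrow> (f has_derivative D x) (at x)"
    and "\<And>v. Ck_on n S (\<lambda>x. D x v)"
  shows "Ck_on (Suc n) S f"
proof -
  have fr: "frechet_derivative f (at x) = D x" if "x \<in> S" for x
    using assms(2)[OF that] by (metis frechet_derivative_at)
  have "Ck_on n S (\<lambda>x. frechet_derivative f (at x) v)" for v
    using Ck_on_cong[OF assms(1), of "\<lambda>x. frechet_derivative f (at x) v" "\<lambda>x. D x v"] fr assms(3)
    by auto
  then show ?thesis
    using assms(2) by (auto simp: differentiable_def)
qed

lemma Ck_on_Suc_has_derivative:
  assumes "Ck_on (Suc n) S f" "x \<in> S"
  shows "(f has_derivative frechet_derivative f (at x)) (at x)"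
  using assms by (simp add: frechet_derivative_works)

lemma Ck_on_const: "open S \<Longrightarrow> Ck_on n S (\<lambda>x. c)"
proof (induction n arbitrary: c)
  case (Suc n)
  show ?case by (rule Ck_on_SucI[where D = "\<lambda>_ _. 0"]) (use Suc in auto)
qed simp

lemma Ck_on_bounded_linear:
  assumes "open S" "bounded_linear f"
  shows "Ck_on n S f"
proof (cases n)
  case 0
  then show ?thesis using assms by (simp add: linear_continuous_on)
next
  case (Suc m)
  show ?thesis unfolding Suc
    by (rule Ck_on_SucI[where D = "\<lambda>x. f"])
      (use assms in \<open>auto intro: bounded_linear_imp_has_derivative Ck_on_const\<close>)
qed

lemma Ck_on_linear_compose:
  assumes "open S" "bounded_linear L"
  shows "Ck_on n S f \<Longrightarrow> Ck_on n S (\<lambda>x. L (f x))"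
proof (induction n arbitrary: f)
  case 0
  then show ?case using assms by (auto intro: bounded_linear.continuous_on)
next
  case (Suc n)
  show ?case
    by (rule Ck_on_SucI[where D = "\<lambda>x v. L (frechet_derivative f (at x) v)"])
      (use assms Suc Ck_on_Suc_has_derivative[OF Suc.prems] in
        \<open>auto intro: bounded_linear.has_derivative\<close>)
qed

lemma Ck_on_add:
  assumes "open S"
  shows "Ck_on n S f \<Longrightarrow> Ck_on n S g \<Longrightarrow> Ck_on n S (\<lambda>x. f x + g x)"
proof (induction n arbitrary: f g)
  case 0
  then show ?case by (auto intro: continuous_intros)
next
  case (Suc n)
  show ?case
    by (rule Ck_on_SucI[where D = "\<lambda>x v. frechet_derivative f (at x) v + frechet_derivative g (at x) v"])
      (use assms Suc Ck_on_Suc_has_derivative[OF Suc.prems(1)] Ck_on_Suc_has_derivative[OF Suc.prems(2)] in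
        \<open>auto intro: has_derivative_add\<close>)
qed

lemma Ck_on_sum:
  assumes "open S" "\<And>i. i \<in> I \<Longrightarrow> Ck_on n S (f i)"
  shows "Ck_on n S (\<lambda>x. \<Sum>i\<in>I. f i x)"
  using assms(2) by (induction I rule: infinite_finite_induct) (auto intro!: Ck_on_add Ck_on_const assms(1))

lemma Ck_on_minus: "open S \<Longrightarrow> Ck_on n S f \<Longrightarrow> Ck_on n S (\<lambda>x. - f x)"
  using Ck_on_linear_compose[of S uminus n f] by (simp add: bounded_linear_minus)

lemma Ck_on_diff: "open S \<Longrightarrow> Ck_on n S f \<Longrightarrow> Ck_on n S g \<Longrightarrow> Ck_on n S (\<lambda>x. f x - g x)"
  using Ck_on_add[of S n f "\<lambda>x. - g x"] Ck_on_minus[of S n g] by simp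

lemma Ck_on_bilinear:
  assumes "open S" "bounded_bilinear B"
  shows "Ck_on n S f \<Longrightarrow> Ck_on n S g \<Longrightarrow> Ck_on n S (\<lambda>x. B (f x) (g x))"
proof (induction n arbitrary: f g)
  case 0
  then show ?case using assms by (auto intro: bounded_bilinear.continuous_on)
next
  case (Suc n)
  show ?case
  proof (rule Ck_on_SucI[OF assms(1)])
    show "((\<lambda>x. B (f x) (g x)) has_derivative
        (\<lambda>v. B (f x) (frechet_derivative g (at x) v) + B (frechet_derivative f (at x) v) (g x))) (at x)"
      if "x \<in> S" for x
      using that Ck_on_Suc_has_derivative[OF Suc.prems(1)] Ck_on_Suc_has_derivative[OF Suc.prems(2)]
      by (intro bounded_bilinear.FDERIV[OF assms(2)]) auto
    show "Ck_on n S (\<lambda>x. B (f x) (frechet_derivative g (at x) v) + B (frechet_derivative f (at x) v) (g x))" for v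
      using Suc.prems by (intro Ck_on_add Suc.IH assms(1) Ck_on_SucD[OF Suc.prems(1)] Ck_on_SucD[OF Suc.prems(2)]) simp_all
  qed
qed

lemmas Ck_on_mult = Ck_on_bilinear[OF _ bounded_bilinear_mult]
lemmas Ck_on_scaleR = Ck_on_bilinear[OF _ bounded_bilinear_scaleR]
lemmas Ck_on_inner = Ck_on_bilinear[OF _ bounded_bilinear_inner]

lemma Ck_on_inverse:
  fixes f :: "'a::euclidean_space \<Rightarrow> real"
  assumes "open S" "\<And>x. x \<in> S \<Longrightarrow> f x \<noteq> 0"
  shows "Ck_on n S f \<Longrightarrow> Ck_on n S (\<lambda>x. inverse (f x))"
proof (induction n)
  case 0
  then show ?case using assms by (auto intro: continuous_intros)
next
  case (Suc n)
  have "Ck_on n S f" using Suc.prems by (rule Ck_on_SucD)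
  then have I: "Ck_on n S (\<lambda>x. inverse (f x))" by (rule Suc.IH)
  show ?case
  proof (rule Ck_on_SucI[OF assms(1)])
    show "((\<lambda>x. inverse (f x)) has_derivative
        (\<lambda>v. - (inverse (f x) * frechet_derivative f (at x) v * inverse (f x)))) (at x)"
      if "x \<in> S" for x
      using that assms(2) Ck_on_Suc_has_derivative[OF Suc.prems]
      by (intro Deriv.has_derivative_inverse) auto
    show "Ck_on n S (\<lambda>x. - (inverse (f x) * frechet_derivative f (at x) v * inverse (f x)))" for v
      using Suc.prems I by (intro Ck_on_minus Ck_on_mult assms(1)) auto
  qed
qed

lemma Ck_on_divide:
  fixes f g :: "'a::euclidean_space \<Rightarrow> real"
  assumes "open S" "\<And>x. x \<in> S \<Longrightarrow> g x \<noteq> 0" "Ck_on n S f" "Ck_on n S g"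
  shows "Ck_on n S (\<lambda>x. f x / g x)"
  unfolding divide_inverse by (intro Ck_on_mult Ck_on_inverse assms)

text \<open>Expanded in the standard basis, the chain rule writes the derivative as a sum of products of maps of
the previous class, to which the induction hypothesis applies.\<close>

lemma Ck_on_compose:
  fixes g :: "'a::euclidean_space \<Rightarrow> 'b::euclidean_space"
  assumes "open S" "open T"
  shows "Ck_on n S g \<Longrightarrow> Ck_on n T f \<Longrightarrow> (\<And>x. x \<in> S \<Longrightarrow> g x \<in> T) \<Longrightarrow> Ck_on n S (\<lambda>x. f (g x))"
proof (induction n arbitrary: f)
  case 0
  then show ?case by (auto intro: continuous_on_compose2)
next
  case (Suc n)
  have g: "Ck_on n S g" using Suc.prems by (blast intro: Ck_on_SucD)
  show ?case
  proof (rule Ck_on_SucI[OF assms(1)])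
    fix x assume x: "x \<in> S"
    have df: "(f has_derivative frechet_derivative f (at (g x))) (at (g x))"
      using x Suc.prems Ck_on_Suc_has_derivative by blast
    have dg: "(g has_derivative frechet_derivative g (at x)) (at x)"
      using x Suc.prems Ck_on_Suc_has_derivative by blast
    have lin: "linear (frechet_derivative f (at (g x)))"
      using df has_derivative_linear by blast
    have e: "frechet_derivative f (at (g x)) w =
        (\<Sum>i\<in>Basis. (w \<bullet> i) *\<^sub>R frechet_derivative f (at (g x)) i)" for w
      by (subst euclidean_representation[of w, symmetric])
        (simp add: linear_sum[OF lin] linear_scale[OF lin])
    show "((\<lambda>x. f (g x)) has_derivative
        (\<lambda>v. \<Sum>i\<in>Basis. (frechet_derivative g (at x) v \<bullet> i) *\<^sub>R frechet_derivative f (at (g x)) i)) (at x)"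
      using has_derivative_compose[OF dg df] by (simp add: e[symmetric])
  next
    show "Ck_on n S (\<lambda>x. \<Sum>i\<in>Basis. (frechet_derivative g (at x) v \<bullet> i) *\<^sub>R frechet_derivative f (at (g x)) i)"
      for v
      using Suc.prems g
      by (intro Ck_on_sum Ck_on_scaleR Ck_on_inner Ck_on_const assms(1) Suc.IH) auto
  qed
qed

section \<open>Smooth maps on arbitrary sets\<close>

lemma smooth_on_open_iff:
  assumes "open S"
  shows "smooth_on S f \<longleftrightarrow> (\<forall>n. Ck_on n S f)"
proof
  assume sm: "smooth_on S f"
  show "\<forall>n. Ck_on n S f"
  proof (intro allI Ck_on_local[OF assms])
    fix n x assume "x \<in> S"
    with sm obtain W g where W: "open W" "x \<in> W" "Ck_on n W g" "\<forall>y\<in>S \<inter> W. g y = f y"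
      unfolding smooth_on_def by meson
    then have "Ck_on n (S \<inter> W) f"
      using Ck_on_cong[of "S \<inter> W" g f n] assms by (auto intro: Ck_on_subset)
    with W show "\<exists>W. open W \<and> x \<in> W \<and> Ck_on n (S \<inter> W) f" by blast
  qed
next
  assume "\<forall>n. Ck_on n S f"
  then show "smooth_on S f" using assms unfolding smooth_on_def by blast
qed

lemma smooth_onE:
  assumes "smooth_on S f" "x \<in> S"
  obtains W g where "open W" "x \<in> W" "\<forall>n. Ck_on n W g" "\<forall>y\<in>S \<inter> W. g y = f y"
  using bspec[OF assms(1)[unfolded smooth_on_def] assms(2)] by (elim exE conjE)

lemma smooth_onI:
  assumes "\<And>x. x \<in> S \<Longrightarrow> \<exists>W g. open W \<and> x \<in> W \<and> (\<forall>n. Ck_on n W g) \<and> (\<forall>y\<in>S \<inter> W. g y = f y)"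
  shows "smooth_on S f"
  unfolding smooth_on_def using assms by (rule ballI)

lemma smooth_on_subset:
  assumes "smooth_on S f" "T \<subseteq> S" shows "smooth_on T f"
proof (rule smooth_onI)
  fix x assume "x \<in> T"
  with assms(2) have "x \<in> S" by blast
  with assms(1) obtain W g where W: "open W" "x \<in> W" "\<forall>n. Ck_on n W g" "\<forall>y\<in>S \<inter> W. g y = f y"
    by (rule smooth_onE)
  show "\<exists>W g. open W \<and> x \<in> W \<and> (\<forall>n. Ck_on n W g) \<and> (\<forall>y\<in>T \<inter> W. g y = f y)"
    by (rule exI[of _ W], rule exI[of _ g]) (use W assms(2) in auto)
qed

lemma smooth_on_cong: "(\<And>x. x \<in> S \<Longrightarrow> f x = g x) \<Longrightarrow> smooth_on S f \<longleftrightarrow> smooth_on S g"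
  unfolding smooth_on_def by simp

lemma smooth_on_local:
  assumes "\<And>x. x \<in> S \<Longrightarrow> \<exists>W. open W \<and> x \<in> W \<and> smooth_on (S \<inter> W) f"
  shows "smooth_on S f"
proof (rule smooth_onI)
  fix x assume x: "x \<in> S"
  then obtain W where W: "open W" "x \<in> W" "smooth_on (S \<inter> W) f" using assms by blast
  then obtain W' g where W': "open W'" "x \<in> W'" "\<forall>n. Ck_on n W' g"
    "\<forall>y\<in>S \<inter> W \<inter> W'. g y = f y"
    using smooth_onE[OF W(3), of x] x by (metis IntI)
  show "\<exists>W g. open W \<and> x \<in> W \<and> (\<forall>n. Ck_on n W g) \<and> (\<forall>y\<in>S \<inter> W. g y = f y)"
    by (rule exI[of _ "W \<inter> W'"], rule exI[of _ g]) (use W W' in \<open>auto intro: Ck_on_subset\<close>)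
qed

lemma Ck_on_imp_continuous_on: "Ck_on n S f \<Longrightarrow> continuous_on S f"
  proof (induction n)
  case (Suc n)
  then show ?case using Ck_on_SucD by blast
qed simp

lemma smooth_on_imp_continuous_on:
  assumes "smooth_on S f" shows "continuous_on S f"
  unfolding continuous_on_eq_continuous_within
proof
  fix x assume x: "x \<in> S"
  from assms x obtain W g where W: "open W" "x \<in> W" "\<forall>n. Ck_on n W g"
      "\<forall>y\<in>S \<inter> W. g y = f y"
    by (rule smooth_onE)
  have "continuous_on W g" by (rule Ck_on_imp_continuous_on[OF W(3)[rule_format, of 0]])
  then have "continuous (at x) g" using W by (simp add: continuous_on_eq_continuous_at)
  then have "continuous (at x within S) g" by (rule continuous_at_imp_continuous_at_within)
  then show "continuous (at x within S) f"
    using W x by (elim continuous_transform_within_openin[of _ S _ "S \<inter> W"]) (auto simp: openin_open_Int)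
qed

lemma smooth_on_compose:
  fixes g :: "'a::euclidean_space \<Rightarrow> 'b::euclidean_space"
  assumes "smooth_on S g" "smooth_on T f" "g ` S \<subseteq> T"
  shows "smooth_on S (\<lambda>x. f (g x))"
proof (rule smooth_onI)
  fix x assume x: "x \<in> S"
  from assms(1) x obtain W g' where W: "open W" "x \<in> W" "\<forall>n. Ck_on n W g'"
      "\<forall>y\<in>S \<inter> W. g' y = g y"
    by (rule smooth_onE)
  have "g x \<in> T" using x assms by auto
  with assms(2) obtain W' f' where W': "open W'" "g x \<in> W'" "\<forall>n. Ck_on n W' f'"
      "\<forall>y\<in>T \<inter> W'. f' y = f y"
    by (rule smooth_onE)
  have "continuous_on W g'" by (rule Ck_on_imp_continuous_on[OF W(3)[rule_format, of 0]])
  then have o: "open (W \<inter> g' -` W')"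
    using W(1) W'(1) by (simp add: continuous_on_open_vimage Int_commute)
  have "Ck_on n (W \<inter> g' -` W') (\<lambda>x. f' (g' x))" for n
    by (rule Ck_on_compose[OF o W'(1) Ck_on_subset[OF W(3)[rule_format]] W'(3)[rule_format]]) auto
  moreover have "\<forall>y\<in>S \<inter> (W \<inter> g' -` W'). f' (g' y) = f (g y)"
    using W(4) W'(4) assms(3) by auto
  ultimately show "\<exists>W h. open W \<and> x \<in> W \<and> (\<forall>n. Ck_on n W h) \<and> (\<forall>y\<in>S \<inter> W. h y = f (g y))"
    using o x W(2) bspec[OF W(4), of x] W'(2)
    by (intro exI[of _ "W \<inter> g' -` W'"] exI[of _ "\<lambda>x. f' (g' x)"]) auto
qed

lemma smooth_on_bounded_linear: "bounded_linear f \<Longrightarrow> smooth_on S f"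
  using smooth_on_open_iff[of UNIV f] Ck_on_bounded_linear[of UNIV f] smooth_on_subset[of UNIV f S] by auto

lemma smooth_on_linear_compose:
  fixes f :: "'a::euclidean_space \<Rightarrow> 'b::euclidean_space"
  assumes "smooth_on S f" "bounded_linear L" shows "smooth_on S (\<lambda>x. L (f x))"
  using smooth_on_compose[OF assms(1) smooth_on_bounded_linear[OF assms(2), of UNIV]] by simp

lemma smooth_on_has_derivative:
  assumes "open S" "smooth_on S f" "x \<in> S"
  shows "(f has_derivative frechet_derivative f (at x)) (at x)"
proof -
  have "Ck_on (Suc 0) S f" using assms(2) smooth_on_open_iff[OF assms(1), of f] by blast
  then show ?thesis using assms(3) by (rule Ck_on_Suc_has_derivative)
qed

lemma smooth_on_frechet:
  assumes "open S" "smooth_on S f"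
  shows "smooth_on S (\<lambda>x. frechet_derivative f (at x) v)"
proof -
  have "Ck_on (Suc n) S f" for n using assms(2) smooth_on_open_iff[OF assms(1), of f] by blast
  then have "Ck_on n S (\<lambda>x. frechet_derivative f (at x) v)" for n by simp
  then show ?thesis using smooth_on_open_iff[OF assms(1)] by blast
qed

section \<open>A smooth cut-off function\<close>

text \<open>The family of functions \<open>p(1/t) e\<^sup>-\<^sup>1\<^sup>/\<^sup>t\<close>, continued by \<open>0\<close> to \<open>t \<le> 0\<close>, is closed under
differentiation. All its members are therefore smooth, although they vanish on a half line.\<close>

definition flat :: "real poly \<Rightarrow> real \<Rightarrow> real" where
  "flat p t = (if t > 0 then poly p (1 / t) * exp (- (1 / t)) else 0)"

lemma poly_times_exp_minus_tendsto_0: "((\<lambda>x::real. poly p x * exp (- x)) \<longlongrightarrow> 0) at_top"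
proof -
  have "((\<lambda>x::real. \<Sum>i\<le>degree p. coeff p i * (x ^ i / exp x)) \<longlongrightarrow> (\<Sum>i\<le>degree p. coeff p i * 0)) at_top"
    by (intro tendsto_sum tendsto_mult tendsto_const tendsto_power_div_exp_0)
  then show ?thesis
    by (simp add: poly_altdef exp_minus divide_inverse sum_distrib_right mult.assoc)
qed

lemma flat_tendsto_0: "(flat p \<longlongrightarrow> 0) (at 0)"
  unfolding filterlim_at_split
proof
  have "\<forall>\<^sub>F t in at_left 0. flat p t = 0"
    by (auto simp: flat_def eventually_at_left_field intro: exI[of _ "-1"])
  then show "(flat p \<longlongrightarrow> 0) (at_left 0)" by (simp add: tendsto_eventually)
  have "((\<lambda>t. poly p (inverse t) * exp (- inverse t)) \<longlongrightarrow> 0) (at_right 0)"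
    using filterlim_compose[OF poly_times_exp_minus_tendsto_0 filterlim_inverse_at_top_right] .
  moreover have "\<forall>\<^sub>F t in at_right 0. poly p (inverse t) * exp (- inverse t) = flat p t"
    by (auto simp: flat_def eventually_at_right_field divide_inverse intro: exI[of _ "1"])
  ultimately show "(flat p \<longlongrightarrow> 0) (at_right 0)" by (rule Lim_transform_eventually)
qed

lemma flat_has_derivative:
  "(flat p has_real_derivative flat ([:0, 0, 1:] * (p - pderiv p)) t) (at t)"
proof (cases t "0::real" rule: linorder_cases)
  case less
  have "((\<lambda>t. 0) has_real_derivative 0) (at t)" by simp
  then show ?thesis using less
    by (subst DERIV_cong_ev[where g = "\<lambda>_. 0"])
      (auto simp: flat_def eventually_nhds intro!: exI[of _ "{..<0}"])
next
  case greater
  have "((\<lambda>t. poly p (1 / t) * exp (- (1 / t))) has_real_derivative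
      (poly (pderiv p) (1 / t) * (- (1 / t\<^sup>2))) * exp (- (1 / t)) + poly p (1 / t) * (exp (- (1 / t)) * (1 / t\<^sup>2))) (at t)"
    using greater
    by (auto intro!: derivative_eq_intros DERIV_chain2[OF poly_DERIV] simp: power2_eq_square field_simps)
  moreover have "(poly (pderiv p) (1 / t) * (- (1 / t\<^sup>2))) * exp (- (1 / t)) + poly p (1 / t) * (exp (- (1 / t)) * (1 / t\<^sup>2))
      = flat ([:0, 0, 1:] * (p - pderiv p)) t"
    using greater by (simp add: flat_def field_simps power2_eq_square)
  ultimately have "((\<lambda>t. poly p (1 / t) * exp (- (1 / t))) has_real_derivative flat ([:0, 0, 1:] * (p - pderiv p)) t) (at t)"
    by (simp only:)
  then show ?thesis using greater
    by (subst DERIV_cong_ev[where g = "\<lambda>t. poly p (1 / t) * exp (- (1 / t))"])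
      (auto simp: flat_def eventually_nhds intro!: exI[of _ "{0<..}"])
next
  case equal
  \<comment> \<open>Dividing by \<open>h\<close> raises the degree in \<open>1/h\<close> by one, so the difference quotient at \<open>0\<close> is flat too.\<close>
  have "((\<lambda>h. (flat p (0 + h) - flat p 0) / h) \<longlongrightarrow> 0) (at 0)"
    by (rule Lim_transform_eventually[OF flat_tendsto_0[of "pCons 0 p"]])
      (auto simp: flat_def intro!: always_eventually)
  then show ?thesis using equal by (simp add: DERIV_def flat_def)
qed

lemma Ck_on_flat: "Ck_on n UNIV (flat p)"
proof (induction n arbitrary: p)
  case 0
  then show ?case
    using DERIV_isCont[OF flat_has_derivative] by (simp add: continuous_on_eq_continuous_at)
next
  case (Suc n)
  show ?case
  proof (rule Ck_on_SucI)
    show "(flat p has_derivative (\<lambda>v. v * flat ([:0, 0, 1:] * (p - pderiv p)) t)) (at t)" for t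
      using flat_has_derivative[of p t] by (simp add: has_field_derivative_def mult.commute[of _ "flat _ _"])
    show "Ck_on n UNIV (\<lambda>t. v * flat ([:0, 0, 1:] * (p - pderiv p)) t)" for v
      by (intro Ck_on_mult Ck_on_const Suc.IH) auto
  qed auto
qed

text \<open>A smooth step that equals \<open>1\<close> up to \<open>a\<close> and \<open>0\<close> from \<open>b\<close> on. For \<open>a < b\<close> the denominator has no
zero, as at every point one of its two terms is positive.\<close>

definition bump_profile :: "real \<Rightarrow> real \<Rightarrow> real \<Rightarrow> real" where
  "bump_profile a b t = flat 1 (b - t) / (flat 1 (b - t) + flat 1 (t - a))"

lemma flat_1_pos: "t > 0 \<Longrightarrow> flat 1 t > 0" and flat_1_nonpos: "t \<le> 0 \<Longrightarrow> flat 1 t = 0"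
  by (auto simp: flat_def)

lemma flat_1_nonneg: "flat 1 t \<ge> 0"
  by (auto simp: flat_def)

lemma bump_profile_eq_1: "a < b \<Longrightarrow> t \<le> a \<Longrightarrow> bump_profile a b t = 1"
  using flat_1_pos[of "b - t"] by (simp add: bump_profile_def flat_1_nonpos)

lemma bump_profile_eq_0: "t \<ge> b \<Longrightarrow> bump_profile a b t = 0"
  by (simp add: bump_profile_def flat_1_nonpos)

lemma Ck_on_bump_profile: assumes "a < b" shows "Ck_on n UNIV (bump_profile a b)"
  unfolding bump_profile_def[abs_def]
proof (rule Ck_on_divide)
  have *: "Ck_on n UNIV (\<lambda>t. flat 1 (b - t))" "Ck_on n UNIV (\<lambda>t. flat 1 (t - a))"
    by (rule Ck_on_compose[OF open_UNIV open_UNIV _ Ck_on_flat];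
        intro Ck_on_diff Ck_on_const Ck_on_bounded_linear[OF _ bounded_linear_ident] open_UNIV UNIV_I)+
  show "Ck_on n UNIV (\<lambda>t. flat 1 (b - t))" by (rule *)
  show "Ck_on n UNIV (\<lambda>t. flat 1 (b - t) + flat 1 (t - a))" by (intro Ck_on_add *) auto
  fix t :: real
  show "flat 1 (b - t) + flat 1 (t - a) \<noteq> 0"
    using assms flat_1_pos[of "b - t"] flat_1_pos[of "t - a"] flat_1_nonneg[of "b - t"] flat_1_nonneg[of "t - a"]
    by (smt (verit))
qed auto

text \<open>The cut-off is a step function of the squared distance to the centre. It vanishes from three quarters
of the radius on, which leaves a margin on which the product with \<open>f\<close> and the continuation by \<open>0\<close>
agree.\<close>

lemma smooth_on_ball_extend:
  fixes f :: "'a::euclidean_space \<Rightarrow> real"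
  assumes "r > 0" "smooth_on (ball z0 r) f"
  obtains g where "smooth_on UNIV g" "\<forall>z\<in>ball z0 (r / 2). g z = f z"
proof -
  define b where "b z = bump_profile ((r / 2)\<^sup>2) ((3 * r / 4)\<^sup>2) ((z - z0) \<bullet> (z - z0))" for z
  have lt: "(r / 2)\<^sup>2 < (3 * r / 4)\<^sup>2" using assms(1) by (simp add: power_strict_mono)
  have d: "(z - z0) \<bullet> (z - z0) = (dist z0 z)\<^sup>2" for z
    by (simp add: dist_norm norm_minus_commute dot_square_norm)
  have Ckb: "Ck_on n UNIV b" for n
    unfolding b_def
    by (rule Ck_on_compose[OF _ _ _ Ck_on_bump_profile[OF lt]];
        intro Ck_on_inner Ck_on_diff Ck_on_const Ck_on_bounded_linear bounded_linear_ident UNIV_I open_UNIV)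
  have b1: "b z = 1" if "z \<in> ball z0 (r / 2)" for z
    unfolding b_def d using that by (intro bump_profile_eq_1 lt power_mono) auto
  have b0: "b z = 0" if "dist z0 z \<ge> 3 * r / 4" for z
    unfolding b_def d using that assms(1) by (intro bump_profile_eq_0 power_mono) auto
  define g where "g z = (if z \<in> ball z0 r then b z * f z else 0)" for z
  have "smooth_on UNIV g"
    unfolding smooth_on_open_iff[OF open_UNIV]
  proof (intro allI Ck_on_local[OF open_UNIV])
    fix n and x :: 'a
    show "\<exists>W. open W \<and> x \<in> W \<and> Ck_on n (UNIV \<inter> W) g"
    proof (cases "x \<in> ball z0 r")
      case True
      have "Ck_on n (ball z0 r) (\<lambda>z. b z * f z)"
        using assms(2) by (intro Ck_on_mult Ck_on_subset[OF Ckb]) (auto simp: smooth_on_open_iff)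
      moreover have "Ck_on n (ball z0 r) g \<longleftrightarrow> Ck_on n (ball z0 r) (\<lambda>z. b z * f z)"
        by (rule Ck_on_cong) (auto simp: g_def)
      ultimately show ?thesis using True by (intro exI[of _ "ball z0 r"]) auto
    next
      case False
      define W where "W = - cball z0 (3 * r / 4)"
      have W: "open W" "x \<in> W" using False assms(1) by (auto simp: W_def)
      have "Ck_on n W g \<longleftrightarrow> Ck_on n W (\<lambda>_. 0::real)"
        by (rule Ck_on_cong) (use W b0 in \<open>auto simp: g_def W_def\<close>)
      then show ?thesis using W by (intro exI[of _ W]) (auto intro: Ck_on_const)
    qed
  qed
  moreover have "\<forall>z\<in>ball z0 (r / 2). g z = f z"
    using b1 assms(1) by (auto simp: g_def)
  ultimately show ?thesis by (rule that)
qed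

section \<open>Smooth local inverses of maps of the plane\<close>

definition cross2 :: "real^2 \<Rightarrow> real^2 \<Rightarrow> real" where
  "cross2 a b = a$1 * b$2 - a$2 * b$1"

lemma real2_eq_axes: "(x::real^2) = x$1 *\<^sub>R axis 1 1 + x$2 *\<^sub>R axis 2 1"
  by (simp add: vec_eq_iff forall_2 axis_def)

lemma linear_real2:
  fixes L :: "real^2 \<Rightarrow> 'b::real_vector"
  assumes "linear L"
  shows "L x = x$1 *\<^sub>R L (axis 1 1) + x$2 *\<^sub>R L (axis 2 1)"
  by (subst real2_eq_axes) (simp add: linear_add[OF assms] linear_scale[OF assms])

lemma linear_inj_real2_cross2:
  fixes L :: "real^2 \<Rightarrow> real^2"
  assumes "linear L" "inj L"
  shows "cross2 (L (axis 1 1)) (L (axis 2 1)) \<noteq> 0"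
proof
  let ?A = "L (axis 1 1)" and ?B = "L (axis 2 1)"
  assume 0: "cross2 ?A ?B = 0"
  have "L (\<chi> k. if k = 1 then ?B$j else - ?A$j) = 0" for j
    unfolding linear_real2[OF assms(1), of "\<chi> k. if k = 1 then ?B$j else - ?A$j"]
    using 0 exhaust_2[of j] by (auto simp: vec_eq_iff forall_2 cross2_def algebra_simps)
  then have "(\<chi> k. if k = 1 then ?B$j else - ?A$j) = (0::real^2)" for j
    using assms linear_injective_0 by blast
  then have "?A = 0" by (simp add: vec_eq_iff forall_2)
  then have "axis 1 1 = (0::real^2)" using assms linear_injective_0 by blast
  then show False by (simp add: axis_eq_0_iff)
qed

text \<open>This is Cramer's rule.\<close>

lemma inv_linear_real2:
  fixes L :: "real^2 \<Rightarrow> real^2"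
  assumes "linear L" "inj L"
  defines "A \<equiv> L (axis 1 1)" and "B \<equiv> L (axis 2 1)"
  shows "inv L v = (cross2 v B / cross2 A B) *\<^sub>R axis 1 1 + (cross2 A v / cross2 A B) *\<^sub>R axis 2 1"
proof (rule inv_f_eq[OF assms(2)])
  have nz: "A$1 * B$2 - A$2 * B$1 \<noteq> 0"
    using linear_inj_real2_cross2[OF assms(1,2)] by (simp add: A_def B_def cross2_def)
  show "L ((cross2 v B / cross2 A B) *\<^sub>R axis 1 1 + (cross2 A v / cross2 A B) *\<^sub>R axis 2 1) = v"
    unfolding linear_add[OF assms(1)] linear_scale[OF assms(1)] A_def[symmetric] B_def[symmetric]
    using nz by (simp add: vec_eq_iff forall_2 cross2_def divide_simps) (simp add: algebra_simps)
qed

text \<open>By Cramer's rule the derivative of the local inverse \<open>k\<close> is a rational expression in the partial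
derivatives of \<open>g\<close> at \<open>k(y)\<close>. If \<open>k\<close> has class \<open>C\<^sup>n\<close>, then so does its derivative, and \<open>k\<close> has class
\<open>C\<^sup>n\<^sup>+\<^sup>1\<close>.\<close>

lemma smooth_inverse_function:
  fixes g :: "real^2 \<Rightarrow> real^2"
  assumes "open V" "smooth_on V g" "u \<in> V" "inj (frechet_derivative g (at u))"
  obtains U' W k where "open U'" "U' \<subseteq> V" "u \<in> U'" "open W" "g u \<in> W" "homeomorphism U' W g k"
    "smooth_on W k"
proof -
  let ?D = "\<lambda>x. frechet_derivative g (at x)"
  define f' where "f' x = Blinfun (?D x)" for x
  have D: "(g has_derivative ?D x) (at x)" if "x \<in> V" for x
    using smooth_on_has_derivative[OF assms(1,2) that] .
  then have bl: "bounded_linear (?D x)" if "x \<in> V" for x using has_derivative_bounded_linear that by blast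
  have f': "blinfun_apply (f' x) = ?D x" if "x \<in> V" for x
    unfolding f'_def using bl[OF that] by (rule bounded_linear_Blinfun_apply)
  have cont: "continuous_on V f'"
  proof (rule continuous_on_blinfun_componentwise)
    fix i :: "real^2"
    have "continuous_on V (\<lambda>x. ?D x i)"
      using smooth_on_imp_continuous_on[OF smooth_on_frechet[OF assms(1,2)]] .
    then show "continuous_on V (\<lambda>x. blinfun_apply (f' x) i)"
      by (rule continuous_on_eq) (simp add: f')
  qed
  have lin: "linear (?D u)" using bl[OF assms(3)] by (rule bounded_linear.linear)
  obtain L where L: "linear L" "L \<circ> ?D u = id"
    using linear_injective_left_inverse[OF lin assms(4)] by blast
  have "bounded_linear L" using L(1) by (rule linear_linear[THEN iffD2])
  then have inv: "Blinfun L o\<^sub>L f' u = id_blinfun"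
    using L(2) by (intro blinfun_eqI) (simp add: bounded_linear_Blinfun_apply f'[OF assms(3)] fun_eq_iff)
  have derg: "(g has_derivative blinfun_apply (f' x)) (at x)" if "x \<in> V" for x
    using D[OF that] f'[OF that] by simp
  show ?thesis
  proof (rule inverse_function_theorem[OF assms(1) derg cont assms(3) inv])
    fix U' W k k'
    assume U': "open U'" "U' \<subseteq> V" "u \<in> U'" "open W" "g u \<in> W" "homeomorphism U' W g k"
      and k': "\<And>y. y \<in> W \<Longrightarrow> (k has_derivative (k' y)) (at y)"
        "\<And>y. y \<in> W \<Longrightarrow> k' y = inv (blinfun_apply (f'(k y)))"
        "\<And>y. y \<in> W \<Longrightarrow> bij (blinfun_apply (f'(k y)))"
    have kV: "k y \<in> V" if "y \<in> W" for y
      using that U'(2,6) by (auto simp: homeomorphism_def)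
    have kinj: "inj (?D (k y))" if "y \<in> W" for y
      using k'(3)[OF that] f'[OF kV[OF that]] by (simp add: bij_is_inj)
    have klin: "linear (?D (k y))" if "y \<in> W" for y
      using bl[OF kV[OF that]] by (rule bounded_linear.linear)
    define A where "A y = ?D (k y) (axis 1 1)" for y
    define B where "B y = ?D (k y) (axis 2 1)" for y
    have AB: "cross2 (A y) (B y) \<noteq> 0" if "y \<in> W" for y
      unfolding A_def B_def using linear_inj_real2_cross2[OF klin kinj] that by blast
    have dk: "(k has_derivative (\<lambda>v. (cross2 v (B y) / cross2 (A y) (B y)) *\<^sub>R axis 1 1 +
        (cross2 (A y) v / cross2 (A y) (B y)) *\<^sub>R axis 2 1)) (at y)" if "y \<in> W" for y
    proof -
      have "k' y = (\<lambda>v. (cross2 v (B y) / cross2 (A y) (B y)) *\<^sub>R axis 1 1 +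
        (cross2 (A y) v / cross2 (A y) (B y)) *\<^sub>R axis 2 1)"
        unfolding k'(2)[OF that] f'[OF kV[OF that]] A_def B_def
        by (rule ext) (rule inv_linear_real2[OF klin[OF that] kinj[OF that]])
      then show ?thesis using k'(1)[OF that] by simp
    qed
    have "Ck_on n W k" for n
    proof (induction n)
      case 0
      then show ?case using U'(6) by (simp add: homeomorphism_def)
    next
      case (Suc n)
      have comp: "Ck_on n W (\<lambda>y. ?D (k y) v)" for v
      proof -
        have "Ck_on n V (\<lambda>x. ?D x v)"
          using smooth_on_frechet[OF assms(1,2), of v] smooth_on_open_iff[OF assms(1)] by blast
        then show ?thesis using Ck_on_compose[OF U'(4) assms(1) Suc] kV by blast
      qed
      have cc: "Ck_on n W (\<lambda>y. a y $ i)" if "Ck_on n W a" for a :: "real^2 \<Rightarrow> real^2" and i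
        using Ck_on_linear_compose[OF U'(4) bounded_linear_vec_nth that] .
      have cr: "Ck_on n W (\<lambda>y. cross2 (a y) (b y))" if "Ck_on n W a" "Ck_on n W b" for a b :: "real^2 \<Rightarrow> real^2"
        unfolding cross2_def by (intro Ck_on_diff Ck_on_mult cc that U'(4))
      show ?case
      proof (rule Ck_on_SucI[OF U'(4) dk])
        fix v
        show "Ck_on n W (\<lambda>y. (cross2 v (B y) / cross2 (A y) (B y)) *\<^sub>R axis 1 1 +
             (cross2 (A y) v / cross2 (A y) (B y)) *\<^sub>R axis 2 1)"
          unfolding A_def B_def
          by (intro Ck_on_add Ck_on_scaleR Ck_on_divide cr comp Ck_on_const U'(4) AB[unfolded A_def B_def])
      qed
    qed
    then have "smooth_on W k" using U'(4) by (simp add: smooth_on_open_iff)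
    then show thesis by (rule that[OF U'])
  qed
qed

section \<open>Linear algebra of \<open>\<real>\<^sup>5\<close> with two negative squares\<close>

lemma exhaust_5: fixes x :: 5 shows "x = 1 \<or> x = 2 \<or> x = 3 \<or> x = 4 \<or> x = 5"
proof (induct x)
  case (of_int z)
  then have "0 \<le> z" and "z < 5" by simp_all
  then have "z = 0 \<or> z = 1 \<or> z = 2 \<or> z = 3 \<or> z = 4" by arith
  then show ?case by auto
qed

lemma forall_5: "(\<forall>i::5. P i) \<longleftrightarrow> P 1 \<and> P 2 \<and> P 3 \<and> P 4 \<and> P 5"
  by (metis exhaust_5)

lemma UNIV_5: "UNIV = {1, 2, 3, 4, 5::5}"
  using exhaust_5 by auto

lemma sum_5: "sum f (UNIV::5 set) = f 1 + f 2 + f 3 + f 4 + f 5"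
  unfolding UNIV_5 by (simp add: ac_simps)

lemma prod_5: "prod f (UNIV::5 set) = f 1 * f 2 * f 3 * f 4 * f 5"
  unfolding UNIV_5 by (simp add: ac_simps)

lemma vector_5 [simp]:
  "(vector [a,b,c,d,e] :: ('a::zero)^5)$1 = a"
  "(vector [a,b,c,d,e] :: ('a::zero)^5)$2 = b"
  "(vector [a,b,c,d,e] :: ('a::zero)^5)$3 = c"
  "(vector [a,b,c,d,e] :: ('a::zero)^5)$4 = d"
  "(vector [a,b,c,d,e] :: ('a::zero)^5)$5 = e"
  unfolding vector_def by simp_all

lemma inner52_commute: "inner52 x y = inner52 y x"
  by (simp add: inner52_def mult.commute)

lemma bounded_bilinear_inner52: "bounded_bilinear inner52"
proof -
  define L :: "real^5 \<Rightarrow> real^5" where "L y = vector [- y$1, - y$2, y$3, y$4, y$5]" for y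
  have "linear L"
    by (rule linearI) (simp_all add: L_def vec_eq_iff forall_5)
  then have L: "bounded_linear L" by (simp add: linear_linear)
  have "inner52 = (\<lambda>x y. x \<bullet> L y)"
    by (intro ext) (simp add: inner52_def L_def inner_vec_def sum_5)
  then show ?thesis
    using bounded_bilinear.comp[OF bounded_bilinear_inner bounded_linear_ident L] by simp
qed

interpretation inner52: bounded_bilinear inner52
  by (rule bounded_bilinear_inner52)

lemmas inner52_simps = inner52.add_left inner52.add_right inner52.diff_left inner52.diff_right
  inner52.scaleR_left inner52.scaleR_right inner52.minus_left inner52.minus_right

text \<open>The order is that of a point of \<^const>\<open>H41\<close> followed by a Darboux frame there, so the first two
vectors are timelike and the signs of the squares are those of the diagonal of the form itself.\<close>

definition pseudo_frame :: "real^5 \<Rightarrow> real^5 \<Rightarrow> real^5 \<Rightarrow> real^5 \<Rightarrow> real^5 \<Rightarrow> bool" where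
  "pseudo_frame x a b c d \<longleftrightarrow> inner52 x x = -1 \<and> inner52 a a = -1 \<and> inner52 b b = 1 \<and> inner52 c c = 1 \<and>
     inner52 d d = 1 \<and> inner52 x a = 0 \<and> inner52 x b = 0 \<and> inner52 x c = 0 \<and> inner52 x d = 0 \<and>
     inner52 a b = 0 \<and> inner52 a c = 0 \<and> inner52 a d = 0 \<and> inner52 b c = 0 \<and> inner52 b d = 0 \<and> inner52 c d = 0"

definition eta5 :: "real^5^5" where
  "eta5 = (\<chi> i j. if i = j then (if i = 1 \<or> i = 2 then -1 else 1) else 0)"

lemma matrix_mult_eta5: "((A :: real^5^5) ** eta5) $ i $ j = (if j = 1 \<or> j = 2 then - A $ i $ j else A $ i $ j)"
  using exhaust_5[of j] by (auto simp: eta5_def matrix_matrix_mult_def sum_5)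

lemma eta5_mult_vector: "(eta5 *v w) $ j = (if j = 1 \<or> j = 2 then - w $ j else w $ j)"
  using exhaust_5[of j] by (auto simp: eta5_def matrix_vector_mult_def sum_5)

lemma gram_eta5: "((M :: real^5^5) ** eta5 ** transpose M) $ i $ j = inner52 (M $ i) (M $ j)"
  unfolding matrix_matrix_mult_def[of "M ** eta5"] by (simp add: matrix_mult_eta5 transpose_def sum_5 inner52_def)

lemma eta5_involution: "eta5 ** eta5 = mat 1"
  by (simp add: vec_eq_iff matrix_mult_eta5 forall_5) (simp add: eta5_def mat_def)

lemma det_eta5: "det eta5 = 1"
  by (subst det_diagonal) (simp_all add: eta5_def prod_5)

lemma det_gram_eta5: "det (M ** eta5 ** transpose M) = (det M)\<^sup>2"
  by (simp add: det_mul det_eta5 power2_eq_square)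

lemma pseudo_frame_gram:
  assumes "pseudo_frame x a b c d"
  shows "vector [x, a, b, c, d] ** eta5 ** transpose (vector [x, a, b, c, d]) = eta5"
  using assms
  by (simp add: vec_eq_iff[where 'b=5] forall_5 gram_eta5)
    (simp add: eta5_def pseudo_frame_def inner52_commute[of b a] inner52_commute[of c a] inner52_commute[of d a]
        inner52_commute[of a x] inner52_commute[of b x] inner52_commute[of c x] inner52_commute[of d x]
        inner52_commute[of c b] inner52_commute[of d b] inner52_commute[of d c])

text \<open>The Gram equation \<open>M \<eta> M\<^sup>T = \<eta>\<close> makes \<open>\<eta> M \<eta>\<close> a left inverse of \<open>M\<^sup>T\<close>, hence a right inverse. Applied
to \<open>v\<close>, this is the expansion of \<open>v\<close> in the frame.\<close>

lemma pseudo_frame_expand: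
  assumes "pseudo_frame x a b c d"
  shows "v = - inner52 v x *\<^sub>R x - inner52 v a *\<^sub>R a + inner52 v b *\<^sub>R b + inner52 v c *\<^sub>R c + inner52 v d *\<^sub>R d"
proof -
  define M where "M = (vector [x, a, b, c, d] :: real^5^5)"
  have "(eta5 ** M ** eta5) ** transpose M = eta5 ** (M ** eta5 ** transpose M)"
    by (simp only: matrix_mul_assoc)
  then have "(eta5 ** M ** eta5) ** transpose M = mat 1"
    using pseudo_frame_gram[OF assms, folded M_def] eta5_involution by simp
  then have "transpose M ** (eta5 ** M ** eta5) = mat 1"
    by (simp add: matrix_left_right_inverse)
  then have "v = (transpose M ** (eta5 ** M ** eta5)) *v v" by simp
  also have "\<dots> = transpose M *v (eta5 *v (M *v (eta5 *v v)))"
    by (simp only: matrix_vector_mul_assoc matrix_mul_assoc)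
  also have "\<dots> = (\<chi> j. \<Sum>i\<in>UNIV. M $ i $ j * (eta5 *v (M *v (eta5 *v v))) $ i)"
    unfolding matrix_vector_mult_def[of "transpose M"] by (simp add: transpose_def)
  also have "\<dots> = - inner52 v x *\<^sub>R x - inner52 v a *\<^sub>R a + inner52 v b *\<^sub>R b + inner52 v c *\<^sub>R c + inner52 v d *\<^sub>R d"
  proof -
    have 2: "(M *v (eta5 *v v)) $ i = inner52 v (M $ i)" for i
      unfolding matrix_vector_mult_def[of M] by (simp add: eta5_mult_vector sum_5 inner52_def mult.commute)
    show ?thesis
      by (simp add: vec_eq_iff sum_5 eta5_mult_vector[of "M *v (eta5 *v v)"] 2) (simp add: M_def mult.commute)
  qed
  finally show ?thesis .
qed

definition det5 :: "real^5 \<Rightarrow> real^5 \<Rightarrow> real^5 \<Rightarrow> real^5 \<Rightarrow> real^5 \<Rightarrow> real" where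
  "det5 x a b c d = det (vector [x, a, b, c, d] :: real^5^5)"

lemma pseudo_frame_det5_nonzero: "pseudo_frame x a b c d \<Longrightarrow> det5 x a b c d \<noteq> 0"
  using arg_cong[OF pseudo_frame_gram[of x a b c d], of det] unfolding det5_def det_gram_eta5 det_eta5 by auto

lemma linear_det_row:
  fixes c :: "5 \<Rightarrow> real^5"
  shows "linear (\<lambda>v. det ((\<chi> i. if i = k then v else c i) :: real^5^5))"
  using det_row_add[of k "\<lambda>_. _" "\<lambda>_. _" c] det_row_mul[of k _ "\<lambda>_. _" c, unfolded scalar_mult_eq_scaleR]
  by (intro linearI) simp_all

lemma linear_det5:
  "linear (\<lambda>v. det5 x v b c d)" "linear (\<lambda>v. det5 x a v c d)"
  "linear (\<lambda>v. det5 x a b v d)" "linear (\<lambda>v. det5 x a b c v)"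
proof -
  have 2: "det5 x v b c d = det (\<chi> i. if i = 2 then v else vector [x, 0, b, c, d] $ i)" for v
    unfolding det5_def by (rule arg_cong[of _ _ det]) (simp add: vec_eq_iff[of "vector _"] forall_5)
  have 3: "det5 x a v c d = det (\<chi> i. if i = 3 then v else vector [x, a, 0, c, d] $ i)" for v
    unfolding det5_def by (rule arg_cong[of _ _ det]) (simp add: vec_eq_iff[of "vector _"] forall_5)
  have 4: "det5 x a b v d = det (\<chi> i. if i = 4 then v else vector [x, a, b, 0, d] $ i)" for v
    unfolding det5_def by (rule arg_cong[of _ _ det]) (simp add: vec_eq_iff[of "vector _"] forall_5)
  have 5: "det5 x a b c v = det (\<chi> i. if i = 5 then v else vector [x, a, b, c, 0] $ i)" for v
    unfolding det5_def by (rule arg_cong[of _ _ det]) (simp add: vec_eq_iff[of "vector _"] forall_5)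
  show "linear (\<lambda>v. det5 x v b c d)" "linear (\<lambda>v. det5 x a v c d)"
    "linear (\<lambda>v. det5 x a b v d)" "linear (\<lambda>v. det5 x a b c v)"
    unfolding 2 3 4 5 by (rule linear_det_row)+
qed

lemmas det5_simps = linear_add[OF linear_det5(1)] linear_add[OF linear_det5(2)] linear_add[OF linear_det5(3)]
  linear_add[OF linear_det5(4)] linear_scale[OF linear_det5(1)] linear_scale[OF linear_det5(2)]
  linear_scale[OF linear_det5(3)] linear_scale[OF linear_det5(4)]
  linear_diff[OF linear_det5(2)] linear_neg[OF linear_det5(1)]  linear_neg[OF linear_det5(2)]

lemma det5_same:
  "det5 x a x c d = 0" "det5 x a a c d = 0" "det5 x a c c d = 0" "det5 x a d c d = 0" "det5 x a b c c = 0"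
  unfolding det5_def
  subgoal by (rule det_identical_rows[of 1 3]) (simp_all add: row_def)
  subgoal by (rule det_identical_rows[of 2 3]) (simp_all add: row_def)
  subgoal by (rule det_identical_rows[of 3 4]) (simp_all add: row_def)
  subgoal by (rule det_identical_rows[of 3 5]) (simp_all add: row_def)
  subgoal by (rule det_identical_rows[of 4 5]) (simp_all add: row_def)
  done

lemma det5_swap: "det5 x b a c d = - det5 x a b c d" "det5 x a b d c = - det5 x a b c d"
proof -
  have "det5 x (a + b) (a + b) c d = det5 x a b c d + det5 x b a c d"
    by (simp only: det5_simps) (simp add: det5_same)
  then have "det5 x a b c d + det5 x b a c d = 0" by (simp only: det5_same)
  then show "det5 x b a c d = - det5 x a b c d" by linarith
  have "det5 x a b (c + d) (c + d) = det5 x a b c d + det5 x a b d c"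
    by (simp only: det5_simps) (simp add: det5_same)
  then have "det5 x a b c d + det5 x a b d c = 0" by (simp only: det5_same)
  then show "det5 x a b d c = - det5 x a b c d" by linarith
qed

text \<open>In the normal plane, the map \<open>v \<mapsto> \<star>(x \<and> v \<and> c \<and> d)\<close> exchanges \<open>a\<close> and \<open>b\<close> up to a common sign, and
\<open>a + b\<close> is one of its eigenvectors. The identity expresses this without the Hodge star; it is what
distinguishes the line of \<open>a + b\<close> from that of \<open>a - b\<close> by the orientation alone.\<close>

lemma det5_null_normal:
  assumes "pseudo_frame x a b c d"
  shows "det5 x (a + b) v c d = det5 x a b c d * inner52 (a + b) v"
proof -
  have "det5 x (a + b) v c d = det5 x (a + b) (- inner52 v x *\<^sub>R x - inner52 v a *\<^sub>R a + inner52 v b *\<^sub>R b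
      + inner52 v c *\<^sub>R c + inner52 v d *\<^sub>R d) c d"
    using pseudo_frame_expand[OF assms, of v] by simp
  also have "\<dots> = det5 x a b c d * inner52 (a + b) v"
    by (simp add: det5_simps det5_same det5_swap(1)[of x a b] inner52_simps inner52_commute algebra_simps)
  finally show ?thesis .
qed

lemma null_normal_unique:
  assumes f: "pseudo_frame x a b c d"
    and "inner52 v x = 0" "inner52 v c = 0" "inner52 v d = 0" "inner52 v (a + b) = 0"
  shows "v = inner52 v b *\<^sub>R (a + b)"
proof -
  have "inner52 v a = - inner52 v b" using assms(5) by (simp add: inner52_simps)
  then show ?thesis using pseudo_frame_expand[OF f, of v] assms(2-4) by (simp add: scaleR_add_right)
qed

text \<open>Both \<open>N = a + b\<close> and \<open>N' = a' + b'\<close> satisfy \<open>det5_null_normal\<close>, with factors of the same sign relative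
to the basis \<open>p, q\<close> of the tangent plane. Evaluated on each other, they make the alternating expression
\<open>det5 x N N' p q\<close> a multiple of \<open>\<langle>N,N'\<rangle>\<close> in two ways, with factors of opposite signs. Hence \<open>\<langle>N,N'\<rangle> = 0\<close>, and orthogonal
null vectors of a Lorentzian plane are proportional.\<close>

lemma null_normal_line_unique:
  assumes f: "pseudo_frame x a b c d" and f': "pseudo_frame x a' b' c' d'"
    and cd: "c = p1 *\<^sub>R p + p2 *\<^sub>R q" "d = q1 *\<^sub>R p + q2 *\<^sub>R q" "p1 * q2 - p2 * q1 > 0"
    and cd': "c' = p1' *\<^sub>R p + p2' *\<^sub>R q" "d' = q1' *\<^sub>R p + q2' *\<^sub>R q" "p1' * q2' - p2' * q1' > 0"
    and o: "\<sigma> * det5 x a b c d > 0" "\<sigma> * det5 x a' b' c' d' > 0"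
  shows "\<exists>k. a' + b' = k *\<^sub>R (a + b)"
proof -
  let ?N = "a + b" and ?N' = "a' + b'"
  have e: "det5 x n v (p1 *\<^sub>R p + p2 *\<^sub>R q) (q1 *\<^sub>R p + q2 *\<^sub>R q) = (p1 * q2 - p2 * q1) * det5 x n v p q"
    for n v p1 p2 q1 q2
    by (simp add: det5_simps det5_same det5_swap(2)[of x n v p q] algebra_simps)
  have 1: "(p1 * q2 - p2 * q1) * det5 x ?N ?N' p q = det5 x a b c d * inner52 ?N ?N'"
    using det5_null_normal[OF f, of ?N'] cd e by simp
  have 2: "(p1' * q2' - p2' * q1') * det5 x ?N' ?N p q = det5 x a' b' c' d' * inner52 ?N' ?N"
    using det5_null_normal[OF f', of ?N] cd' e by simp
  define w where "w = \<sigma> * det5 x ?N ?N' p q"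
  have 3: "(p1 * q2 - p2 * q1) * w = (\<sigma> * det5 x a b c d) * inner52 ?N ?N'"
    using 1 by (simp add: w_def algebra_simps)
  have 4: "- ((p1' * q2' - p2' * q1') * w) = (\<sigma> * det5 x a' b' c' d') * inner52 ?N ?N'"
    using 2 by (simp add: w_def det5_swap(1)[of x ?N ?N'] inner52_commute[of ?N' ?N] algebra_simps)
  have 0: "inner52 ?N ?N' = 0"
  proof (rule ccontr)
    assume "inner52 ?N ?N' \<noteq> 0"
    then consider "inner52 ?N ?N' > 0" | "inner52 ?N ?N' < 0" by linarith
    then show False
    proof cases
      case 1
      then have "(p1 * q2 - p2 * q1) * w > 0" "- ((p1' * q2' - p2' * q1') * w) > 0"
        unfolding 3 4 using o by simp_all
      then show False using cd(3) cd'(3) by (simp add: zero_less_mult_iff mult_less_0_iff)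
    next
      case 2
      then have "(p1 * q2 - p2 * q1) * w < 0" "- ((p1' * q2' - p2' * q1') * w) < 0"
        unfolding 3 4 using o by (simp_all add: mult_pos_neg)
      then show False using cd(3) cd'(3) by (simp add: zero_less_mult_iff mult_less_0_iff)
    qed
  qed
  have T: "inner52 ?N' p = 0 \<and> inner52 ?N' q = 0"
  proof -
    have A: "p1' * inner52 ?N' p + p2' * inner52 ?N' q = 0" "q1' * inner52 ?N' p + q2' * inner52 ?N' q = 0"
      using f' unfolding pseudo_frame_def cd'(1,2) inner52_simps by (simp_all add: algebra_simps)
    have "(p1' * q2' - p2' * q1') * inner52 ?N' p = 0" using A by algebra
    moreover have "(p1' * q2' - p2' * q1') * inner52 ?N' q = 0" using A by algebra
    ultimately show ?thesis using cd'(3) by simp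
  qed
  have "?N' = inner52 ?N' b *\<^sub>R (a + b)"
  proof (rule null_normal_unique[OF f])
    show "inner52 ?N' x = 0" using f' by (simp add: pseudo_frame_def inner52_simps inner52_commute)
    show "inner52 ?N' c = 0" "inner52 ?N' d = 0" using T cd by (simp_all add: inner52_simps)
    show "inner52 ?N' (a + b) = 0" using 0 by (simp add: inner52_commute)
  qed
  then show ?thesis by blast
qed

text \<open>For dimensional reasons there is a nonzero vector \<open>w\<close> orthogonal to the four given ones. It is
spacelike: the Gram determinant of the five vectors is \<open>\<langle>w,w\<rangle>\<close>, and it is also the square of their
determinant, which does not vanish because they are linearly independent.\<close>

lemma normal_vector_exists:
  assumes x: "inner52 x x = -1" "inner52 a a = -1" "inner52 c c = 1" "inner52 d d = 1"
     "inner52 x a = 0" "inner52 x c = 0" "inner52 x d = 0" "inner52 a c = 0" "inner52 a d = 0" "inner52 c d = 0"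
  obtains b where "pseudo_frame x a b c d"
proof -
  define L :: "real^5 \<Rightarrow> real^5" where "L y = vector [- y$1, - y$2, y$3, y$4, y$5]" for y
  have LL: "L (L y) = y" for y by (simp add: L_def vec_eq_iff forall_5)
  have dotL: "y \<bullet> L z = inner52 y z" for y z
    by (simp add: inner52_def L_def inner_vec_def sum_5)
  have "dim (span {x, a, c, d}) < DIM(real^5)"
  proof -
    have "dim {x, a, c, d} \<le> card {x, a, c, d}" by (rule dim_le_card') simp
    also have "\<dots> \<le> 4" by (simp add: card_insert_if)
    finally show ?thesis by simp
  qed
  then have "dim {x, a, c, d} < DIM(real^5)" by simp
  then obtain y where y: "y \<noteq> 0" "\<And>z. z \<in> span {x, a, c, d} \<Longrightarrow> orthogonal y z"
    using orthogonal_to_subspace_exists by blast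
  \<comment> \<open>The map \<open>L\<close> turns Euclidean orthogonality into orthogonality for the form.\<close>
  define w where "w = L y"
  have w0: "w \<noteq> 0" using y(1) LL[of y] by (auto simp: w_def L_def vec_eq_iff forall_5)
  have wo: "inner52 z w = 0" if "z \<in> {x, a, c, d}" for z
    using y(2)[of z] that span_base[OF that] by (simp add: w_def dotL[symmetric] LL orthogonal_def inner_commute)
  have wo': "inner52 w z = 0" if "z \<in> {x, a, c, d}" for z
    using wo[OF that] by (simp add: inner52_commute)
  have x': "inner52 a x = 0" "inner52 c x = 0" "inner52 d x = 0" "inner52 c a = 0" "inner52 d a = 0" "inner52 d c = 0"
    using x by (simp_all add: inner52_commute)
  let ?M = "vector [x, a, w, c, d] :: real^5^5"
  have "\<exists>B. ?M ** B = mat 1"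
    unfolding matrix_right_invertible_independent_rows
  proof (intro allI impI)
    fix k :: "5 \<Rightarrow> real" and i
    assume "(\<Sum>i\<in>UNIV. k i *s row i ?M) = 0"
    then have s: "k 1 *\<^sub>R x + k 2 *\<^sub>R a + k 3 *\<^sub>R w + k 4 *\<^sub>R c + k 5 *\<^sub>R d = 0"
      by (simp add: sum_5 row_def scalar_mult_eq_scaleR)
    have i: "inner52 (k 1 *\<^sub>R x + k 2 *\<^sub>R a + k 3 *\<^sub>R w + k 4 *\<^sub>R c + k 5 *\<^sub>R d) z = 0" for z
      unfolding s by (rule inner52.zero_left)
    have "k 1 = 0" using i[of x] x x' wo wo' by (simp add: inner52_simps)
    moreover have "k 2 = 0" using i[of a] x x' wo wo' by (simp add: inner52_simps)
    moreover have "k 4 = 0" using i[of c] x x' wo wo' by (simp add: inner52_simps)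
    moreover have "k 5 = 0" using i[of d] x x' wo wo' by (simp add: inner52_simps)
    moreover have "k 3 = 0" using s calculation w0 by simp
    ultimately show "k i = 0" using exhaust_5[of i] by auto
  qed
  then have "det ?M \<noteq> 0"
    using invertible_det_nz matrix_left_right_inverse by (metis invertible_def)
  moreover have "(det ?M)\<^sup>2 = (\<Prod>i\<in>UNIV. inner52 (?M $ i) (?M $ i))"
    unfolding det_gram_eta5[symmetric]
  proof (subst det_diagonal)
    fix i j :: 5 assume "i \<noteq> j"
    then show "(?M ** eta5 ** transpose ?M) $ i $ j = 0"
      unfolding gram_eta5 using exhaust_5[of i] exhaust_5[of j] x x' wo wo'
      by (elim disjE) simp_all
  qed (simp add: gram_eta5)
  moreover have "\<dots> = inner52 w w" using x by (simp add: prod_5)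
  ultimately have pos: "inner52 w w > 0" by (metis zero_less_power2)
  define b where "b = (1 / sqrt (inner52 w w)) *\<^sub>R w"
  have "inner52 b b = 1" using pos by (simp add: b_def inner52_simps power2_eq_square[symmetric] real_sqrt_pow2)
  then have "pseudo_frame x a b c d"
    using x wo wo' by (auto simp: pseudo_frame_def b_def inner52_simps)
  then show ?thesis using that by blast
qed

section \<open>Darboux frames along a spacelike patch\<close>

lemma derivative_zero_of_constant_on_open:
  assumes "open V" "u \<in> V" "\<And>v. v \<in> V \<Longrightarrow> g v = c" "(g has_derivative D) (at u)"
  shows "D h = 0"
proof -
  have "((\<lambda>_. c) has_derivative D) (at u)"
    using has_derivative_transform_within_open[OF assms(4,1,2)] assms(3) by auto
  then have "D = (\<lambda>_. 0)" using has_derivative_unique[OF _ has_derivative_const] by blast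
  then show ?thesis by simp
qed

lemma open_Collect_preimage:
  assumes "open T" "open V" "continuous_on V g"
  shows "open {u \<in> V. g u \<in> T}"
  using continuous_open_preimage[OF assms(3,2,1)] by (simp add: vimage_def Int_def)

lemma differentiable_inner52:
  "a differentiable at u \<Longrightarrow> b differentiable at u \<Longrightarrow> (\<lambda>u. inner52 (a u) (b u)) differentiable at u"
  unfolding differentiable_def using bounded_bilinear.FDERIV[OF bounded_bilinear_inner52] by blast

text \<open>The sign \<open>s\<close> is \<open>1\<close> for spacelike and \<open>-1\<close> for timelike vectors.\<close>

definition normalize52 :: "real \<Rightarrow> real^5 \<Rightarrow> real^5" where
  "normalize52 s v = (1 / sqrt (s * inner52 v v)) *\<^sub>R v"

lemma differentiable_normalize52:
  fixes v :: "'a::euclidean_space \<Rightarrow> real^5"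
  assumes "v differentiable at u" "s * inner52 (v u) (v u) > 0"
  shows "(\<lambda>u. normalize52 s (v u)) differentiable at u"
proof -
  have "(\<lambda>u. s * inner52 (v u) (v u)) differentiable at u"
    by (intro differentiable_mult differentiable_const differentiable_inner52 assms)
  then obtain D where D: "((\<lambda>u. s * inner52 (v u) (v u)) has_derivative D) (at u)"
    unfolding differentiable_def by blast
  have "(\<lambda>u. sqrt (s * inner52 (v u) (v u))) differentiable at u"
    using has_derivative_real_sqrt[OF assms(2) D] unfolding differentiable_def by blast
  then have "(\<lambda>u. 1 / sqrt (s * inner52 (v u) (v u))) differentiable at u"
    using assms(2) by (intro differentiable_divide differentiable_const) auto
  then show ?thesis unfolding normalize52_def by (intro differentiable_scaleR assms)
qed

lemma inner52_normalize52:
  assumes "s = 1 \<or> s = -1" "s * inner52 v v > 0"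
  shows "inner52 (normalize52 s v) (normalize52 s v) = s"
  using assms by (auto simp: normalize52_def inner52_simps power2_eq_square[symmetric] divide_simps)

lemma inner52_normalize52_0: "inner52 v w = 0 \<Longrightarrow> inner52 (normalize52 s v) w = 0"
  by (simp add: normalize52_def inner52_simps)

definition frame4 :: "'v \<Rightarrow> 'v \<Rightarrow> 'v \<Rightarrow> 'v \<Rightarrow> nat \<Rightarrow> 'v" where
  "frame4 a b c d i = (if i = 1 then a else if i = 2 then b else if i = 3 then c else d)"

lemma nat_1_4: "{1..4::nat} = {1, 2, 3, 4}" by auto

lemma det_vector_2: "det (vector [a, b] :: real^2^2) = a$1 * b$2 - a$2 * b$1"
  by (simp add: det_2)

lemma darboux_frame_iff:
  assumes "F u \<in> H41"
  shows "darboux_frame \<sigma> F u e \<longleftrightarrow> pseudo_frame (F u) (e 1) (e 2) (e 3) (e 4) \<and>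
    \<sigma> * det5 (F u) (e 1) (e 2) (e 3) (e 4) > 0 \<and>
    (\<exists>a b. e 3 = frechet_derivative F (at u) a \<and> e 4 = frechet_derivative F (at u) b \<and>
        det (vector [a, b] :: real^2^2) > 0)"
proof -
  have "(\<forall>i\<in>{1..4}. e i \<in> tangent_H41 (F u)) \<and>
     (\<forall>i\<in>{1..4}. \<forall>j\<in>{1..4}. inner52 (e i) (e j) = (if i = j then (if i = 1 then -1 else 1) else 0)) \<longleftrightarrow>
     pseudo_frame (F u) (e 1) (e 2) (e 3) (e 4)"
    using assms unfolding nat_1_4 pseudo_frame_def tangent_H41_def H41_def ball_simps inner52_commute[of "e 2" "e 1"]
      inner52_commute[of "e 3" "e 1"] inner52_commute[of "e 4" "e 1"]
      inner52_commute[of "e 3" "e 2"] inner52_commute[of "e 4" "e 2"] inner52_commute[of "e 4" "e 3"]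
    by simp blast
  then show ?thesis
    unfolding darboux_frame_def pos_oriented_H41_def det5_def by (simp only: conj_assoc[symmetric])
qed

lemma continuous_on_det5:
  assumes "continuous_on S x" "continuous_on S a" "continuous_on S b" "continuous_on S c" "continuous_on S d"
  shows "continuous_on S (\<lambda>u. det5 (x u) (a u) (b u) (c u) (d u))"
proof -
  have "continuous_on S (\<lambda>u. (vector [x u, a u, b u, c u, d u] :: real^5^5) $ i $ j)" for i j
    using exhaust_5[of i] assms by (auto intro: continuous_intros)
  then show ?thesis unfolding det5_def det_def
    by (intro continuous_on_sum continuous_on_mult continuous_on_prod continuous_on_const) 
qed

text \<open>The map \<open>F\<close> is the immersion in a chart, so that the local arguments take place on an open set of
\<open>\<real>\<^sup>2\<close>.\<close>

locale spacelike_patch =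
  fixes V :: "(real^2) set" and F :: "real^2 \<Rightarrow> real^5"
  assumes V: "open V" and smooth: "smooth_on V F" and H41: "\<And>u. u \<in> V \<Longrightarrow> F u \<in> H41"
    and spacelike: "\<And>u a. u \<in> V \<Longrightarrow> a \<noteq> 0 \<Longrightarrow>
       inner52 (frechet_derivative F (at u) a) (frechet_derivative F (at u) a) > 0"
begin

abbreviation "dF u \<equiv> frechet_derivative F (at u)"

lemma F_deriv: "u \<in> V \<Longrightarrow> (F has_derivative dF u) (at u)"
  by (rule smooth_on_has_derivative[OF V smooth])

lemma dF_linear: "u \<in> V \<Longrightarrow> linear (dF u)"
  using F_deriv has_derivative_linear by blast

lemma inner52_F: "u \<in> V \<Longrightarrow> inner52 (F u) (F u) = -1"
  using H41 by (simp add: H41_def)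

lemma F_dF: assumes "u \<in> V" shows "inner52 (F u) (dF u a) = 0"
proof -
  have "((\<lambda>u. inner52 (F u) (F u)) has_derivative (\<lambda>a. inner52 (F u) (dF u a) + inner52 (dF u a) (F u))) (at u)"
    using bounded_bilinear.FDERIV[OF bounded_bilinear_inner52 F_deriv[OF assms] F_deriv[OF assms]] .
  from derivative_zero_of_constant_on_open[OF V assms inner52_F this, of a]
  show ?thesis by (simp add: inner52_commute)
qed

lemma dF_smooth: "smooth_on V (\<lambda>u. dF u a)"
  by (rule smooth_on_frechet[OF V smooth])

lemma dF_deriv: "u \<in> V \<Longrightarrow> ((\<lambda>u. dF u b) has_derivative frechet_derivative (\<lambda>u. dF u b) (at u)) (at u)"
  by (rule smooth_on_has_derivative[OF V dF_smooth])

lemmas darboux_iff = darboux_frame_iff[of F u for u, OF H41]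

text \<open>The frame is obtained by orthonormalisation. The tangent vectors \<open>c, d\<close> come from the coordinate
fields. The timelike normal vector \<open>a\<close> comes from \<open>(F\<^sub>2,-F\<^sub>1,0,0,0)\<close>, which is timelike and orthogonal
to \<open>F\<close>; removing its tangent part only makes its square more negative. The vector \<open>b\<close> is a correctly
oriented normal vector at \<open>u\<^sub>0\<close>, kept constant and projected to the other normal spaces; near \<open>u\<^sub>0\<close> the
projection remains spacelike and correctly oriented.\<close>

lemma darboux_frame_field:
  assumes \<sigma>: "\<sigma> = 1 \<or> \<sigma> = -1" and u0: "u0 \<in> V"
  obtains W a b c d where "open W" "u0 \<in> W" "W \<subseteq> V"
    "\<And>u. u \<in> W \<Longrightarrow> darboux_frame \<sigma> F u (frame4 (a u) (b u) (c u) (d u))"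
    "\<And>u. u \<in> W \<Longrightarrow> a differentiable at u" "\<And>u. u \<in> W \<Longrightarrow> b differentiable at u"
proof -
  define p where "p u = dF u (axis 1 1)" for u
  define q where "q u = dF u (axis 2 1)" for u
  define c where "c u = normalize52 1 (p u)" for u
  define q' where "q' u = q u - inner52 (q u) (c u) *\<^sub>R c u" for u
  define d where "d u = normalize52 1 (q' u)" for u
  define w where "w u = (vector [F u $ 2, - F u $ 1, 0, 0, 0] :: real^5)" for u
  define w' where "w' u = w u - inner52 (w u) (c u) *\<^sub>R c u - inner52 (w u) (d u) *\<^sub>R d u" for u
  define a where "a u = normalize52 (-1) (w' u)" for u
  have pp: "inner52 (p u) (p u) > 0" if "u \<in> V" for u
    unfolding p_def using that by (intro spacelike) auto
  have cdF: "c u = dF u ((1 / sqrt (inner52 (p u) (p u))) *\<^sub>R axis 1 1)" if "u \<in> V" for u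
    using that by (simp add: c_def normalize52_def p_def linear_scale[OF dF_linear])
  define \<beta> where "\<beta> u = (axis 2 1 :: real^2) - (inner52 (q u) (c u) / sqrt (inner52 (p u) (p u))) *\<^sub>R axis 1 (1::real)" for u
  have q'dF: "q' u = dF u (\<beta> u)" if "u \<in> V" for u
    using that by (simp add: q'_def \<beta>_def q_def linear_diff[OF dF_linear] linear_scale[OF dF_linear]
        cdF[OF that])
  have q'q': "inner52 (q' u) (q' u) > 0" if "u \<in> V" for u
    unfolding q'dF[OF that] using that
    by (intro spacelike) (auto simp: \<beta>_def vec_eq_iff axis_def intro!: exI[of _ 2])
  have cc: "inner52 (c u) (c u) = 1" if "u \<in> V" for u
    unfolding c_def using pp[OF that] by (intro inner52_normalize52) auto
  have dd: "inner52 (d u) (d u) = 1" if "u \<in> V" for u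
    unfolding d_def using q'q'[OF that] by (intro inner52_normalize52) auto
  have cd: "inner52 (d u) (c u) = 0" if "u \<in> V" for u
    unfolding d_def by (intro inner52_normalize52_0) (simp add: q'_def inner52_simps cc[OF that])
  have cd': "inner52 (c u) (d u) = 0" if "u \<in> V" for u using cd[OF that] by (simp add: inner52_commute)
  have Fc: "inner52 (F u) (c u) = 0" if "u \<in> V" for u unfolding cdF[OF that] by (rule F_dF[OF that])
  have Fd: "inner52 (F u) (d u) = 0" if "u \<in> V" for u
    using inner52_normalize52_0[of "q' u" "F u" 1] F_dF[OF that, of "\<beta> u"]
    by (simp add: d_def q'dF[OF that] inner52_commute)
  have ww: "inner52 (w u) (w u) < 0" if "u \<in> V" for u
  proof -
    have "(F u $ 1)\<^sup>2 + (F u $ 2)\<^sup>2 = 1 + (F u $ 3)\<^sup>2 + (F u $ 4)\<^sup>2 + (F u $ 5)\<^sup>2"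
      using inner52_F[OF that] by (simp add: inner52_def power2_eq_square)
    then have "(F u $ 1)\<^sup>2 + (F u $ 2)\<^sup>2 > 0"
      by (smt (verit) zero_le_power2)
    then show ?thesis by (simp add: w_def inner52_def power2_eq_square)
  qed
  have Fw: "inner52 (F u) (w u) = 0" for u by (simp add: w_def inner52_def)
  have w'w': "- 1 * inner52 (w' u) (w' u) > 0" if "u \<in> V" for u
  proof -
    have "inner52 (w' u) (w' u) = inner52 (w u) (w u) - (inner52 (w u) (c u))\<^sup>2 - (inner52 (w u) (d u))\<^sup>2"
      unfolding w'_def inner52_simps cc[OF that] dd[OF that] cd[OF that] cd'[OF that]
      by (simp add: inner52_commute[of "c u" "w u"] inner52_commute[of "d u" "w u"] power2_eq_square algebra_simps)
    then show ?thesis using ww[OF that] by (smt (verit) zero_le_power2)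
  qed
  have aa: "inner52 (a u) (a u) = -1" if "u \<in> V" for u
    unfolding a_def using w'w'[OF that] by (intro inner52_normalize52) auto
  have ac: "inner52 (a u) (c u) = 0" "inner52 (a u) (d u) = 0" "inner52 (a u) (F u) = 0" if "u \<in> V" for u
    unfolding a_def
    by (rule inner52_normalize52_0; simp add: w'_def inner52_simps cc[OF that] dd[OF that] cd[OF that] cd'[OF that]
        Fw Fc[OF that] Fd[OF that] inner52_commute[of "c u" "F u"] inner52_commute[of "d u" "F u"] inner52_commute[of "w u" "F u"])+
  have Fa: "inner52 (F u) (a u) = 0" if "u \<in> V" for u using ac(3)[OF that] by (simp add: inner52_commute)
  obtain b1 where b1: "pseudo_frame (F u0) (a u0) b1 (c u0) (d u0)"
    by (rule normal_vector_exists[of "F u0" "a u0" "c u0" "d u0"])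
      (use u0 inner52_F aa cc dd Fa Fc Fd ac cd' in auto)
  define s where "s = sgn (\<sigma> * det5 (F u0) (a u0) b1 (c u0) (d u0))"
  have s: "s = 1 \<or> s = -1" using pseudo_frame_det5_nonzero[OF b1] \<sigma> by (auto simp: s_def sgn_if)
  define b0 where "b0 = s *\<^sub>R b1"
  have b0: "pseudo_frame (F u0) (a u0) b0 (c u0) (d u0)"
    using b1 s by (auto simp: pseudo_frame_def b0_def inner52_simps)
  have det0: "\<sigma> * det5 (F u0) (a u0) b0 (c u0) (d u0) > 0"
    using pseudo_frame_det5_nonzero[OF b1] \<sigma> by (auto simp: b0_def det5_simps s_def sgn_if mult_neg_pos not_less_iff_gr_or_eq)
  define m where "m u = b0 + inner52 b0 (F u) *\<^sub>R F u + inner52 b0 (a u) *\<^sub>R a u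
      - inner52 b0 (c u) *\<^sub>R c u - inner52 b0 (d u) *\<^sub>R d u" for u
  have b0': "inner52 b0 (F u0) = 0" "inner52 b0 (a u0) = 0" "inner52 b0 (c u0) = 0" "inner52 b0 (d u0) = 0"
    using b0 inner52_commute[of b0 "F u0"] inner52_commute[of b0 "a u0"] unfolding pseudo_frame_def by simp_all
  have m0: "m u0 = b0" by (simp add: m_def b0')
  define b where "b u = normalize52 1 (m u)" for u
  have mo: "inner52 (m u) (F u) = 0" "inner52 (m u) (a u) = 0" "inner52 (m u) (c u) = 0" "inner52 (m u) (d u) = 0"
    if "u \<in> V" for u
    using that by (simp_all add: m_def inner52_simps inner52_F aa cc dd Fa Fc Fd ac cd cd'
        inner52_commute[of "c u" "a u"] inner52_commute[of "d u" "a u"] inner52_commute[of "c u" "F u"]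
        inner52_commute[of "d u" "F u"] inner52_commute[of "a u" "F u"])
  have dif: "F differentiable at u" "p differentiable at u" "q differentiable at u" if "u \<in> V" for u
    using F_deriv[OF that] dF_deriv[OF that] unfolding p_def[abs_def] q_def[abs_def] differentiable_def by blast+
  have difc: "c differentiable at u" if "u \<in> V" for u
    unfolding c_def[abs_def] using pp[OF that] by (intro differentiable_normalize52 dif that) simp
  have difd: "d differentiable at u" if "u \<in> V" for u
    unfolding d_def[abs_def]
  proof (rule differentiable_normalize52)
    show "q' differentiable at u" unfolding q'_def[abs_def]
      by (intro differentiable_diff differentiable_scaleR differentiable_inner52 dif difc that)
    show "1 * inner52 (q' u) (q' u) > 0" using q'q'[OF that] by simp
  qed
  have difw: "w differentiable at u" if "u \<in> V" for u
  proof -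
    have "linear (\<lambda>x::real^5. vector [x $ 2, - x $ 1, 0, 0, 0] :: real^5)"
      by (rule linearI) (simp_all add: vec_eq_iff forall_5)
    then have "bounded_linear (\<lambda>x::real^5. vector [x $ 2, - x $ 1, 0, 0, 0] :: real^5)"
      by (simp add: linear_linear)
    from bounded_linear.has_derivative[OF this F_deriv[OF that]]
    show ?thesis unfolding w_def[abs_def] differentiable_def by blast
  qed
  have difa: "a differentiable at u" if "u \<in> V" for u
    unfolding a_def[abs_def]
  proof (rule differentiable_normalize52)
    show "w' differentiable at u" unfolding w'_def[abs_def]
      by (intro differentiable_diff differentiable_scaleR differentiable_inner52 difw difc difd that)
    show "- 1 * inner52 (w' u) (w' u) > 0" by (rule w'w'[OF that])
  qed
  have difm: "m differentiable at u" if "u \<in> V" for u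
    unfolding m_def[abs_def]
    by (intro differentiable_diff differentiable_add differentiable_scaleR differentiable_inner52
        differentiable_const dif difa difc difd that)
  define W where "W = {u \<in> V. inner52 (m u) (m u) > 0 \<and> \<sigma> * det5 (F u) (a u) (m u) (c u) (d u) > 0}"
  have cont: "continuous_on V g" if "\<And>u. u \<in> V \<Longrightarrow> g differentiable at u" for g :: "real^2 \<Rightarrow> real^5"
    using that by (simp add: continuous_at_imp_continuous_on differentiable_imp_continuous_within)
  have "open {u \<in> V. inner52 (m u) (m u) \<in> {0<..}}"
    by (intro open_Collect_preimage V bounded_bilinear.continuous_on[OF bounded_bilinear_inner52] cont difm) auto
  moreover have "open {u \<in> V. \<sigma> * det5 (F u) (a u) (m u) (c u) (d u) \<in> {0<..}}"
    by (intro open_Collect_preimage V continuous_on_mult continuous_on_const continuous_on_det5 cont dif difa difm difc difd) auto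
  ultimately have "open ({u \<in> V. inner52 (m u) (m u) \<in> {0<..}} \<inter> {u \<in> V. \<sigma> * det5 (F u) (a u) (m u) (c u) (d u) \<in> {0<..}})"
    by (rule open_Int)
  moreover have "{u \<in> V. inner52 (m u) (m u) \<in> {0<..}} \<inter> {u \<in> V. \<sigma> * det5 (F u) (a u) (m u) (c u) (d u) \<in> {0<..}} = W"
    unfolding W_def by auto
  ultimately have "open W" by simp
  moreover have "u0 \<in> W" using u0 m0 b0 det0 by (simp add: W_def pseudo_frame_def)
  moreover have "W \<subseteq> V" by (auto simp: W_def)
  moreover have "darboux_frame \<sigma> F u (frame4 (a u) (b u) (c u) (d u))" if "u \<in> W" for u
  proof -
    have u: "u \<in> V" and pos: "inner52 (m u) (m u) > 0" "\<sigma> * det5 (F u) (a u) (m u) (c u) (d u) > 0"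
      using that by (auto simp: W_def)
    have bb: "inner52 (b u) (b u) = 1" unfolding b_def using pos by (intro inner52_normalize52) auto
    have bo: "inner52 (b u) (F u) = 0" "inner52 (b u) (a u) = 0" "inner52 (b u) (c u) = 0" "inner52 (b u) (d u) = 0"
      unfolding b_def by (intro inner52_normalize52_0 mo[OF u])+
    have "pseudo_frame (F u) (a u) (b u) (c u) (d u)"
      using inner52_F aa cc dd Fa Fc Fd ac cd' bb bo u
      by (auto simp: pseudo_frame_def inner52_commute[of "a u" "b u"] inner52_commute[of "F u" "b u"])
    moreover have "\<sigma> * det5 (F u) (a u) (b u) (c u) (d u) = 1 / sqrt (inner52 (m u) (m u)) * (\<sigma> * det5 (F u) (a u) (m u) (c u) (d u))"
      by (simp add: b_def normalize52_def det5_simps)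
    then have "\<sigma> * det5 (F u) (a u) (b u) (c u) (d u) > 0" using pos by simp
    moreover have "\<exists>\<alpha> \<gamma>. c u = dF u \<alpha> \<and> d u = dF u \<gamma> \<and> det (vector [\<alpha>, \<gamma>] :: real^2^2) > 0"
    proof (intro exI conjI)
      show "c u = dF u ((1 / sqrt (inner52 (p u) (p u))) *\<^sub>R axis 1 1)" by (rule cdF[OF u])
      show "d u = dF u ((1 / sqrt (inner52 (q' u) (q' u))) *\<^sub>R \<beta> u)"
        by (simp add: d_def normalize52_def linear_scale[OF dF_linear[OF u]] q'dF[OF u])
      show "det (vector [(1 / sqrt (inner52 (p u) (p u))) *\<^sub>R axis 1 1, (1 / sqrt (inner52 (q' u) (q' u))) *\<^sub>R \<beta> u] :: real^2^2) > 0"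
        using pp[OF u] q'q'[OF u] by (simp add: det_vector_2 \<beta>_def axis_def)
    qed
    ultimately show ?thesis by (simp add: darboux_iff[OF u] frame4_def)
  qed
  moreover have "a differentiable at u" if "u \<in> W" for u using difa that by (simp add: W_def)
  moreover have "b differentiable at u" if "u \<in> W" for u
    unfolding b_def[abs_def] using that difm by (intro differentiable_normalize52) (auto simp: W_def)
  ultimately show ?thesis using that by blast
qed

text \<open>All Darboux frames at \<open>u\<close> yield the same null line, by \<open>null_normal_line_unique\<close> for the coordinate
basis of the tangent plane.\<close>

lemma TN_plus_eq:
  assumes u: "u \<in> V" and e: "darboux_frame \<sigma> F u e"
  shows "TN_plus \<sigma> F u = range (\<lambda>k. k *\<^sub>R (e 1 + e 2))"
proof
  show "range (\<lambda>k. k *\<^sub>R (e 1 + e 2)) \<subseteq> TN_plus \<sigma> F u"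
    using e by (auto simp: TN_plus_def)
  have comb: "dF u a = a$1 *\<^sub>R dF u (axis 1 1) + a$2 *\<^sub>R dF u (axis 2 1)" for a
    by (rule linear_real2[OF dF_linear[OF u]])
  have "\<exists>k. e' 1 + e' 2 = k *\<^sub>R (e 1 + e 2)" if e': "darboux_frame \<sigma> F u e'" for e'
  proof -
    obtain a b where ab: "e 3 = dF u a" "e 4 = dF u b" "det (vector [a, b] :: real^2^2) > 0"
      using e darboux_iff[OF u] by blast
    obtain a' b' where ab': "e' 3 = dF u a'" "e' 4 = dF u b'" "det (vector [a', b'] :: real^2^2) > 0"
      using e' darboux_iff[OF u] by blast
    show ?thesis
    proof (rule null_normal_line_unique)
      show "pseudo_frame (F u) (e 1) (e 2) (e 3) (e 4)" "pseudo_frame (F u) (e' 1) (e' 2) (e' 3) (e' 4)"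
        "\<sigma> * det5 (F u) (e 1) (e 2) (e 3) (e 4) > 0" "\<sigma> * det5 (F u) (e' 1) (e' 2) (e' 3) (e' 4) > 0"
        using e e' darboux_iff[OF u] by blast+
      show "e 3 = a$1 *\<^sub>R dF u (axis 1 1) + a$2 *\<^sub>R dF u (axis 2 1)"
        "e 4 = b$1 *\<^sub>R dF u (axis 1 1) + b$2 *\<^sub>R dF u (axis 2 1)"
        "e' 3 = a'$1 *\<^sub>R dF u (axis 1 1) + a'$2 *\<^sub>R dF u (axis 2 1)"
        "e' 4 = b'$1 *\<^sub>R dF u (axis 1 1) + b'$2 *\<^sub>R dF u (axis 2 1)"
        using ab(1,2) ab'(1,2) comb by metis+
      show "a $ 1 * b $ 2 - a $ 2 * b $ 1 > 0" "a' $ 1 * b' $ 2 - a' $ 2 * b' $ 1 > 0"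
        using ab(3) ab'(3) by (simp_all add: det_vector_2)
    qed
  qed
  then show "TN_plus \<sigma> F u \<subseteq> range (\<lambda>k. k *\<^sub>R (e 1 + e 2))"
    unfolding TN_plus_def by (force simp: scaleR_scaleR)
qed

lemma normal_to_dF:
  assumes u: "u \<in> V" and e: "darboux_frame \<sigma> F u e"
    and n: "inner52 n (e 3) = 0" "inner52 n (e 4) = 0"
  shows "inner52 n (dF u z) = 0"
proof -
  obtain p q where pq: "e 3 = dF u p" "e 4 = dF u q" "det (vector [p, q] :: real^2^2) > 0"
    using e darboux_iff[OF u] by blast
  define i where "i = inner52 n (dF u (axis 1 1))"
  define j where "j = inner52 n (dF u (axis 2 1))"
  have ij: "inner52 n (dF u z) = z$1 * i + z$2 * j" for z
    by (subst linear_real2[OF dF_linear[OF u]]) (simp add: inner52_simps i_def j_def)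
  have 1: "p$1 * i + p$2 * j = 0" "q$1 * i + q$2 * j = 0" using n pq(1,2) by (simp_all add: ij[symmetric])
  have "(p$1 * q$2 - p$2 * q$1) * i = 0" "(p$1 * q$2 - p$2 * q$1) * j = 0" using 1 by algebra+
  then have "i = 0" "j = 0" using pq(3) by (simp_all add: det_vector_2)
  then show ?thesis by (simp add: ij)
qed

text \<open>The second derivative differs from the second fundamental form by a multiple of \<open>F\<close> and by a tangent
vector. The null vector \<open>e\<^sub>1 + e\<^sub>2\<close> is orthogonal to both, and to its own multiples.\<close>

lemma second_derivative_normal_to_TN_plus:
  assumes u: "u \<in> V" and e: "darboux_frame \<sigma> F u e"
    and II: "second_ff F u a b \<in> TN_plus \<sigma> F u"
  shows "inner52 (e 1 + e 2) (frechet_derivative (\<lambda>u. dF u b) (at u) a) = 0"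
proof -
  let ?N = "e 1 + e 2"
  define w where "w = frechet_derivative (\<lambda>u. dF u b) (at u) a"
  define C where "C = cov_deriv F u a b"
  have C: "C = w + inner52 w (F u) *\<^sub>R F u" by (simp add: C_def cov_deriv_def w_def Let_def)
  have pf: "pseudo_frame (F u) (e 1) (e 2) (e 3) (e 4)" using e darboux_iff[OF u] by blast
  obtain p q where pq: "e 3 = dF u p" "e 4 = dF u q" "det (vector [p, q] :: real^2^2) > 0"
    using e darboux_iff[OF u] by blast
  define n0 where "n0 = C - inner52 C (e 3) *\<^sub>R e 3 - inner52 C (e 4) *\<^sub>R e 4"
  let ?P = "\<lambda>n. n \<in> normal_space F u \<and> C - n \<in> range (dF u)"
  have "?P n0"
  proof
    have "inner52 (F u) n0 = 0"
      unfolding n0_def C using pf inner52_F[OF u]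
      by (simp add: inner52_simps pseudo_frame_def inner52_commute[of w "F u"])
    moreover have "inner52 n0 (e 3) = 0" "inner52 n0 (e 4) = 0"
      using pf by (simp_all add: n0_def inner52_simps pseudo_frame_def inner52_commute[of "e 4" "e 3"])
    ultimately show "n0 \<in> normal_space F u"
      using normal_to_dF[OF u e] by (simp add: normal_space_def tangent_H41_def)
    have "C - n0 = dF u (inner52 C (e 3) *\<^sub>R p + inner52 C (e 4) *\<^sub>R q)"
      by (simp add: n0_def pq(1,2) linear_add[OF dF_linear[OF u]] linear_scale[OF dF_linear[OF u]])
    then show "C - n0 \<in> range (dF u)" by blast
  qed
  moreover have "n = n0" if n: "?P n" for n
  proof -
    obtain k k0 where k: "C - n = dF u k" "C - n0 = dF u k0" using n \<open>?P n0\<close> by blast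
    have "n0 - n = (C - n) - (C - n0)" by simp
    also have "\<dots> = dF u (k - k0)" unfolding k by (simp add: linear_diff[OF dF_linear[OF u]])
    finally have d: "n0 - n = dF u (k - k0)" .
    have "inner52 (n0 - n) (dF u (k - k0)) = 0"
      using n \<open>?P n0\<close> by (simp add: normal_space_def inner52_simps)
    then have "k - k0 = 0" using spacelike[OF u, of "k - k0"] unfolding d by force
    then show ?thesis using d linear_0[OF dF_linear[OF u]] by simp
  qed
  ultimately have "second_ff F u a b = n0"
    unfolding second_ff_def C_def[symmetric] by (intro the_equality)
  then obtain k where k: "n0 = k *\<^sub>R ?N" using II TN_plus_eq[OF u e] by auto
  have "inner52 ?N n0 = 0" unfolding k using pf by (simp add: inner52_simps pseudo_frame_def inner52_commute[of "e 2" "e (Suc 0)"])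
  moreover have "inner52 ?N n0 = inner52 ?N w"
    unfolding n0_def C using pf
    by (simp add: inner52_simps pseudo_frame_def inner52_commute[of "e (Suc 0)" "F u"] inner52_commute[of "e 2" "F u"])
  ultimately show ?thesis by (simp add: w_def)
qed

text \<open>The field \<open>N = a + b\<close> of the Darboux frames satisfies \<open>dN = \<theta>N\<close>, because \<open>dN\<close> is orthogonal to \<open>F\<close>,
to \<open>N\<close> and to the tangent plane. A field with this property has constant direction.\<close>

lemma TN_plus_locally_constant:
  assumes \<sigma>: "\<sigma> = 1 \<or> \<sigma> = -1" and u0: "u0 \<in> V"
    and II: "\<And>u a b. u \<in> V \<Longrightarrow> second_ff F u a b \<in> TN_plus \<sigma> F u"
  obtains B where "open B" "u0 \<in> B" "B \<subseteq> V" "\<And>u. u \<in> B \<Longrightarrow> TN_plus \<sigma> F u = TN_plus \<sigma> F u0"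
proof -
  obtain W a b c d where W: "open W" "u0 \<in> W" "W \<subseteq> V"
    and dar: "\<And>u. u \<in> W \<Longrightarrow> darboux_frame \<sigma> F u (frame4 (a u) (b u) (c u) (d u))"
    and dif: "\<And>u. u \<in> W \<Longrightarrow> a differentiable at u" "\<And>u. u \<in> W \<Longrightarrow> b differentiable at u"
    using darboux_frame_field[OF \<sigma> u0] by blast
  define N where "N u = a u + b u" for u
  have pf: "pseudo_frame (F u) (a u) (b u) (c u) (d u)" if "u \<in> W" for u
    using dar[OF that] darboux_iff[of u \<sigma> "frame4 (a u) (b u) (c u) (d u)"] W(3) that
    by (auto simp: frame4_def)
  have TN: "TN_plus \<sigma> F u = range (\<lambda>k. k *\<^sub>R N u)" if "u \<in> W" for u
    using TN_plus_eq[OF _ dar[OF that]] W(3) that by (auto simp: N_def frame4_def)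
  define DN where "DN u = frechet_derivative N (at u)" for u
  have DN: "(N has_derivative DN u) (at u)" if "u \<in> W" for u
    unfolding DN_def N_def[abs_def]
    using differentiable_add[OF dif[OF that]] by (simp add: frechet_derivative_works)
  have NN: "inner52 (N u) (N u) = 0" "inner52 (N u) (F u) = 0" "inner52 (N u) (c u) = 0" "inner52 (N u) (d u) = 0"
    if "u \<in> W" for u
    using pf[OF that] by (simp_all add: N_def inner52_simps pseudo_frame_def inner52_commute[of "b u" "a u"] inner52_commute[of "a u" "F u"] inner52_commute[of "b u" "F u"])
  have NdF: "inner52 (N u) (dF u z) = 0" if "u \<in> W" for u z
    using normal_to_dF[OF subsetD[OF W(3) that] dar[OF that], of "N u"] NN(3,4)[OF that] by (simp add: frame4_def)
  have parallel: "\<exists>\<theta>. DN u h = \<theta> *\<^sub>R N u" if u: "u \<in> W" for u h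
  proof -
    have uV: "u \<in> V" using W(3) u by blast
    note FD = bounded_bilinear.FDERIV[OF bounded_bilinear_inner52 DN[OF u]]
    have "inner52 (N u) (DN u h) + inner52 (DN u h) (N u) = 0"
      using derivative_zero_of_constant_on_open[OF W(1) u NN(1) FD[OF DN[OF u]], of h] .
    then have 1: "inner52 (DN u h) (N u) = 0" by (simp add: inner52_commute)
    have "inner52 (N u) (dF u h) + inner52 (DN u h) (F u) = 0"
      using derivative_zero_of_constant_on_open[OF W(1) u NN(2) FD[OF F_deriv[OF uV]], of h] .
    then have 2: "inner52 (DN u h) (F u) = 0" using NdF[OF u] by simp
    have 3: "inner52 (DN u h) (dF u z) = 0" for z
    proof -
      have "inner52 (N u) (frechet_derivative (\<lambda>u. dF u z) (at u) h) + inner52 (DN u h) (dF u z) = 0"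
        using derivative_zero_of_constant_on_open[OF W(1) u NdF FD[OF dF_deriv[OF uV]], of z h] by simp
      moreover have "inner52 (N u) (frechet_derivative (\<lambda>u. dF u z) (at u) h) = 0"
        using second_derivative_normal_to_TN_plus[OF uV dar[OF u] II[OF uV]] by (simp add: frame4_def N_def)
      ultimately show ?thesis by simp
    qed
    obtain p q where pq: "c u = dF u p" "d u = dF u q"
      using dar[OF u] darboux_iff[of u \<sigma> "frame4 (a u) (b u) (c u) (d u)"] uV
      by (auto simp: frame4_def)
    show ?thesis
      using null_normal_unique[OF pf[OF u] 2, of] 1 3 pq unfolding N_def by metis
  qed
  have "N u0 \<noteq> 0"
  proof
    assume "N u0 = 0"
    then have "inner52 (N u0) (b u0) = 0" by (simp add: inner52.zero_left)
    moreover have "inner52 (N u0) (b u0) = 1"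
      using pf[OF W(2)] by (simp add: N_def inner52_simps pseudo_frame_def)
    ultimately show False by simp
  qed
  then obtain k where k: "N u0 $ k \<noteq> 0" by (auto simp: vec_eq_iff)
  have contN: "continuous_on W N"
    using DN by (intro has_derivative_continuous_on[of _ _ DN]) (auto intro: has_derivative_at_withinI)
  have "open {u \<in> W. N u $ k \<in> - {0}}"
    by (intro open_Collect_preimage W(1) continuous_on_component contN) auto
  moreover have "u0 \<in> {u \<in> W. N u $ k \<in> - {0}}" using W(2) k by simp
  ultimately obtain r where r: "r > 0" "ball u0 r \<subseteq> {u \<in> W. N u $ k \<in> - {0}}"
    using open_contains_ball_eq by blast
  \<comment> \<open>Dividing by a component that does not vanish removes the factor \<open>\<theta>\<close>: the derivative of \<open>M\<close> is \<open>0\<close>.\<close>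
  define M where "M u = (1 / N u $ k) *\<^sub>R N u" for u
  have "(M has_derivative (\<lambda>h. 0)) (at u within ball u0 r)" if "u \<in> ball u0 r" for u
  proof -
    have u: "u \<in> W" and nz: "N u $ k \<noteq> 0" using r(2) that by auto
    have Dk: "((\<lambda>u. N u $ k) has_derivative (\<lambda>h. DN u h $ k)) (at u)"
      using bounded_linear.has_derivative[OF bounded_linear_vec_nth DN[OF u]] .
    have "((\<lambda>u. inverse (N u $ k) *\<^sub>R N u) has_derivative
       (\<lambda>h. inverse (N u $ k) *\<^sub>R DN u h + (- (inverse (N u $ k) * (DN u h $ k) * inverse (N u $ k))) *\<^sub>R N u)) (at u)"
      by (intro has_derivative_scaleR Deriv.has_derivative_inverse nz Dk DN[OF u])
    moreover have "inverse (N u $ k) *\<^sub>R DN u h + (- (inverse (N u $ k) * (DN u h $ k) * inverse (N u $ k))) *\<^sub>R N u = 0" for h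
    proof -
      obtain \<theta> where "DN u h = \<theta> *\<^sub>R N u" using parallel[OF u] by blast
      then show ?thesis using nz by (simp add: vec_eq_iff)
    qed
    ultimately have "(M has_derivative (\<lambda>h. 0)) (at u)" unfolding M_def[abs_def] by (simp add: divide_inverse)
    then show ?thesis by (rule has_derivative_at_withinI)
  qed
  then obtain M0 where M0: "\<And>u. u \<in> ball u0 r \<Longrightarrow> M u = M0"
    using has_derivative_zero_constant[OF convex_ball] by blast
  have line: "range (\<lambda>k. k *\<^sub>R N u) = range (\<lambda>k. k *\<^sub>R M0)" if "u \<in> ball u0 r" for u
  proof -
    have nz: "N u $ k \<noteq> 0" using r(2) that by auto
    have "t *\<^sub>R N u = (t * N u $ k) *\<^sub>R M0" "t *\<^sub>R M0 = (t / N u $ k) *\<^sub>R N u" for t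
      using nz by (simp_all add: M0[OF that, symmetric] M_def)
    then show ?thesis by blast
  qed
  show ?thesis
  proof (rule that[of "ball u0 r"])
    fix u assume "u \<in> ball u0 r"
    moreover from this have "u \<in> W" using r(2) by blast
    moreover have "u0 \<in> ball u0 r" using r(1) by simp
    ultimately show "TN_plus \<sigma> F u = TN_plus \<sigma> F u0"
      using line[of u] line[of u0] TN[of u] TN[OF W(2)] by simp
  qed (use r W in auto)
qed

end

section \<open>The null normal line of a connected surface\<close>

lemma connected_space_locally_constant:
  assumes "connected_space X" and p: "p \<in> topspace X" "q \<in> topspace X"
    and loc: "\<And>p. p \<in> topspace X \<Longrightarrow> \<exists>U. openin X U \<and> p \<in> U \<and> (\<forall>q\<in>U. g q = g p)"
  shows "g q = g p"
proof -
  let ?S = "{q \<in> topspace X. g q = g p}"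
  have "openin X ?S"
  proof (subst openin_subopen, intro ballI)
    fix q assume q: "q \<in> ?S"
    then have "q \<in> topspace X" by simp
    from loc[OF this] obtain U where U: "openin X U" "q \<in> U" "\<forall>r\<in>U. g r = g q" by blast
    have "U \<subseteq> ?S"
    proof
      fix r assume r: "r \<in> U"
      then have "r \<in> topspace X" "g r = g q" using openin_subset[OF U(1)] U(3) by blast+
      then show "r \<in> ?S" using q by simp
    qed
    with U(1,2) show "\<exists>T. openin X T \<and> q \<in> T \<and> T \<subseteq> ?S" by blast
  qed
  moreover have "openin X (topspace X - ?S)"
  proof (subst openin_subopen, intro ballI)
    fix q assume q: "q \<in> topspace X - ?S"
    then have "q \<in> topspace X" by simp
    from loc[OF this] obtain U where U: "openin X U" "q \<in> U" "\<forall>r\<in>U. g r = g q" by blast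
    have "U \<subseteq> topspace X - ?S"
    proof
      fix r assume r: "r \<in> U"
      then have "r \<in> topspace X" "g r = g q" using openin_subset[OF U(1)] U(3) by blast+
      then show "r \<in> topspace X - ?S" using q by simp
    qed
    with U(1,2) show "\<exists>T. openin X T \<and> q \<in> T \<and> T \<subseteq> topspace X - ?S" by blast
  qed
  ultimately have "?S = {} \<or> ?S = topspace X"
    using assms(1) unfolding connected_space_clopen_in closedin_def by auto
  then show ?thesis using p by blast
qed

locale spacelike_surface =
  fixes X :: "'a topology" and A :: "'a atlas" and f :: "'a \<Rightarrow> real^5"
  assumes surface: "spacelike_surface_H41 X A f"
begin

lemma Hausdorff: "Hausdorff_space X" and connected: "connected_space X" and nonempty: "topspace X \<noteq> {}"
  using surface unfolding spacelike_surface_H41_def oriented_surface_def by blast+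

lemma chart_open: "(V, \<psi>) \<in> A \<Longrightarrow> open V"
  and chart_image_open: "(V, \<psi>) \<in> A \<Longrightarrow> openin X (\<psi> ` V)"
  and chart_homeo: "(V, \<psi>) \<in> A \<Longrightarrow> homeomorphic_map (top_of_set V) (subtopology X (\<psi> ` V)) \<psi>"
  using surface unfolding spacelike_surface_H41_def oriented_surface_def by fast+

lemma chart_exists:
  assumes "p \<in> topspace X"
  obtains V \<psi> u where "(V, \<psi>) \<in> A" "u \<in> V" "\<psi> u = p"
proof -
  have "topspace X = (\<Union>(V, \<psi>)\<in>A. \<psi> ` V)"
    using surface by (simp add: spacelike_surface_H41_def oriented_surface_def)
  with assms have "p \<in> (\<Union>(V, \<psi>)\<in>A. \<psi> ` V)" by (simp only:)
  then obtain z where z: "z \<in> A" "p \<in> (case z of (V, \<psi>) \<Rightarrow> \<psi> ` V)" by (rule UN_E)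
  obtain V \<psi> where "z = (V, \<psi>)" by (cases z)
  with z that show ?thesis by auto
qed

lemma chart_inj: "(V, \<psi>) \<in> A \<Longrightarrow> inj_on \<psi> V"
  using homeomorphic_imp_injective_map[OF chart_homeo] by simp

lemma chart_in_X: "(V, \<psi>) \<in> A \<Longrightarrow> u \<in> V \<Longrightarrow> \<psi> u \<in> topspace X"
  using chart_image_open openin_subset by fastforce

lemma chart_continuous: "(V, \<psi>) \<in> A \<Longrightarrow> continuous_map (top_of_set V) X \<psi>"
  using homeomorphic_imp_continuous_map[OF chart_homeo] continuous_map_into_fulltopology by blast

lemma chart_preimage_open:
  assumes "(V, \<psi>) \<in> A" "openin X U" shows "open {u \<in> V. \<psi> u \<in> U}"
  using openin_continuous_map_preimage[OF chart_continuous[OF assms(1)] assms(2)]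
    openin_open_eq[OF chart_open[OF assms(1)]] by simp

lemma chart_image_of_open:
  assumes "(V, \<psi>) \<in> A" "open B" "B \<subseteq> V" shows "openin X (\<psi> ` B)"
proof -
  have "openin (top_of_set V) B" using assms by (simp add: openin_open_eq chart_open)
  then have "openin (subtopology X (\<psi> ` V)) (\<psi> ` B)"
    using homeomorphic_imp_open_map[OF chart_homeo[OF assms(1)]] unfolding open_map_def by blast
  then show ?thesis using openin_trans_full[OF _ chart_image_open[OF assms(1)]] by blast
qed

lemma transition:
  assumes "(V, \<psi>) \<in> A" "(V', \<psi>') \<in> A"
  shows "smooth_on {u \<in> V. \<psi> u \<in> \<psi>' ` V'} (inv_into V' \<psi>' \<circ> \<psi>) \<and>
    (\<forall>u\<in>V. \<psi> u \<in> \<psi>' ` V' \<longrightarrow> det (matrix (frechet_derivative (inv_into V' \<psi>' \<circ> \<psi>) (at u))) > 0)"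
proof -
  have "\<forall>(V, \<psi>)\<in>A. \<forall>(V', \<psi>')\<in>A.
        smooth_on {u\<in>V. \<psi> u \<in> \<psi>' ` V'} (inv_into V' \<psi>' \<circ> \<psi>) \<and>
        (\<forall>u\<in>V. \<psi> u \<in> \<psi>' ` V' \<longrightarrow>
           det (matrix (frechet_derivative (inv_into V' \<psi>' \<circ> \<psi>) (at u))) > 0)"
    using surface unfolding spacelike_surface_H41_def oriented_surface_def by (elim conjE)
  from bspec[OF bspec[OF this assms(1), unfolded prod.case] assms(2), unfolded prod.case] show ?thesis .
qed

lemma transition_smooth:
  assumes "(V, \<psi>) \<in> A" "(V', \<psi>') \<in> A"
  shows "smooth_on {u \<in> V. \<psi> u \<in> \<psi>' ` V'} (inv_into V' \<psi>' \<circ> \<psi>)"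
  using transition[OF assms] by (rule conjunct1)

lemma transition_det:
  assumes "(V, \<psi>) \<in> A" "(V', \<psi>') \<in> A" "u \<in> V" "\<psi> u \<in> \<psi>' ` V'"
  shows "det (matrix (frechet_derivative (inv_into V' \<psi>' \<circ> \<psi>) (at u))) > 0"
  using bspec[OF conjunct2[OF transition[OF assms(1,2)]] assms(3)] assms(4) by (rule mp)

lemma f_H41: "p \<in> topspace X \<Longrightarrow> f p \<in> H41"
  using surface unfolding spacelike_surface_H41_def by blast

lemma patch:
  assumes "(V, \<psi>) \<in> A" shows "spacelike_patch V (f \<circ> \<psi>)"
proof
  have "\<forall>(V, \<psi>)\<in>A. smooth_on V (f \<circ> \<psi>) \<and>
        (\<forall>u\<in>V. inj (frechet_derivative (f \<circ> \<psi>) (at u)) \<and>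
           (\<forall>a. a \<noteq> 0 \<longrightarrow>
              inner52 (frechet_derivative (f \<circ> \<psi>) (at u) a) (frechet_derivative (f \<circ> \<psi>) (at u) a) > 0))"
    using surface unfolding spacelike_surface_H41_def by (elim conjE)
  note s = bspec[OF this assms, unfolded prod.case]
  show "open V" using chart_open[OF assms] .
  show "smooth_on V (f \<circ> \<psi>)" using s by blast
  show "(f \<circ> \<psi>) u \<in> H41" if "u \<in> V" for u using chart_in_X[OF assms that] f_H41 by simp
  show "inner52 (frechet_derivative (f \<circ> \<psi>) (at u) a) (frechet_derivative (f \<circ> \<psi>) (at u) a) > 0"
    if "u \<in> V" "a \<noteq> 0" for u a using s that by blast
qed

lemma f_continuous: "continuous_map X euclidean f"
  unfolding continuous_map_def
proof (intro conjI allI impI)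
  fix T :: "(real^5) set" assume T: "openin euclidean T"
  show "openin X {p \<in> topspace X. f p \<in> T}"
  proof (subst openin_subopen, intro ballI)
    fix p assume p: "p \<in> {p \<in> topspace X. f p \<in> T}"
    then have "p \<in> topspace X" by simp
    then obtain V \<psi> u where c: "(V, \<psi>) \<in> A" "u \<in> V" "\<psi> u = p" by (rule chart_exists)
    interpret spacelike_patch V "f \<circ> \<psi>" by (rule patch[OF c(1)])
    let ?B = "{u \<in> V. (f \<circ> \<psi>) u \<in> T}"
    have "open ?B" using T smooth_on_imp_continuous_on[OF smooth] by (intro open_Collect_preimage V) auto
    then have "openin X (\<psi> ` ?B)" by (intro chart_image_of_open[OF c(1)]) auto
    then show "\<exists>U. openin X U \<and> p \<in> U \<and> U \<subseteq> {p \<in> topspace X. f p \<in> T}"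
      using p c chart_in_X[OF c(1)] by (intro exI[of _ "\<psi> ` ?B"]) auto
  qed
qed auto

lemma chart_change:
  assumes c: "(V, \<psi>) \<in> A" "u \<in> V" and c': "(V', \<psi>') \<in> A" "u' \<in> V'" and eq: "\<psi> u = \<psi>' u'"
  obtains L where "linear L" "det (matrix L) > 0"
    "\<And>a. frechet_derivative (f \<circ> \<psi>) (at u) a = frechet_derivative (f \<circ> \<psi>') (at u') (L a)"
proof -
  let ?O = "{u \<in> V. \<psi> u \<in> \<psi>' ` V'}" and ?t = "inv_into V' \<psi>' \<circ> \<psi>"
  interpret F: spacelike_patch V "f \<circ> \<psi>" by (rule patch[OF c(1)])
  interpret F': spacelike_patch V' "f \<circ> \<psi>'" by (rule patch[OF c'(1)])
  have O: "open ?O" by (rule chart_preimage_open[OF c(1) chart_image_open[OF c'(1)]])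
  have uO: "u \<in> ?O" using c c' eq by auto
  have tu: "?t u = u'" using eq c'(2) chart_inj[OF c'(1)] by (simp add: inv_into_f_f)
  define L where "L = frechet_derivative ?t (at u)"
  have L: "(?t has_derivative L) (at u)"
    unfolding L_def by (rule smooth_on_has_derivative[OF O transition_smooth[OF c(1) c'(1)] uO])
  have "((f \<circ> \<psi>' \<circ> ?t) has_derivative (\<lambda>a. F'.dF u' (L a))) (at u)"
  proof -
    have "((f \<circ> \<psi>') has_derivative F'.dF u') (at (?t u))" unfolding tu by (rule F'.F_deriv[OF c'(2)])
    from has_derivative_compose[OF L this] show ?thesis by (simp only: o_def)
  qed
  then have "((f \<circ> \<psi>) has_derivative (\<lambda>a. F'.dF u' (L a))) (at u)"
  proof (rule has_derivative_transform_within_open[OF _ O uO])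
    show "(f \<circ> \<psi>' \<circ> ?t) v = (f \<circ> \<psi>) v" if "v \<in> ?O" for v
      using that by (auto simp: f_inv_into_f)
  qed
  then have "F.dF u = (\<lambda>a. F'.dF u' (L a))" by (rule frechet_derivative_at[symmetric])
  moreover have "linear L" using L by (rule has_derivative_linear)
  moreover have "det (matrix L) > 0" unfolding L_def using transition_det c c' eq by auto
  ultimately show ?thesis using that by metis
qed

lemma det_vector_2_linear:
  fixes L :: "real^2 \<Rightarrow> real^2"
  assumes "linear L"
  shows "det (vector [L a, L b] :: real^2^2) = det (matrix L) * det (vector [a, b] :: real^2^2)"
  unfolding linear_real2[OF assms, of a] linear_real2[OF assms, of b]
  by (simp add: det_2 matrix_def algebra_simps)

text \<open>The transition maps of the atlas have positive Jacobian, which preserves the orientation condition on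
\<open>(e\<^sub>3,e\<^sub>4)\<close>; all other conditions depend on the immersed point and tangent plane only.\<close>

lemma darboux_frame_chart_change:
  assumes c: "(V, \<psi>) \<in> A" "u \<in> V" and c': "(V', \<psi>') \<in> A" "u' \<in> V'" and eq: "\<psi> u = \<psi>' u'"
    and e: "darboux_frame \<sigma> (f \<circ> \<psi>) u e"
  shows "darboux_frame \<sigma> (f \<circ> \<psi>') u' e"
proof -
  interpret F: spacelike_patch V "f \<circ> \<psi>" by (rule patch[OF c(1)])
  interpret F': spacelike_patch V' "f \<circ> \<psi>'" by (rule patch[OF c'(1)])
  obtain L where L: "linear L" "det (matrix L) > 0" "\<And>a. F.dF u a = F'.dF u' (L a)"
    using chart_change[OF c c' eq] by metis
  obtain a b where ab: "e 3 = F.dF u a" "e 4 = F.dF u b" "det (vector [a, b] :: real^2^2) > 0"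
    using e F.darboux_iff[OF c(2)] by blast
  have "e 3 = F'.dF u' (L a)" "e 4 = F'.dF u' (L b)" "det (vector [L a, L b] :: real^2^2) > 0"
    using ab L by (simp_all add: det_vector_2_linear)
  moreover have "(f \<circ> \<psi>') u' = (f \<circ> \<psi>) u" using eq by simp
  ultimately show ?thesis using e unfolding F'.darboux_iff[OF c'(2)] F.darboux_iff[OF c(2)] by metis
qed

lemma TN_plus_chart_change:
  assumes "(V, \<psi>) \<in> A" "u \<in> V" "(V', \<psi>') \<in> A" "u' \<in> V'" "\<psi> u = \<psi>' u'"
  shows "TN_plus \<sigma> (f \<circ> \<psi>) u = TN_plus \<sigma> (f \<circ> \<psi>') u'"
  using darboux_frame_chart_change[OF assms] darboux_frame_chart_change[OF assms(3,4,1,2) assms(5)[symmetric]]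
  unfolding TN_plus_def by metis

text \<open>The line \<^const>\<open>TN_plus\<close> does not depend on the chart, so it is a function on the surface; this function
is locally constant, hence constant. The position vector is orthogonal to the normal space.\<close>

lemma constant_null_normal:
  assumes \<sigma>: "\<sigma> = 1 \<or> \<sigma> = -1" and iso: "plus_isotropic \<sigma> A f"
  obtains N where "N \<noteq> 0" "inner52 N N = 0" "\<And>p. p \<in> topspace X \<Longrightarrow> inner52 N (f p) = 0"
proof -
  define l where "l p = (SOME l. \<exists>V \<psi> u. (V, \<psi>) \<in> A \<and> u \<in> V \<and> \<psi> u = p \<and> l = TN_plus \<sigma> (f \<circ> \<psi>) u)" for p
  have l: "l (\<psi> u) = TN_plus \<sigma> (f \<circ> \<psi>) u" if c: "(V, \<psi>) \<in> A" "u \<in> V" for V \<psi> u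
  proof -
    have "\<exists>V' \<psi>' u'. (V', \<psi>') \<in> A \<and> u' \<in> V' \<and> \<psi>' u' = \<psi> u \<and> l (\<psi> u) = TN_plus \<sigma> (f \<circ> \<psi>') u'"
      unfolding l_def by (rule someI_ex) (use c in blast)
    then show ?thesis using TN_plus_chart_change[OF _ _ c] by metis
  qed
  have loc: "\<exists>U. openin X U \<and> p \<in> U \<and> (\<forall>q\<in>U. l q = l p)" if "p \<in> topspace X" for p
  proof -
    obtain V \<psi> u where c: "(V, \<psi>) \<in> A" "u \<in> V" "\<psi> u = p" using chart_exists[OF \<open>p \<in> topspace X\<close>] .
    interpret F: spacelike_patch V "f \<circ> \<psi>" by (rule patch[OF c(1)])
    have II: "second_ff (f \<circ> \<psi>) u a b \<in> TN_plus \<sigma> (f \<circ> \<psi>) u" if "u \<in> V" for u a b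
      using iso c(1) that unfolding plus_isotropic_def by fast
    obtain B where B: "open B" "u \<in> B" "B \<subseteq> V" "\<And>v. v \<in> B \<Longrightarrow> TN_plus \<sigma> (f \<circ> \<psi>) v = TN_plus \<sigma> (f \<circ> \<psi>) u"
      using F.TN_plus_locally_constant[OF \<sigma> c(2) II] by blast
    show ?thesis
    proof (intro exI[of _ "\<psi> ` B"] conjI ballI)
      show "openin X (\<psi> ` B)" by (rule chart_image_of_open[OF c(1) B(1,3)])
      show "p \<in> \<psi> ` B" using B c by blast
      fix q assume "q \<in> \<psi> ` B"
      then obtain v where v: "v \<in> B" "q = \<psi> v" by blast
      have "l q = TN_plus \<sigma> (f \<circ> \<psi>) v" unfolding v(2) using v(1) B(3) by (intro l[OF c(1)]) blast
      also have "\<dots> = TN_plus \<sigma> (f \<circ> \<psi>) u" by (rule B(4)[OF v(1)])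
      also have "\<dots> = l p" unfolding c(3)[symmetric] by (rule l[OF c(1,2), symmetric])
      finally show "l q = l p" .
    qed
  qed
  obtain p0 where p0: "p0 \<in> topspace X" using nonempty by blast
  have line: "\<exists>e1 e2. l p = range (\<lambda>k. k *\<^sub>R (e1 + e2)) \<and> inner52 (e1 + e2) (f p) = 0 \<and>
      inner52 (e1 + e2) (e1 + e2) = 0 \<and> e1 + e2 \<noteq> 0" if p: "p \<in> topspace X" for p
  proof -
    obtain V \<psi> u where c: "(V, \<psi>) \<in> A" "u \<in> V" "\<psi> u = p" using chart_exists[OF p] .
    interpret F: spacelike_patch V "f \<circ> \<psi>" by (rule patch[OF c(1)])
    obtain e where e: "darboux_frame \<sigma> (f \<circ> \<psi>) u e"
      using F.darboux_frame_field[OF \<sigma> c(2)] by metis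
    then have pf: "pseudo_frame (f p) (e 1) (e 2) (e 3) (e 4)" using F.darboux_iff[OF c(2)] c(3) by simp
    have "l p = range (\<lambda>k. k *\<^sub>R (e 1 + e 2))" using l[OF c(1,2)] F.TN_plus_eq[OF c(2) e] c(3) by simp
    moreover have "inner52 (e 1 + e 2) (f p) = 0"
      using pf by (simp add: pseudo_frame_def inner52_simps inner52_commute[of "e (Suc 0)" "f p"] inner52_commute[of "e 2" "f p"])
    moreover have "inner52 (e 1 + e 2) (e 1 + e 2) = 0"
      using pf by (simp add: pseudo_frame_def inner52_simps inner52_commute[of "e 2" "e (Suc 0)"])
    moreover have "inner52 (e 1 + e 2) (e 2) = 1"
      using pf by (simp add: pseudo_frame_def inner52_simps)
    then have "e 1 + e 2 \<noteq> 0" by (auto simp: inner52.zero_left)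
    ultimately show ?thesis by blast
  qed
  obtain e1 e2 where N: "l p0 = range (\<lambda>k. k *\<^sub>R (e1 + e2))"
    "inner52 (e1 + e2) (e1 + e2) = 0" "e1 + e2 \<noteq> 0" using line[OF p0] by blast
  have "inner52 (e1 + e2) (f p) = 0" if p: "p \<in> topspace X" for p
  proof -
    obtain d1 d2 where d: "l p = range (\<lambda>k. k *\<^sub>R (d1 + d2))" "inner52 (d1 + d2) (f p) = 0"
      using line[OF p] by blast
    have "l p = l p0" using connected_space_locally_constant[OF connected p0 p loc] .
    moreover have "e1 + e2 \<in> l p0" unfolding N(1) by (rule range_eqI[of _ _ 1]) simp
    ultimately obtain k where "e1 + e2 = k *\<^sub>R (d1 + d2)" using d(1) by auto
    then show ?thesis using d(2) by (simp add: inner52.scaleR_left)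
  qed
  then show ?thesis by (rule that[OF N(3,2)])
qed

end

section \<open>The normal form\<close>

text \<open>For null \<open>w\<close> the division by \<open>0\<close> makes this the identity, so it is an isometric involution for every \<open>w\<close>.\<close>

definition refl52 :: "real^5 \<Rightarrow> real^5 \<Rightarrow> real^5" where
  "refl52 w x = x - (2 * inner52 x w / inner52 w w) *\<^sub>R w"

lemma linear_refl52: "linear (refl52 w)"
  by (rule linearI) (simp_all add: refl52_def inner52_simps algebra_simps add_divide_distrib)

lemma inner52_refl52: "inner52 (refl52 w x) (refl52 w y) = inner52 x y"
  by (simp add: refl52_def inner52_simps inner52_commute[of w x] inner52_commute[of w y] field_simps)

lemma refl52_refl52: "refl52 w (refl52 w x) = x"
  by (cases "inner52 w w = 0") (simp_all add: refl52_def inner52_simps algebra_simps)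

lemma isometry_H41_linear:
  assumes "linear \<Phi>" "linear \<Psi>" "\<And>x. \<Phi> (\<Psi> x) = x" "\<And>x. \<Psi> (\<Phi> x) = x"
    "\<And>x y. inner52 (\<Phi> x) (\<Phi> y) = inner52 x y"
  shows "isometry_H41 \<Phi>"
proof -
  have bl: "bounded_linear \<Phi>" "bounded_linear \<Psi>" using assms by (simp_all add: linear_linear)
  have H: "\<Phi> x \<in> H41 \<longleftrightarrow> x \<in> H41" for x using assms(5) by (simp add: H41_def)
  have bij: "bij_betw \<Phi> H41 H41"
    by (rule bij_betwI[of _ _ _ \<Psi>]) (use H assms(3,4) in \<open>auto, metis\<close>)
  moreover have "smooth_on H41 (inv_into H41 \<Phi>)"
  proof -
    have "inv_into H41 \<Phi> y = \<Psi> y" if "y \<in> H41" for y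
    proof (rule inv_into_f_eq)
      show "inj_on \<Phi> H41" using bij by (rule bij_betw_imp_inj_on)
      show "\<Psi> y \<in> H41" using that H[of "\<Psi> y"] assms(3) by simp
    qed (rule assms(3))
    then show ?thesis using smooth_on_cong[of H41 "inv_into H41 \<Phi>" \<Psi>] smooth_on_bounded_linear[OF bl(2)] by blast
  qed
  ultimately show ?thesis
    unfolding isometry_H41_def using smooth_on_bounded_linear[OF bl(1)] assms(5)
      bounded_linear_imp_has_derivative[OF bl(1)] by blast
qed

text \<open>The two Householder reflections act in the timelike plane and in its spacelike complement, where the
two parts of \<open>N\<close> have equal Euclidean length \<open>r\<close>. The first one takes \<open>(N\<^sub>1,N\<^sub>2)\<close> to \<open>(0,r)\<close>, the second
one takes \<open>(N\<^sub>3,N\<^sub>4,N\<^sub>5)\<close> to \<open>(r,0,0)\<close>.\<close>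

lemma isometry_null_vector:
  assumes "N \<noteq> 0" "inner52 N N = 0"
  obtains \<Phi> \<Psi> k where "linear \<Phi>" "linear \<Psi>" "\<forall>x. \<Phi> (\<Psi> x) = x" "\<forall>x. \<Psi> (\<Phi> x) = x"
    "\<forall>x y. inner52 (\<Phi> x) (\<Phi> y) = inner52 x y" "k \<noteq> 0" "\<Phi> N = k *\<^sub>R vector [0, 1, 1, 0, 0]"
proof -
  define r where "r = sqrt ((N$1)\<^sup>2 + (N$2)\<^sup>2)"
  have e: "(N$1)\<^sup>2 + (N$2)\<^sup>2 = (N$3)\<^sup>2 + (N$4)\<^sup>2 + (N$5)\<^sup>2"
    using assms(2) by (simp add: inner52_def power2_eq_square)
  have "(N$1)\<^sup>2 + (N$2)\<^sup>2 \<noteq> 0"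
  proof
    assume 0: "(N$1)\<^sup>2 + (N$2)\<^sup>2 = 0"
    then have "N$1 = 0" "N$2 = 0" by (simp_all add: sum_power2_eq_zero_iff)
    moreover have "(N$3)\<^sup>2 = 0" "(N$4)\<^sup>2 = 0" "(N$5)\<^sup>2 = 0"
      using e 0 zero_le_power2[of "N$3"] zero_le_power2[of "N$4"] zero_le_power2[of "N$5"] by linarith+
    ultimately show False using assms(1) by (simp add: vec_eq_iff forall_5)
  qed
  then have pos: "(N$1)\<^sup>2 + (N$2)\<^sup>2 > 0" by (smt (verit) zero_le_power2)
  then have r: "r > 0" "r\<^sup>2 = (N$1)\<^sup>2 + (N$2)\<^sup>2" by (simp_all add: r_def)
  define w1 :: "real^5" where "w1 = vector [N$1, N$2 - r, 0, 0, 0]"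
  define w2 :: "real^5" where "w2 = vector [0, 0, N$3 - r, N$4, N$5]"
  define m :: "real^5" where "m = vector [0, r, N$3, N$4, N$5]"
  have 1: "refl52 w1 N = m"
  proof (cases "w1 = 0")
    case True
    then have "N$1 = 0" "N$2 = r" by (simp_all add: w1_def vec_eq_iff forall_5)
    then show ?thesis using True by (simp add: refl52_def m_def vec_eq_iff forall_5)
  next
    case False
    have "inner52 w1 w1 = - ((N$1)\<^sup>2 + (N$2 - r)\<^sup>2)" by (simp add: inner52_def w1_def power2_eq_square)
    moreover have "(N$1)\<^sup>2 + (N$2 - r)\<^sup>2 \<noteq> 0"
      using False by (auto simp: w1_def vec_eq_iff forall_5 sum_power2_eq_zero_iff)
    ultimately have nz: "inner52 w1 w1 \<noteq> 0" by (metis neg_equal_0_iff_equal)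
    have "2 * inner52 N w1 = inner52 w1 w1"
      using r(2) by (simp add: inner52_def w1_def power2_eq_square algebra_simps)
    then have "refl52 w1 N = N - w1" using nz by (simp add: refl52_def)
    then show ?thesis by (simp add: m_def w1_def vec_eq_iff forall_5)
  qed
  have 2: "refl52 w2 m = r *\<^sub>R vector [0, 1, 1, 0, 0]"
  proof (cases "w2 = 0")
    case True
    then have "N$3 = r" "N$4 = 0" "N$5 = 0" by (simp_all add: w2_def vec_eq_iff forall_5)
    then show ?thesis using True by (simp add: refl52_def m_def vec_eq_iff forall_5)
  next
    case False
    have "inner52 w2 w2 = (N$3 - r)\<^sup>2 + (N$4)\<^sup>2 + (N$5)\<^sup>2" by (simp add: inner52_def w2_def power2_eq_square)
    moreover have "(N$3 - r)\<^sup>2 + (N$4)\<^sup>2 + (N$5)\<^sup>2 \<noteq> 0"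
    proof
      assume "(N$3 - r)\<^sup>2 + (N$4)\<^sup>2 + (N$5)\<^sup>2 = 0"
      then have "(N$3 - r)\<^sup>2 = 0" "(N$4)\<^sup>2 = 0" "(N$5)\<^sup>2 = 0"
        using zero_le_power2[of "N$3 - r"] zero_le_power2[of "N$4"] zero_le_power2[of "N$5"] by linarith+
      then show False using False by (simp add: w2_def vec_eq_iff forall_5)
    qed
    ultimately have nz: "inner52 w2 w2 \<noteq> 0" by metis
    have "2 * inner52 m w2 = inner52 w2 w2"
      using r(2) e by (simp add: inner52_def w2_def m_def power2_eq_square algebra_simps)
    then have "refl52 w2 m = m - w2" using nz by (simp add: refl52_def)
    then show ?thesis by (simp add: m_def w2_def vec_eq_iff forall_5)
  qed
  show ?thesis
  proof (rule that[of "refl52 w2 \<circ> refl52 w1" "refl52 w1 \<circ> refl52 w2" r])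
    show "linear (refl52 w2 \<circ> refl52 w1)" "linear (refl52 w1 \<circ> refl52 w2)"
      by (intro linear_compose linear_refl52)+
  qed (use r 1 2 in \<open>simp_all add: refl52_refl52 inner52_refl52\<close>)
qed

text \<open>After the isometry \<open>\<Phi>\<close> the surface lies in the hyperplane orthogonal to \<open>(0,1,1,0,0)\<close>, over the upper
sheet of the hyperboloid.\<close>

locale null_graph_surface = spacelike_surface X A f
  for X :: "'a topology" and A :: "'a atlas" and f :: "'a \<Rightarrow> real^5" +
  fixes \<Phi> :: "real^5 \<Rightarrow> real^5"
  assumes lin: "linear \<Phi>" and iso: "\<And>x y. inner52 (\<Phi> x) (\<Phi> y) = inner52 x y"
    and null: "\<And>p. p \<in> topspace X \<Longrightarrow> \<Phi> (f p) $ 2 = \<Phi> (f p) $ 3"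
    and upper: "\<And>p. p \<in> topspace X \<Longrightarrow> \<Phi> (f p) $ 1 > 0"

text \<open>Once the second and third coordinates agree, the first one satisfies \<open>y\<^sub>1\<^sup>2 = 1 + y\<^sub>2\<^sup>2 + y\<^sub>3\<^sup>2\<close>. It
vanishes nowhere, so its sign is constant on the connected surface and is corrected by the isometry
\<open>-1\<close>, which preserves the null line.\<close>

lemma (in spacelike_surface) normal_form:
  assumes "\<sigma> = 1 \<or> \<sigma> = -1" and "plus_isotropic \<sigma> A f"
  obtains \<Phi> where "isometry_H41 \<Phi>" "null_graph_surface X A f \<Phi>"
proof -
  obtain N where N: "N \<noteq> 0" "inner52 N N = 0" "\<And>p. p \<in> topspace X \<Longrightarrow> inner52 N (f p) = 0"
    using constant_null_normal[OF assms] by blast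
  obtain \<Phi> \<Psi> k where \<Phi>: "linear \<Phi>" "linear \<Psi>" "\<forall>x. \<Phi> (\<Psi> x) = x" "\<forall>x. \<Psi> (\<Phi> x) = x"
    "\<forall>x y. inner52 (\<Phi> x) (\<Phi> y) = inner52 x y" "k \<noteq> 0" "\<Phi> N = k *\<^sub>R vector [0, 1, 1, 0, 0]"
    by (rule isometry_null_vector[OF N(1,2)])
  define g where "g p = \<Phi> (f p)" for p
  have null: "g p $ 2 = g p $ 3" if "p \<in> topspace X" for p
  proof -
    have "inner52 (\<Phi> N) (g p) = 0" using N(3)[OF that] \<Phi>(5) by (simp add: g_def)
    then show ?thesis using \<Phi>(6) unfolding \<Phi>(7) by (simp add: inner52_def)
  qed
  have nz: "g p $ 1 \<noteq> 0" if "p \<in> topspace X" for p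
  proof -
    have "inner52 (g p) (g p) = -1" using f_H41[OF that] \<Phi>(5) by (simp add: g_def H41_def)
    then have "(g p $ 1)\<^sup>2 = 1 + (g p $ 4)\<^sup>2 + (g p $ 5)\<^sup>2"
      using null[OF that] by (simp add: inner52_def power2_eq_square)
    then show ?thesis by (smt (verit) zero_le_power2 power_zero_numeral)
  qed
  have "continuous_map X euclidean (\<lambda>p. g p $ 1)"
  proof -
    have "continuous_map euclidean euclidean (\<lambda>x. \<Phi> x $ 1)"
      using \<Phi>(1) by (auto simp: linear_continuous_on linear_linear intro!: continuous_intros)
    from continuous_map_compose[OF f_continuous this] show ?thesis by (simp add: g_def o_def)
  qed
  then have loc: "\<exists>U. openin X U \<and> p \<in> U \<and> (\<forall>q\<in>U. sgn (g q $ 1) = sgn (g p $ 1))" if p: "p \<in> topspace X" for p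
  proof -
    have c: "openin X {q \<in> topspace X. g q $ 1 \<in> T}" if "open T" for T
      using openin_continuous_map_preimage[OF \<open>continuous_map X euclidean (\<lambda>p. g p $ 1)\<close>] that by simp
    consider "g p $ 1 > 0" | "g p $ 1 < 0" using nz[OF p] by linarith
    then show ?thesis
    proof cases
      case 1
      then show ?thesis using c[of "{0<..}"] p by (intro exI[of _ "{q \<in> topspace X. g q $ 1 \<in> {0<..}}"]) auto
    next
      case 2
      then show ?thesis using c[of "{..<0}"] p by (intro exI[of _ "{q \<in> topspace X. g q $ 1 \<in> {..<0}}"]) auto
    qed
  qed
  obtain p0 where p0: "p0 \<in> topspace X" using nonempty by blast
  define s where "s = sgn (g p0 $ 1)"
  have s: "s * s = 1" using nz[OF p0] by (auto simp: s_def sgn_if)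
  have sg: "sgn (g p $ 1) = s" if "p \<in> topspace X" for p
    unfolding s_def using connected_space_locally_constant[OF connected p0 that loc] .
  show ?thesis
  proof (rule that[of "\<lambda>x. s *\<^sub>R \<Phi> x"])
    show "isometry_H41 (\<lambda>x. s *\<^sub>R \<Phi> x)"
      by (rule isometry_H41_linear[where \<Psi> = "\<lambda>x. s *\<^sub>R \<Psi> x"])
        (use s \<Phi> in \<open>auto simp: linear_scale inner52_simps intro: linear_compose_scale_right\<close>)
    show "null_graph_surface X A f (\<lambda>x. s *\<^sub>R \<Phi> x)"
    proof (intro null_graph_surface.intro null_graph_surface_axioms.intro spacelike_surface_axioms)
      show "linear (\<lambda>x. s *\<^sub>R \<Phi> x)" using \<Phi>(1) by (rule linear_compose_scale_right)
      show "inner52 (s *\<^sub>R \<Phi> x) (s *\<^sub>R \<Phi> y) = inner52 x y" for x y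
        using s by (simp add: inner52_simps \<Phi>(5) mult.assoc[symmetric])
      fix p assume p: "p \<in> topspace X"
      show "(s *\<^sub>R \<Phi> (f p)) $ 2 = (s *\<^sub>R \<Phi> (f p)) $ 3" using null[OF p] by (simp add: g_def)
      show "(s *\<^sub>R \<Phi> (f p)) $ 1 > 0" using nz[OF p] by (simp add: sg[OF p, symmetric] g_def sgn_if)
    qed
  qed
qed

section \<open>The local isometry to the hyperbolic plane\<close>

text \<open>The hyperbolic plane is the graph of \<open>\<surd>(1 + |z|\<^sup>2)\<close> over the plane, so \<open>z = (y\<^sub>2,y\<^sub>3)\<close> is a global
coordinate on it.\<close>

definition proj_H2 :: "real^3 \<Rightarrow> real^2" where
  "proj_H2 y = vector [y$2, y$3]"

definition lift_H2 :: "real^2 \<Rightarrow> real^3" where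
  "lift_H2 z = vector [sqrt (1 + z \<bullet> z), z$1, z$2]"

text \<open>The hyperbolic metric \<open>-dy\<^sub>1\<^sup>2 + |dz|\<^sup>2\<close> in the coordinate \<open>z\<close>, where \<open>y\<^sub>1 dy\<^sub>1 = z \<bullet> dz\<close>.\<close>

definition hyp_metric :: "real^2 \<Rightarrow> real^2 \<Rightarrow> real^2 \<Rightarrow> real" where
  "hyp_metric z a b = a \<bullet> b - (z \<bullet> a) * (z \<bullet> b) / (1 + z \<bullet> z)"

lemma inner_real2: "(a::real^2) \<bullet> b = a$1 * b$1 + a$2 * b$2"
  by (simp add: inner_vec_def sum_2)

lemma one_plus_inner_pos: "1 + (z::real^2) \<bullet> z > 0"
  using inner_ge_zero[of z] by linarith

lemma hyp_metric_le: "hyp_metric z a a \<le> a \<bullet> a"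
  using one_plus_inner_pos[of z] by (simp add: hyp_metric_def)

lemma hyp_metric_ge: "(a \<bullet> a) / (1 + z \<bullet> z) \<le> hyp_metric z a a"
proof -
  have "(z \<bullet> a) * (z \<bullet> a) \<le> (z \<bullet> z) * (a \<bullet> a)"
    using Cauchy_Schwarz_ineq[of z a] by (simp add: power2_eq_square)
  then have "a \<bullet> a + (z \<bullet> a) * (z \<bullet> a) \<le> (a \<bullet> a) * (1 + z \<bullet> z)" by (simp add: algebra_simps)
  then have "(a \<bullet> a + (z \<bullet> a) * (z \<bullet> a)) / (1 + z \<bullet> z) \<le> a \<bullet> a"
    by (simp only: pos_divide_le_eq[OF one_plus_inner_pos])
  then show ?thesis by (simp add: hyp_metric_def add_divide_distrib)
qed

lemma hyp_metric_nonneg: "0 \<le> hyp_metric z a a"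
  using hyp_metric_ge[of a z] one_plus_inner_pos[of z] by (smt (verit) divide_nonneg_pos inner_ge_zero)

lemma bounded_linear_proj_H2: "bounded_linear proj_H2"
  unfolding linear_conv_bounded_linear[symmetric]
  by (rule linearI) (simp_all add: proj_H2_def vec_eq_iff forall_2)

lemma lift_H2_in: "lift_H2 z \<in> H2"
  using one_plus_inner_pos[of z]
  by (simp add: H2_def lift_H2_def inner31_def inner_real2)

lemma lift_proj_H2:
  assumes "y \<in> H2" shows "lift_H2 (proj_H2 y) = y"
proof -
  have "(y$1)\<^sup>2 = 1 + proj_H2 y \<bullet> proj_H2 y" and "y$1 > 0"
    using assms by (simp_all add: H2_def inner31_def proj_H2_def inner_real2 power2_eq_square)
  then have "y$1 = sqrt (1 + proj_H2 y \<bullet> proj_H2 y)" by (metis less_imp_le real_sqrt_unique)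
  then show ?thesis by (simp add: lift_H2_def vec_eq_iff forall_3) (simp add: proj_H2_def)
qed

context null_graph_surface
begin

text \<open>The map \<open>h\<close> goes to the hyperbolic plane, and \<open>P\<close> is its expression in the coordinate \<open>z\<close>.\<close>

definition P :: "'a \<Rightarrow> real^2" where "P p = vector [\<Phi> (f p) $ 4, \<Phi> (f p) $ 5]"

definition h :: "'a \<Rightarrow> real^3" where "h p = vector [\<Phi> (f p) $ 1, \<Phi> (f p) $ 4, \<Phi> (f p) $ 5]"

definition coords2 :: "real^5 \<Rightarrow> real^2" where "coords2 x = vector [\<Phi> x $ 4, \<Phi> x $ 5]"

definition coords3 :: "real^5 \<Rightarrow> real^3" where "coords3 x = vector [\<Phi> x $ 1, \<Phi> x $ 4, \<Phi> x $ 5]"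

lemma coords_bounded_linear: "bounded_linear \<Phi>" "bounded_linear coords2" "bounded_linear coords3"
  unfolding linear_conv_bounded_linear[symmetric]
  subgoal by (rule lin)
  subgoal by (rule linearI)
    (simp_all add: coords2_def vec_eq_iff forall_2 linear_add[OF lin] linear_scale[OF lin])
  subgoal by (rule linearI)
    (simp_all add: coords3_def vec_eq_iff forall_3 linear_add[OF lin] linear_scale[OF lin])
  done

lemma P_eq: "P = coords2 \<circ> f" and h_eq: "h = coords3 \<circ> f"
  by (simp_all add: fun_eq_iff P_def coords2_def h_def coords3_def)

lemma Phi_f_1:
  assumes "p \<in> topspace X" shows "(\<Phi> (f p) $ 1)\<^sup>2 = 1 + P p \<bullet> P p"
proof -
  have "inner52 (\<Phi> (f p)) (\<Phi> (f p)) = -1" using f_H41[OF assms] by (simp add: iso H41_def)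
  then show ?thesis using null[OF assms]
    by (simp add: P_def inner_real2 inner52_def power2_eq_square)
qed

lemma h_lift: assumes "p \<in> topspace X" shows "h p = lift_H2 (P p)"
proof -
  have "\<Phi> (f p) $ 1 = sqrt (1 + P p \<bullet> P p)"
    using Phi_f_1[OF assms] upper[OF assms] by (metis less_imp_le real_sqrt_unique)
  then show ?thesis by (simp add: h_def lift_H2_def) (simp add: P_def)
qed

lemma proj_h: "proj_H2 (h p) = P p"
  by (simp add: proj_H2_def h_def P_def)

lemma h_in_H2: "p \<in> topspace X \<Longrightarrow> h p \<in> H2"
  by (simp add: h_lift lift_H2_in)

lemma P_continuous: "continuous_map X euclidean P"
  unfolding P_eq
  by (rule continuous_map_compose[OF f_continuous])
    (simp add: linear_continuous_on coords_bounded_linear)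

text \<open>The equal second and third coordinates of \<open>\<Phi> \<circ> f\<close> contribute opposite terms to the form, so that only
the hyperbolic part is left. The parameter space is arbitrary, as the statement is needed for charts
and for curves.\<close>

lemma induced_metric:
  fixes c :: "'c::real_normed_vector \<Rightarrow> 'a"
  assumes B: "open B" "x \<in> B" "c ` B \<subseteq> topspace X" and D: "((f \<circ> c) has_derivative D) (at x)"
  shows "((P \<circ> c) has_derivative (coords2 \<circ> D)) (at x)" "((h \<circ> c) has_derivative (coords3 \<circ> D)) (at x)"
    "inner31 (coords3 (D a)) (coords3 (D b)) = inner52 (D a) (D b)"
    "inner52 (D a) (D b) = hyp_metric (P (c x)) (coords2 (D a)) (coords2 (D b))"
proof -
  show "((P \<circ> c) has_derivative (coords2 \<circ> D)) (at x)" "((h \<circ> c) has_derivative (coords3 \<circ> D)) (at x)"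
    using bounded_linear.has_derivative[OF coords_bounded_linear(2) D] bounded_linear.has_derivative[OF coords_bounded_linear(3) D]
    by (simp_all add: P_eq h_eq o_def)
  let ?g = "\<Phi> (f (c x))"
  have cx: "c x \<in> topspace X" using B by auto
  have 23: "\<Phi> (D a) $ 2 = \<Phi> (D a) $ 3" for a
  proof -
    have "bounded_linear (\<lambda>y. \<Phi> y $ 2 - \<Phi> y $ 3)"
      by (intro bounded_linear_sub bounded_linear_compose[OF bounded_linear_vec_nth coords_bounded_linear(1)])
    from bounded_linear.has_derivative[OF this D]
    have "((\<lambda>y. \<Phi> ((f \<circ> c) y) $ 2 - \<Phi> ((f \<circ> c) y) $ 3) has_derivative (\<lambda>a. \<Phi> (D a) $ 2 - \<Phi> (D a) $ 3)) (at x)" .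
    from derivative_zero_of_constant_on_open[OF B(1,2) _ this, of 0 a] show ?thesis
      using null B(3) by force
  qed
  have 1: "?g $ 1 * \<Phi> (D a) $ 1 = P (c x) \<bullet> coords2 (D a)" for a
  proof -
    have "inner52 ((f \<circ> c) x) (D a) + inner52 (D a) ((f \<circ> c) x) = 0"
    proof (rule derivative_zero_of_constant_on_open[OF B(1,2) _
        bounded_bilinear.FDERIV[OF bounded_bilinear_inner52 D D]])
      show "inner52 ((f \<circ> c) y) ((f \<circ> c) y) = -1" if "y \<in> B" for y
        using that B(3) f_H41 by (force simp: H41_def)
    qed
    then have "inner52 (f (c x)) (D a) = 0" by (simp add: inner52_commute[of "D a" "f (c x)"])
    then have "inner52 ?g (\<Phi> (D a)) = 0" by (simp add: iso)
    then show ?thesis using 23[of a] null[OF cx]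
      by (simp add: inner52_def P_def coords2_def inner_real2)
  qed
  have e: "inner52 (D a) (D b) = - (\<Phi> (D a) $ 1 * \<Phi> (D b) $ 1) + coords2 (D a) \<bullet> coords2 (D b)"
    using iso[of "D a" "D b"] 23[of a] 23[of b] by (simp add: inner52_def coords2_def inner_real2)
  then show "inner31 (coords3 (D a)) (coords3 (D b)) = inner52 (D a) (D b)"
    by (simp add: inner31_def coords3_def coords2_def inner_real2)
  have pos: "1 + P (c x) \<bullet> P (c x) > 0" by (rule one_plus_inner_pos)
  have "(1 + P (c x) \<bullet> P (c x)) * (\<Phi> (D a) $ 1 * \<Phi> (D b) $ 1) = (P (c x) \<bullet> coords2 (D a)) * (P (c x) \<bullet> coords2 (D b))"
    unfolding Phi_f_1[OF cx, symmetric] 1[symmetric] by (simp add: power2_eq_square algebra_simps)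
  then have "\<Phi> (D a) $ 1 * \<Phi> (D b) $ 1 = (P (c x) \<bullet> coords2 (D a)) * (P (c x) \<bullet> coords2 (D b)) / (1 + P (c x) \<bullet> P (c x))"
    using pos by (simp add: eq_divide_eq mult.commute)
  then show "inner52 (D a) (D b) = hyp_metric (P (c x)) (coords2 (D a)) (coords2 (D b))"
    unfolding e hyp_metric_def by simp
qed

lemma chart_induced_metric:
  assumes c: "(V, \<psi>) \<in> A" "u \<in> V"
  shows "((P \<circ> \<psi>) has_derivative (coords2 \<circ> frechet_derivative (f \<circ> \<psi>) (at u))) (at u)" (is ?thesis1)
    "((h \<circ> \<psi>) has_derivative (coords3 \<circ> frechet_derivative (f \<circ> \<psi>) (at u))) (at u)" (is ?thesis2)
    "inner31 (coords3 (frechet_derivative (f \<circ> \<psi>) (at u) a)) (coords3 (frechet_derivative (f \<circ> \<psi>) (at u) b)) =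
      inner52 (frechet_derivative (f \<circ> \<psi>) (at u) a) (frechet_derivative (f \<circ> \<psi>) (at u) b)" (is ?thesis3)
    "inner52 (frechet_derivative (f \<circ> \<psi>) (at u) a) (frechet_derivative (f \<circ> \<psi>) (at u) b) =
       hyp_metric (P (\<psi> u)) (coords2 (frechet_derivative (f \<circ> \<psi>) (at u) a)) (coords2 (frechet_derivative (f \<circ> \<psi>) (at u) b))" (is ?thesis4)
proof -
  have im: "\<psi> ` V \<subseteq> topspace X" using chart_in_X[OF c(1)] by blast
  note * = induced_metric[OF chart_open[OF c(1)] c(2) im spacelike_patch.F_deriv[OF patch[OF c(1)] c(2)]]
  show ?thesis1 ?thesis2 ?thesis3 ?thesis4 by (rule *)+
qed

lemma P_chart_smooth: assumes "(V, \<psi>) \<in> A" shows "smooth_on V (P \<circ> \<psi>)"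
proof -
  interpret spacelike_patch V "f \<circ> \<psi>" by (rule patch[OF assms])
  show ?thesis using smooth_on_linear_compose[OF smooth coords_bounded_linear(2)] by (simp add: P_eq o_def)
qed

lemma h_chart_smooth: assumes "(V, \<psi>) \<in> A" shows "smooth_on V (h \<circ> \<psi>)"
proof -
  interpret spacelike_patch V "f \<circ> \<psi>" by (rule patch[OF assms])
  show ?thesis using smooth_on_linear_compose[OF smooth coords_bounded_linear(3)] by (simp add: h_eq o_def)
qed

text \<open>A tangent vector in the kernel would have length \<open>0\<close> by \<open>induced_metric\<close>.\<close>

lemma P_chart_immersion:
  assumes c: "(V, \<psi>) \<in> A" "u \<in> V"
  shows "inj (frechet_derivative (P \<circ> \<psi>) (at u))"
proof -
  interpret spacelike_patch V "f \<circ> \<psi>" by (rule patch[OF c(1)])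
  have e: "frechet_derivative (P \<circ> \<psi>) (at u) = coords2 \<circ> dF u"
    using frechet_derivative_at[OF chart_induced_metric(1)[OF c]] by simp
  have "linear (coords2 \<circ> dF u)" using dF_linear[OF c(2)] coords_bounded_linear(2) by (simp add: linear_compose linear_linear)
  moreover have "a = 0" if "(coords2 \<circ> dF u) a = 0" for a
  proof (rule ccontr)
    assume "a \<noteq> 0"
    from spacelike[OF c(2) this] chart_induced_metric(4)[OF c, of a a] that
    show False by (simp add: hyp_metric_def)
  qed
  ultimately show ?thesis unfolding e using linear_injective_0 by blast
qed

text \<open>An open set \<open>U\<close> of the surface that \<open>P\<close> maps bijectively onto a disc, together with the smooth inverse
\<open>\<kappa>\<close>.\<close>

definition sheet :: "'a set \<Rightarrow> real^2 \<Rightarrow> real \<Rightarrow> (real^2 \<Rightarrow> 'a) \<Rightarrow> bool" where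
  "sheet U z0 r \<kappa> \<longleftrightarrow> openin X U \<and> r > 0 \<and> (\<forall>z\<in>ball z0 r. \<kappa> z \<in> U \<and> P (\<kappa> z) = z) \<and>
     (\<forall>q\<in>U. P q \<in> ball z0 r \<and> \<kappa> (P q) = q) \<and> continuous_map (top_of_set (ball z0 r)) X \<kappa> \<and>
     (\<forall>(V, \<psi>)\<in>A. smooth_on {z \<in> ball z0 r. \<kappa> z \<in> \<psi> ` V} (inv_into V \<psi> \<circ> \<kappa>))"

lemma sheetD:
  assumes "sheet U z0 r \<kappa>"
  shows "openin X U" "r > 0" "\<And>z. z \<in> ball z0 r \<Longrightarrow> \<kappa> z \<in> U" "\<And>z. z \<in> ball z0 r \<Longrightarrow> P (\<kappa> z) = z"
    "\<And>q. q \<in> U \<Longrightarrow> P q \<in> ball z0 r" "\<And>q. q \<in> U \<Longrightarrow> \<kappa> (P q) = q"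
    "continuous_map (top_of_set (ball z0 r)) X \<kappa>"
  using assms unfolding sheet_def by blast+

lemma sheet_smooth:
  assumes "sheet U z0 r \<kappa>" "(V, \<psi>) \<in> A"
  shows "smooth_on {z \<in> ball z0 r. \<kappa> z \<in> \<psi> ` V} (inv_into V \<psi> \<circ> \<kappa>)"
proof -
  have "\<forall>(V, \<psi>)\<in>A. smooth_on {z \<in> ball z0 r. \<kappa> z \<in> \<psi> ` V} (inv_into V \<psi> \<circ> \<kappa>)"
    using assms(1) unfolding sheet_def by (elim conjE)
  from bspec[OF this assms(2), unfolded prod.case] show ?thesis .
qed

lemma sheet_exists:
  assumes Op: "openin X Op" and p: "p \<in> Op"
  shows "\<exists>U r \<kappa>. sheet U (P p) r \<kappa> \<and> p \<in> U \<and> U \<subseteq> Op"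
proof -
  have "p \<in> topspace X" using Op p openin_subset by blast
  then obtain V \<psi> u where c: "(V, \<psi>) \<in> A" "u \<in> V" "\<psi> u = p" by (rule chart_exists)
  define V1 where "V1 = {v \<in> V. \<psi> v \<in> Op}"
  have V1: "open V1" "V1 \<subseteq> V" "u \<in> V1"
    unfolding V1_def using chart_preimage_open[OF c(1) Op] c p by auto
  obtain U' W k where k: "open U'" "U' \<subseteq> V1" "u \<in> U'" "open W" "(P \<circ> \<psi>) u \<in> W"
    "homeomorphism U' W (P \<circ> \<psi>) k" "smooth_on W k"
    by (rule smooth_inverse_function[OF V1(1) smooth_on_subset[OF P_chart_smooth[OF c(1)] V1(2)] V1(3)
        P_chart_immersion[OF c(1,2)]])
  obtain r where r: "r > 0" "ball (P p) r \<subseteq> W"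
    using k(4,5) c(3) open_contains_ball_eq[of W] by auto
  define U where "U = \<psi> ` {v \<in> U'. (P \<circ> \<psi>) v \<in> ball (P p) r}"
  define \<kappa> where "\<kappa> = \<psi> \<circ> k"
  have kW: "k z \<in> U'" "(P \<circ> \<psi>) (k z) = z" if "z \<in> W" for z
    using k(6) that unfolding homeomorphism_def by auto
  have kU: "k ((P \<circ> \<psi>) v) = v" if "v \<in> U'" for v
    using k(6) that unfolding homeomorphism_def by auto
  have U'V: "U' \<subseteq> V" using k(2) V1(2) by blast
  have "sheet U (P p) r \<kappa>"
    unfolding sheet_def
  proof (intro conjI ballI)
    have "open {v \<in> U'. (P \<circ> \<psi>) v \<in> ball (P p) r}"
      by (rule open_Collect_preimage[OF open_ball k(1)])
        (use smooth_on_imp_continuous_on[OF P_chart_smooth[OF c(1)]] U'V continuous_on_subset in blast)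
    then show "openin X U" unfolding U_def by (rule chart_image_of_open[OF c(1)]) (use U'V in auto)
    show "r > 0" by (rule r(1))
    fix z assume z: "z \<in> ball (P p) r"
    then have "z \<in> W" using r(2) by blast
    then show "\<kappa> z \<in> U" "P (\<kappa> z) = z" using kW[of z] z by (auto simp: \<kappa>_def U_def)
  next
    fix q assume "q \<in> U"
    then show "P q \<in> ball (P p) r" "\<kappa> (P q) = q" using kU by (auto simp: U_def \<kappa>_def)
  next
    have "continuous_on (ball (P p) r) k" using smooth_on_imp_continuous_on[OF k(7)] r(2) continuous_on_subset by blast
    then have "continuous_map (top_of_set (ball (P p) r)) (top_of_set V) k"
      using kW(1) r(2) U'V by (auto simp: continuous_map_in_subtopology)
    then show "continuous_map (top_of_set (ball (P p) r)) X \<kappa>"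
      unfolding \<kappa>_def by (rule continuous_map_compose[OF _ chart_continuous[OF c(1)]])
  next
    fix c' assume c': "c' \<in> A"
    obtain V' \<psi>' where e: "c' = (V', \<psi>')" by (cases c')
    have "smooth_on {z \<in> ball (P p) r. \<kappa> z \<in> \<psi>' ` V'} (\<lambda>z. (inv_into V' \<psi>' \<circ> \<psi>) (k z))"
    proof (rule smooth_on_compose[OF _ transition_smooth[OF c(1) c'[unfolded e]]])
      show "smooth_on {z \<in> ball (P p) r. \<kappa> z \<in> \<psi>' ` V'} k"
        by (rule smooth_on_subset[OF k(7)]) (use r(2) in auto)
      show "k ` {z \<in> ball (P p) r. \<kappa> z \<in> \<psi>' ` V'} \<subseteq> {u \<in> V. \<psi> u \<in> \<psi>' ` V'}"
      proof (rule image_subsetI)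
        fix z assume "z \<in> {z \<in> ball (P p) r. \<kappa> z \<in> \<psi>' ` V'}"
        then have "z \<in> ball (P p) r" "\<psi> (k z) \<in> \<psi>' ` V'" by (simp_all add: \<kappa>_def)
        then show "k z \<in> {u \<in> V. \<psi> u \<in> \<psi>' ` V'}" using kW(1)[of z] r(2) U'V by blast
      qed
    qed
    then show "case c' of (V, \<psi>) \<Rightarrow> smooth_on {z \<in> ball (P p) r. \<kappa> z \<in> \<psi> ` V} (inv_into V \<psi> \<circ> \<kappa>)"
      by (simp add: e \<kappa>_def o_def)
  qed
  moreover have "p \<in> U" unfolding U_def using c k(3) r(1) by (auto intro!: image_eqI[of _ _ u])
  moreover have "U \<subseteq> Op" unfolding U_def using k(2) by (auto simp: V1_def)
  ultimately show ?thesis by blast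
qed

lemma sheet_f_smooth:
  assumes s: "sheet U z0 r \<kappa>"
  shows "smooth_on (ball z0 r) (f \<circ> \<kappa>)"
proof (rule smooth_on_local)
  fix z assume z: "z \<in> ball z0 r"
  then have "\<kappa> z \<in> topspace X" using sheetD(1,3)[OF s] openin_subset by blast
  then obtain V \<psi> u where c: "(V, \<psi>) \<in> A" "u \<in> V" "\<psi> u = \<kappa> z" by (rule chart_exists)
  interpret spacelike_patch V "f \<circ> \<psi>" by (rule patch[OF c(1)])
  let ?W = "{z \<in> ball z0 r. \<kappa> z \<in> \<psi> ` V}"
  have W1: "open ?W"
    using openin_continuous_map_preimage[OF sheetD(7)[OF s] chart_image_open[OF c(1)]]
    by (simp add: openin_open_eq)
  have W2: "z \<in> ?W" using z c by (auto intro!: image_eqI[of _ \<psi> u])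
  have W3: "smooth_on ?W (f \<circ> \<kappa>)"
  proof -
    have "smooth_on ?W (\<lambda>z. (f \<circ> \<psi>) ((inv_into V \<psi> \<circ> \<kappa>) z))"
      by (rule smooth_on_compose[OF sheet_smooth[OF s c(1)] smooth]) (auto intro: inv_into_into)
    moreover have "(f \<circ> \<psi>) ((inv_into V \<psi> \<circ> \<kappa>) z) = (f \<circ> \<kappa>) z" if "z \<in> ?W" for z
      using that by (auto simp: f_inv_into_f)
    ultimately show ?thesis using smooth_on_cong[of ?W] by (metis (no_types, lifting))
  qed
  have "smooth_on (ball z0 r \<inter> ?W) (f \<circ> \<kappa>)" using W3 by (rule smooth_on_subset) blast
  then show "\<exists>W. open W \<and> z \<in> W \<and> smooth_on (ball z0 r \<inter> W) (f \<circ> \<kappa>)"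
    by (intro exI[of _ ?W] conjI W1 W2)
qed

lemma open_proj_H2: "open B \<Longrightarrow> open {y. proj_H2 y \<in> B}"
  using open_vimage[of B proj_H2] linear_continuous_on[OF bounded_linear_proj_H2, of UNIV]
  by (simp add: vimage_def)

text \<open>Near a point of its image, the inverse of \<open>h\<close> is \<open>\<kappa> \<circ> proj_H2\<close> for a sheet \<open>\<kappa>\<close>. This formula makes sense
on an open set of \<open>\<real>\<^sup>3\<close> and so provides the local extension that \<^const>\<open>smooth_on\<close> asks for.\<close>

lemma diffeo_h:
  assumes U: "openin X U" and inj: "inj_on h U"
  shows "diffeo_H2 X A U h (h ` U)"
  unfolding diffeo_H2_def
proof (intro conjI ballI)
  have UX: "U \<subseteq> topspace X" by (rule openin_subset[OF U])
  show "openin X U" by (rule U)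
  show "bij_betw h U (h ` U)" by (rule inj_on_imp_bij_betw[OF inj])
  have key: "\<exists>U0 r \<kappa>. sheet U0 (P p0) r \<kappa> \<and> U0 \<subseteq> Op \<and> p0 \<in> U0 \<and> (\<forall>y\<in>H2. proj_H2 y \<in> ball (P p0) r \<longrightarrow>
      \<kappa> (proj_H2 y) \<in> U0 \<and> h (\<kappa> (proj_H2 y)) = y)" if Op: "openin X Op" "p0 \<in> Op" for p0 Op
  proof -
    obtain U0 r \<kappa> where s: "sheet U0 (P p0) r \<kappa>" "p0 \<in> U0" "U0 \<subseteq> Op" using sheet_exists[OF Op] by blast
    have "\<kappa> (proj_H2 y) \<in> U0 \<and> h (\<kappa> (proj_H2 y)) = y" if y: "y \<in> H2" "proj_H2 y \<in> ball (P p0) r" for y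
    proof
      show k: "\<kappa> (proj_H2 y) \<in> U0" by (rule sheetD(3)[OF s(1) y(2)])
      then have "\<kappa> (proj_H2 y) \<in> topspace X" using sheetD(1)[OF s(1)] openin_subset by blast
      then show "h (\<kappa> (proj_H2 y)) = y"
        using sheetD(4)[OF s(1) y(2)] lift_proj_H2[OF y(1)] by (simp add: h_lift)
    qed
    then show ?thesis using s by blast
  qed
  show "openin (top_of_set H2) (h ` U)"
  proof (subst openin_subopen, intro ballI)
    fix y assume "y \<in> h ` U"
    then obtain p0 where p0: "p0 \<in> U" "y = h p0" by blast
    from key[OF U p0(1)] obtain U0 r \<kappa> where k: "sheet U0 (P p0) r \<kappa>" "U0 \<subseteq> U"
      "\<forall>y\<in>H2. proj_H2 y \<in> ball (P p0) r \<longrightarrow> \<kappa> (proj_H2 y) \<in> U0 \<and> h (\<kappa> (proj_H2 y)) = y" by blast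
    let ?T = "H2 \<inter> {y. proj_H2 y \<in> ball (P p0) r}"
    have "openin (top_of_set H2) ?T" by (intro openin_open_Int open_proj_H2 open_ball)
    moreover have "y \<in> ?T" using p0 UX h_in_H2 sheetD(2)[OF k(1)] by (auto simp: proj_h)
    moreover have "?T \<subseteq> h ` U"
    proof
      fix y assume "y \<in> ?T"
      then have "\<kappa> (proj_H2 y) \<in> U0" "h (\<kappa> (proj_H2 y)) = y" using k(3) by blast+
      then show "y \<in> h ` U" using k(2) by (intro image_eqI[of _ h "\<kappa> (proj_H2 y)"]) auto
    qed
    ultimately show "\<exists>T. openin (top_of_set H2) T \<and> y \<in> T \<and> T \<subseteq> h ` U" by blast
  qed
  fix c assume c: "c \<in> A"
  obtain V \<psi> where e: "c = (V, \<psi>)" by (cases c)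
  note c = c[unfolded e]
  have "smooth_on {u \<in> V. \<psi> u \<in> U} (h \<circ> \<psi>)"
    by (rule smooth_on_subset[OF h_chart_smooth[OF c]]) auto
  moreover have "smooth_on (h ` (U \<inter> \<psi> ` V)) (inv_into V \<psi> \<circ> inv_into U h)"
  proof (rule smooth_on_local)
    let ?S = "h ` (U \<inter> \<psi> ` V)"
    fix y assume "y \<in> ?S"
    then obtain p0 where p0: "p0 \<in> U \<inter> \<psi> ` V" "y = h p0" by blast
    from key[OF openin_Int[OF U chart_image_open[OF c]] p0(1)]
    obtain U0 r \<kappa> where k: "sheet U0 (P p0) r \<kappa>" "U0 \<subseteq> U \<inter> \<psi> ` V"
      "\<forall>y\<in>H2. proj_H2 y \<in> ball (P p0) r \<longrightarrow> \<kappa> (proj_H2 y) \<in> U0 \<and> h (\<kappa> (proj_H2 y)) = y" by blast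
    let ?W = "{y. proj_H2 y \<in> ball (P p0) r}"
    have "smooth_on (?S \<inter> ?W) (\<lambda>y. (inv_into V \<psi> \<circ> \<kappa>) (proj_H2 y))"
    proof (rule smooth_on_compose[OF smooth_on_bounded_linear[OF bounded_linear_proj_H2] sheet_smooth[OF k(1) c]])
      show "proj_H2 ` (?S \<inter> ?W) \<subseteq> {z \<in> ball (P p0) r. \<kappa> z \<in> \<psi> ` V}"
        using sheetD(3)[OF k(1)] k(2) by blast
    qed
    moreover have "(inv_into V \<psi> \<circ> \<kappa>) (proj_H2 y) = (inv_into V \<psi> \<circ> inv_into U h) y" if y: "y \<in> ?S \<inter> ?W" for y
    proof -
      have "y \<in> H2" using y UX h_in_H2 by auto
      then have "\<kappa> (proj_H2 y) \<in> U" "h (\<kappa> (proj_H2 y)) = y" using k(2,3) y by blast+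
      then have "inv_into U h y = \<kappa> (proj_H2 y)" using inj by (metis inv_into_f_f)
      then show ?thesis by simp
    qed
    ultimately have "smooth_on (?S \<inter> ?W) (inv_into V \<psi> \<circ> inv_into U h)"
      using smooth_on_cong[of "?S \<inter> ?W"] by (metis (no_types, lifting))
    moreover have "open ?W" by (intro open_proj_H2 open_ball)
    moreover have "y \<in> ?W" using p0 sheetD(2)[OF k(1)] by (simp add: proj_h)
    ultimately show "\<exists>W. open W \<and> y \<in> W \<and> smooth_on (?S \<inter> W) (inv_into V \<psi> \<circ> inv_into U h)"
      by (intro exI[of _ ?W] conjI)
  qed
  ultimately show "case c of (V, \<psi>) \<Rightarrow> smooth_on {u \<in> V. \<psi> u \<in> U} (h \<circ> \<psi>) \<and>
        smooth_on (h ` (U \<inter> \<psi> ` V)) (inv_into V \<psi> \<circ> inv_into U h)" by (simp add: e)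
qed

lemma isometric_if_bij:
  assumes "bij_betw P (topspace X) UNIV"
  shows "isometric_to_H2 X A f"
proof -
  have inj: "inj_on h (topspace X)"
  proof (rule inj_onI)
    fix p q assume "p \<in> topspace X" "q \<in> topspace X" "h p = h q"
    moreover from this have "P p = P q" by (metis proj_h)
    ultimately show "p = q" using inj_onD[OF bij_betw_imp_inj_on[OF assms], of p q] by blast
  qed
  have "h ` topspace X = H2"
  proof
    show "h ` topspace X \<subseteq> H2" using h_in_H2 by blast
    show "H2 \<subseteq> h ` topspace X"
    proof
      fix y assume y: "y \<in> H2"
      have "proj_H2 y \<in> P ` topspace X" using bij_betw_imp_surj_on[OF assms] by simp
      then obtain p where "p \<in> topspace X" "P p = proj_H2 y" by auto
      then show "y \<in> h ` topspace X" using h_lift lift_proj_H2[OF y] by (metis imageI)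
    qed
  qed
  then have "diffeo_H2 X A (topspace X) h H2" using diffeo_h[OF openin_topspace inj] by simp
  moreover have "\<forall>(V, \<psi>)\<in>A. \<forall>u\<in>V. \<forall>a b.
        inner31 (frechet_derivative (h \<circ> \<psi>) (at u) a) (frechet_derivative (h \<circ> \<psi>) (at u) b) =
        inner52 (frechet_derivative (f \<circ> \<psi>) (at u) a) (frechet_derivative (f \<circ> \<psi>) (at u) b)"
  proof (clarify)
    fix V \<psi> u a b assume c: "(V, \<psi>) \<in> A" "u \<in> V"
    have "frechet_derivative (h \<circ> \<psi>) (at u) = coords3 \<circ> frechet_derivative (f \<circ> \<psi>) (at u)"
      using frechet_derivative_at[OF chart_induced_metric(2)[OF c]] by simp
    then show "inner31 (frechet_derivative (h \<circ> \<psi>) (at u) a) (frechet_derivative (h \<circ> \<psi>) (at u) b) =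
        inner52 (frechet_derivative (f \<circ> \<psi>) (at u) a) (frechet_derivative (f \<circ> \<psi>) (at u) b)"
      using chart_induced_metric(3)[OF c] by simp
  qed
  ultimately show ?thesis unfolding isometric_to_H2_def by blast
qed

text \<open>Over a sheet the function \<open>\<lambda>\<close> is the second coordinate of \<open>\<Phi> \<circ> f \<circ> \<kappa>\<close>. Passing to half the radius
leaves room for its extension to the whole plane.\<close>

lemma local_graph:
  assumes p: "p \<in> topspace X"
  shows "\<exists>U W l. p \<in> U \<and> diffeo_H2 X A U h W \<and> smooth_on H2 l \<and> (\<forall>q\<in>U. \<Phi> (f q) = i_map l (h q))"
proof -
  obtain U0 r \<kappa> where s: "sheet U0 (P p) r \<kappa>" "p \<in> U0" using sheet_exists[OF openin_topspace p] by blast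
  have "smooth_on (ball (P p) r) (\<lambda>z. \<Phi> ((f \<circ> \<kappa>) z) $ 2)"
    by (rule smooth_on_linear_compose[OF sheet_f_smooth[OF s(1)]])
      (rule bounded_linear_compose[OF bounded_linear_vec_nth coords_bounded_linear(1)])
  then obtain m where m: "smooth_on UNIV m" "\<forall>z\<in>ball (P p) (r / 2). m z = \<Phi> ((f \<circ> \<kappa>) z) $ 2"
    by (rule smooth_on_ball_extend[OF sheetD(2)[OF s(1)]])
  define U where "U = {q \<in> topspace X. P q \<in> ball (P p) (r / 2)} \<inter> U0"
  have U: "openin X U" unfolding U_def
    using openin_continuous_map_preimage[OF P_continuous, of "ball (P p) (r / 2)"] sheetD(1)[OF s(1)]
    by (intro openin_Int) auto
  have "inj_on h U"
  proof (rule inj_onI)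
    fix q q' assume "q \<in> U" "q' \<in> U" "h q = h q'"
    then have "q \<in> U0" "q' \<in> U0" "P q = P q'" by (auto simp: U_def) (metis proj_h)
    then show "q = q'" using sheetD(6)[OF s(1)] by metis
  qed
  moreover have "p \<in> U" using p s sheetD(2)[OF s(1)] by (simp add: U_def)
  moreover have "smooth_on H2 (\<lambda>y. m (proj_H2 y))"
    using smooth_on_compose[OF smooth_on_bounded_linear[OF bounded_linear_proj_H2] m(1)] by simp
  moreover have "\<Phi> (f q) = i_map (\<lambda>y. m (proj_H2 y)) (h q)" if "q \<in> U" for q
  proof -
    have q: "q \<in> U0" "P q \<in> ball (P p) (r / 2)" "q \<in> topspace X" using that by (auto simp: U_def)
    have "m (P q) = \<Phi> (f q) $ 2" using bspec[OF m(2) q(2)] sheetD(6)[OF s(1) q(1)] by simp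
    then show ?thesis using null[OF q(3)] by (simp add: i_map_def proj_h vec_eq_iff forall_5) (simp add: h_def)
  qed
  ultimately show ?thesis using diffeo_h[OF U] by blast
qed

end

section \<open>Sections over discs\<close>

lemma norm_convex_combination_lt:
  fixes a b :: "'a::real_inner"
  assumes "norm a = R" "norm b = R" "a \<noteq> b" "0 < l" "l < 1"
  shows "norm ((1 - l) *\<^sub>R a + l *\<^sub>R b) < R"
proof -
  have "(norm ((1 - l) *\<^sub>R a + l *\<^sub>R b))\<^sup>2 = (1 - l) * (norm a)\<^sup>2 + l * (norm b)\<^sup>2 - l * (1 - l) * (norm (a - b))\<^sup>2"
    by (simp add: power2_norm_eq_inner inner_add_left inner_add_right inner_diff_left inner_diff_right
        inner_commute[of b a] algebra_simps)
  also have "\<dots> = R\<^sup>2 - l * (1 - l) * (norm (a - b))\<^sup>2" using assms(1,2) by (simp add: algebra_simps)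
  also have "\<dots> < R\<^sup>2" using assms(3-5) by simp
  finally show ?thesis using assms(1) norm_ge_zero[of a] by (metis power2_less_imp_less)
qed

text \<open>Extensions of a section to discs around two boundary points agree where they meet, since they agree
with the section at a common interior point. If the two centres differ, such a point is found on the
chord between them, which is interior by strict convexity; otherwise it is found on the radius.\<close>

lemma spheres_balls_meet_inside:
  fixes z0 :: "'a::real_inner"
  assumes "dist z0 z = R" "dist z0 z' = R" "R > 0" "\<epsilon> > 0" "\<epsilon>' > 0" "x \<in> ball z \<epsilon>" "x \<in> ball z' \<epsilon>'"
  obtains w where "w \<in> ball z \<epsilon>" "w \<in> ball z' \<epsilon>'" "w \<in> ball z0 R"
proof (cases "z = z'")
  case True
  define t where "t = min 1 (min \<epsilon> \<epsilon>' / (2 * R))"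
  have t: "0 < t" "t \<le> 1" "t * R < \<epsilon>" "t * R < \<epsilon>'"
  proof -
    have "min \<epsilon> \<epsilon>' > 0" using assms(4,5) by simp
    then show "0 < t" "t \<le> 1" using assms(3) by (simp_all add: t_def)
    have "t * R \<le> min \<epsilon> \<epsilon>' / (2 * R) * R" using assms(3) by (intro mult_right_mono) (auto simp: t_def)
    also have "\<dots> = min \<epsilon> \<epsilon>' / 2" using assms(3) by simp
    also have "\<dots> < min \<epsilon> \<epsilon>'" using \<open>min \<epsilon> \<epsilon>' > 0\<close> by linarith
    finally have "t * R < min \<epsilon> \<epsilon>'" .
    then show "t * R < \<epsilon>" "t * R < \<epsilon>'" by simp_all
  qed
  define w where "w = z + t *\<^sub>R (z0 - z)"
  have n: "norm (z0 - z) = R" using assms(1) by (simp add: dist_norm)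
  have "dist z w = t * R" using t(1) n by (simp add: w_def dist_norm)
  moreover have "dist z0 w = (1 - t) * R"
  proof -
    have "z0 - w = (1 - t) *\<^sub>R (z0 - z)" by (simp add: w_def algebra_simps)
    then show ?thesis using t(2) n by (simp add: dist_norm)
  qed
  moreover have "(1 - t) * R < R" using t(1) assms(3) by simp
  ultimately show ?thesis using that[of w] t True by simp
next
  case False
  define l where "l = \<epsilon> / (\<epsilon> + \<epsilon>')"
  have l: "0 < l" "l < 1" "1 - l = \<epsilon>' / (\<epsilon> + \<epsilon>')" using assms(4,5) by (simp_all add: l_def field_simps)
  have d: "dist z z' < \<epsilon> + \<epsilon>'"
    using dist_triangle[of z z' x] assms(6,7) by (simp add: dist_commute)
  define w where "w = (1 - l) *\<^sub>R z + l *\<^sub>R z'"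
  have "z - w = l *\<^sub>R (z - z')" "z' - w = (1 - l) *\<^sub>R (z' - z)" by (simp_all add: w_def algebra_simps)
  then have "dist z w = l * dist z z'" "dist z' w = (1 - l) * dist z z'"
    using l(1,2) by (simp_all add: dist_norm norm_minus_commute)
  moreover have "l * dist z z' < \<epsilon>" "(1 - l) * dist z z' < \<epsilon>'"
    unfolding l(3) using d assms(4,5) by (simp_all add: l_def divide_less_eq mult_strict_left_mono)
  moreover have "dist z0 w < R"
  proof -
    have "norm ((1 - l) *\<^sub>R (z - z0) + l *\<^sub>R (z' - z0)) < R"
      by (rule norm_convex_combination_lt) (use assms(1,2) False l(1,2) in \<open>auto simp: dist_norm norm_minus_commute\<close>)
    moreover have "(1 - l) *\<^sub>R (z - z0) + l *\<^sub>R (z' - z0) = w - z0" by (simp add: w_def algebra_simps)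
    ultimately show ?thesis by (simp add: dist_norm norm_minus_commute)
  qed
  ultimately show ?thesis using that[of w] by simp
qed

context null_graph_surface
begin

definition local_section :: "(real^2) set \<Rightarrow> (real^2 \<Rightarrow> 'a) \<Rightarrow> bool" where
  "local_section B s \<longleftrightarrow> continuous_map (top_of_set B) X s \<and> (\<forall>z\<in>B. P (s z) = z)"

lemma local_section_subset: "local_section B s \<Longrightarrow> C \<subseteq> B \<Longrightarrow> local_section C s"
  unfolding local_section_def using continuous_map_from_subtopology_mono by blast

lemma local_section_in_X: "local_section B s \<Longrightarrow> z \<in> B \<Longrightarrow> s z \<in> topspace X"
  unfolding local_section_def using continuous_map_funspace by fastforce

lemma sheet_local_section: "sheet U z0 r \<kappa> \<Longrightarrow> local_section (ball z0 r) \<kappa>"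
  unfolding sheet_def local_section_def by blast

text \<open>The set where two sections agree is closed as the surface is a Hausdorff space, and open because \<open>P\<close> is
injective on sheets.\<close>

lemma local_section_unique:
  assumes s: "local_section B s" "local_section B s'" and B: "connected B" "z0 \<in> B" "s z0 = s' z0" and z: "z \<in> B"
  shows "s z = s' z"
proof -
  let ?E = "{z \<in> B. s z = s' z}"
  have c: "continuous_map (top_of_set B) X s" "continuous_map (top_of_set B) X s'"
    using s by (auto simp: local_section_def)
  have "closedin (top_of_set B) ?E"
    using closedin_continuous_maps_eq[OF Hausdorff c] by simp
  moreover have "openin (top_of_set B) ?E"
  proof (subst openin_subopen, intro ballI)
    fix w assume w: "w \<in> ?E"
    then have "s w \<in> topspace X" using local_section_in_X[OF s(1)] by blast
    then obtain U r \<kappa> where sh: "sheet U (P (s w)) r \<kappa>" "s w \<in> U"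
      using sheet_exists[OF openin_topspace] by blast
    let ?T = "{v \<in> B. s v \<in> U} \<inter> {v \<in> B. s' v \<in> U}"
    have "openin (top_of_set B) ?T"
      using openin_continuous_map_preimage[OF c(1) sheetD(1)[OF sh(1)]]
        openin_continuous_map_preimage[OF c(2) sheetD(1)[OF sh(1)]] by (intro openin_Int) auto
    moreover have "w \<in> ?T" using w sh(2) by auto
    moreover have "?T \<subseteq> ?E"
    proof
      fix v assume v: "v \<in> ?T"
      then have "P (s v) = v" "P (s' v) = v" using s by (auto simp: local_section_def)
      then have "s v = \<kappa> v" "s' v = \<kappa> v" using sheetD(6)[OF sh(1), of "s v"] sheetD(6)[OF sh(1), of "s' v"] v by auto
      then show "v \<in> ?E" using v by simp
    qed
    ultimately show "\<exists>T. openin (top_of_set B) T \<and> w \<in> T \<and> T \<subseteq> ?E" by blast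
  qed
  ultimately have "?E = {} \<or> ?E = B" using B(1) unfolding connected_clopen by blast
  then show ?thesis using B z by blast
qed

lemma local_section_pasting:
  assumes T: "\<And>i. i \<in> I \<Longrightarrow> open (T i)" "\<And>i. i \<in> I \<Longrightarrow> local_section (T i) (s i)"
    and agree: "\<And>i j x. i \<in> I \<Longrightarrow> j \<in> I \<Longrightarrow> x \<in> T i \<Longrightarrow> x \<in> T j \<Longrightarrow> s i x = s j x"
  shows "\<exists>g. local_section (\<Union>i\<in>I. T i) g \<and> (\<forall>i\<in>I. \<forall>x\<in>T i. g x = s i x)"
proof -
  let ?X = "top_of_set (\<Union>i\<in>I. T i)"
  have sub: "subtopology ?X (T i) = top_of_set (T i)" if "i \<in> I" for i
  proof -
    have "(\<Union>i\<in>I. T i) \<inter> T i = T i" using that by blast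
    then show ?thesis by (simp add: subtopology_subtopology)
  qed
  have "\<exists>g. continuous_map ?X X g \<and> (\<forall>i x. i \<in> I \<longrightarrow> x \<in> topspace ?X \<inter> T i \<longrightarrow> g x = s i x)"
  proof (rule pasting_lemma_exists[where X = ?X and I = I and T = T and Y = X and f = s])
    show "topspace ?X \<subseteq> \<Union> (T ` I)" by simp
    show "openin ?X (T i)" if "i \<in> I" for i using T(1)[OF that] that by (auto intro!: open_subset)
    show "continuous_map (subtopology ?X (T i)) X (s i)" if "i \<in> I" for i
      unfolding sub[OF that] using T(2)[OF that] by (simp add: local_section_def)
    show "s i x = s j x" if "i \<in> I" "j \<in> I" "x \<in> topspace ?X \<inter> T i \<inter> T j" for i j x
      using agree that by blast
  qed blast
  then obtain g where g: "continuous_map ?X X g" "\<forall>i x. i \<in> I \<longrightarrow> x \<in> topspace ?X \<inter> T i \<longrightarrow> g x = s i x"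
    by blast
  have "g x = s i x" if "i \<in> I" "x \<in> T i" for i x using g(2) that by auto
  moreover from this have "P (g x) = x" if "x \<in> (\<Union>i\<in>I. T i)" for x
    using that T(2) by (auto simp: local_section_def)
  ultimately show ?thesis using g(1) unfolding local_section_def by blast
qed

text \<open>The form in which completeness enters the covering argument: the lift of a radius, as traced by a
section, has a cluster point at its end.\<close>

definition has_radial_limits :: bool where
  "has_radial_limits \<longleftrightarrow> (\<forall>z0 R s z. R > 0 \<longrightarrow> local_section (ball z0 R) s \<longrightarrow> dist z0 z = R \<longrightarrow>
     (\<exists>p\<in>topspace X. \<forall>Op \<delta>. openin X Op \<longrightarrow> p \<in> Op \<longrightarrow> \<delta> > 0 \<longrightarrow>
        (\<exists>t. 0 < t \<and> t < 1 \<and> 1 - \<delta> < t \<and> s (z0 + t *\<^sub>R (z - z0)) \<in> Op)))"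

text \<open>The cluster point \<open>p\<close> of the lifted radius lies over \<open>z\<close>. The inverse of \<open>P\<close> on a sheet around \<open>p\<close>
agrees with the section at a point of the radius, hence on the whole intersection of the two discs,
which is convex.\<close>

lemma local_section_boundary:
  assumes rad: "has_radial_limits" and R: "R > 0" and s: "local_section (ball z0 R) s" and z: "dist z0 z = R"
  shows "\<exists>\<epsilon> \<sigma>. \<epsilon> > 0 \<and> local_section (ball z \<epsilon>) \<sigma> \<and> (\<forall>w\<in>ball z \<epsilon> \<inter> ball z0 R. \<sigma> w = s w)"
proof -
  define c where "c t = z0 + t *\<^sub>R (z - z0)" for t
  obtain p where p: "p \<in> topspace X"
    "\<And>Op \<delta>. openin X Op \<Longrightarrow> p \<in> Op \<Longrightarrow> \<delta> > 0 \<Longrightarrow> \<exists>t. 0 < t \<and> t < 1 \<and> 1 - \<delta> < t \<and> s (c t) \<in> Op"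
    using rad R s z unfolding has_radial_limits_def c_def by metis
  have nz: "norm (z - z0) = R" using z by (simp add: dist_norm norm_minus_commute)
  have cz: "dist (c t) z = (1 - t) * R" "c t \<in> ball z0 R" if "0 < t" "t < 1" for t
  proof -
    have "z - c t = (1 - t) *\<^sub>R (z - z0)" by (simp add: c_def algebra_simps)
    then show "dist (c t) z = (1 - t) * R" using that nz by (simp add: dist_norm norm_minus_commute)
    show "c t \<in> ball z0 R" using that nz R by (simp add: c_def dist_norm)
  qed
  have Pp: "P p = z"
  proof (rule ccontr)
    assume ne: "P p \<noteq> z"
    define e where "e = dist (P p) z / 2"
    have e: "e > 0" using ne by (simp add: e_def)
    have "openin X {q \<in> topspace X. P q \<in> ball (P p) e}"
      using openin_continuous_map_preimage[OF P_continuous, of "ball (P p) e"] by simp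
    then obtain t where t: "0 < t" "t < 1" "1 - e / R < t" "s (c t) \<in> {q \<in> topspace X. P q \<in> ball (P p) e}"
      using p(2)[of "{q \<in> topspace X. P q \<in> ball (P p) e}" "e / R"] p(1) e R by auto
    have "P (s (c t)) = c t" using s cz(2)[OF t(1,2)] by (simp add: local_section_def)
    then have "dist (P p) (c t) < e" using t(4) by simp
    moreover have "dist (c t) z < e" using cz(1)[OF t(1,2)] t(3) R by (simp add: field_simps)
    ultimately have "dist (P p) z < 2 * e" using dist_triangle[of "P p" z "c t"] by simp
    then show False by (simp add: e_def)
  qed
  obtain U r \<kappa> where sh: "sheet U (P p) r \<kappa>" "p \<in> U" using sheet_exists[OF openin_topspace p(1)] by blast
  have r: "r > 0" by (rule sheetD(2)[OF sh(1)])
  obtain t where t: "0 < t" "t < 1" "1 - r / R < t" "s (c t) \<in> U"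
    using p(2)[OF sheetD(1)[OF sh(1)] sh(2), of "r / R"] r R by auto
  have "c t \<in> ball z r" using cz(1)[OF t(1,2)] t(3) R by (simp add: field_simps dist_commute)
  then have ct: "c t \<in> ball z r \<inter> ball z0 R" using cz(2)[OF t(1,2)] by blast
  have Ps: "P (s (c t)) = c t" using s cz(2)[OF t(1,2)] by (simp add: local_section_def)
  have "\<kappa> (c t) = s (c t)" using sheetD(6)[OF sh(1) t(4)] Ps by simp
  moreover have k: "local_section (ball z r) \<kappa>" using sheet_local_section[OF sh(1)] Pp by simp
  ultimately have "\<kappa> w = s w" if "w \<in> ball z r \<inter> ball z0 R" for w
    using local_section_unique[of "ball z r \<inter> ball z0 R" \<kappa> s "c t" w] local_section_subset[OF k] local_section_subset[OF s] ct that
    by (simp add: convex_connected convex_Int)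
  then show ?thesis using r k by blast
qed

text \<open>The extensions to small discs around the boundary points are consistent and paste together. Their
domain is an open set that contains the closed disc, so by compactness it contains a larger disc.\<close>

lemma local_section_extend:
  assumes rad: "has_radial_limits" and R: "R > 0" and s: "local_section (ball z0 R) s"
  shows "\<exists>R' s'. R' > R \<and> local_section (ball z0 R') s' \<and> s' z0 = s z0"
proof -
  have "\<forall>z. \<exists>\<epsilon> \<sigma>. dist z0 z = R \<longrightarrow> \<epsilon> > 0 \<and> local_section (ball z \<epsilon>) \<sigma> \<and> (\<forall>w\<in>ball z \<epsilon> \<inter> ball z0 R. \<sigma> w = s w)"
    using local_section_boundary[OF rad R s] by blast
  then obtain \<epsilon> where "\<forall>z. \<exists>\<sigma>. dist z0 z = R \<longrightarrow> \<epsilon> z > 0 \<and> local_section (ball z (\<epsilon> z)) \<sigma> \<and>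
      (\<forall>w\<in>ball z (\<epsilon> z) \<inter> ball z0 R. \<sigma> w = s w)" by (rule choice[THEN exE])
  then obtain \<sigma> where b0: "\<forall>z. dist z0 z = R \<longrightarrow> \<epsilon> z > 0 \<and> local_section (ball z (\<epsilon> z)) (\<sigma> z) \<and>
      (\<forall>w\<in>ball z (\<epsilon> z) \<inter> ball z0 R. \<sigma> z w = s w)" by (rule choice[THEN exE])
  have b: "\<epsilon> z > 0" "local_section (ball z (\<epsilon> z)) (\<sigma> z)" "\<forall>w\<in>ball z (\<epsilon> z) \<inter> ball z0 R. \<sigma> z w = s w"
    if "dist z0 z = R" for z using b0 that by blast+
  define I where "I = insert None (Some ` {z. dist z0 z = R})"
  define T where "T i = (case i of None \<Rightarrow> ball z0 R | Some z \<Rightarrow> ball z (\<epsilon> z))" for i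
  define S where "S i = (case i of None \<Rightarrow> s | Some z \<Rightarrow> \<sigma> z)" for i
  have agree2: "\<sigma> z x = \<sigma> z' x" if zz: "dist z0 z = R" "dist z0 z' = R" and x: "x \<in> ball z (\<epsilon> z)" "x \<in> ball z' (\<epsilon> z')" for z z' x
  proof -
    obtain w where w: "w \<in> ball z (\<epsilon> z)" "w \<in> ball z' (\<epsilon> z')" "w \<in> ball z0 R"
      by (rule spheres_balls_meet_inside[OF zz R b(1)[OF zz(1)] b(1)[OF zz(2)] x])
    have "\<sigma> z w = s w" "\<sigma> z' w = s w" using b(3)[OF zz(1)] b(3)[OF zz(2)] w by blast+
    then have "\<sigma> z w = \<sigma> z' w" by simp
    moreover have "local_section (ball z (\<epsilon> z) \<inter> ball z' (\<epsilon> z')) (\<sigma> z)" "local_section (ball z (\<epsilon> z) \<inter> ball z' (\<epsilon> z')) (\<sigma> z')"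
      using local_section_subset[OF b(2)[OF zz(1)]] local_section_subset[OF b(2)[OF zz(2)]] by blast+
    ultimately show ?thesis
      using local_section_unique[of "ball z (\<epsilon> z) \<inter> ball z' (\<epsilon> z')" "\<sigma> z" "\<sigma> z'" w x] w x
      by (simp add: convex_connected convex_Int)
  qed
  have "\<exists>g. local_section (\<Union>i\<in>I. T i) g \<and> (\<forall>i\<in>I. \<forall>x\<in>T i. g x = S i x)"
  proof (rule local_section_pasting)
    show "open (T i)" if "i \<in> I" for i by (simp add: T_def split: option.split)
    show "local_section (T i) (S i)" if "i \<in> I" for i using that s b(2) by (auto simp: T_def S_def I_def)
    have 1: "\<sigma> z x = s x" if "dist z0 z = R" "x \<in> ball z (\<epsilon> z)" "x \<in> ball z0 R" for z x
      using b(3)[OF that(1)] that(2,3) by blast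
    show "S i x = S j x" if ij: "i \<in> I" "j \<in> I" "x \<in> T i" "x \<in> T j" for i j x
    proof (cases i)
      case None
      show ?thesis
      proof (cases j)
        case (Some z)
        then show ?thesis using ij None 1[of z x] by (simp add: I_def T_def S_def image_iff)
      qed (simp add: None)
    next
      case i: (Some z)
      show ?thesis
      proof (cases j)
        case None
        then show ?thesis using ij i 1[of z x] by (simp add: I_def T_def S_def image_iff)
      next
        case (Some z')
        then show ?thesis using ij i agree2[of z z' x] by (simp add: I_def T_def S_def image_iff)
      qed
    qed
  qed
  then obtain g where g: "local_section (\<Union>i\<in>I. T i) g" "\<forall>i\<in>I. \<forall>x\<in>T i. g x = S i x" by blast
  have o: "open (\<Union>i\<in>I. T i)" by (intro open_UN ballI) (simp add: T_def split: option.split)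
  have c: "cball z0 R \<subseteq> (\<Union>i\<in>I. T i)"
  proof
    fix w assume "w \<in> cball z0 R"
    then consider "w \<in> ball z0 R" | "dist z0 w = R" by force
    then show "w \<in> (\<Union>i\<in>I. T i)"
    proof cases
      case 1
      then show ?thesis by (intro UN_I[of None]) (auto simp: I_def T_def)
    next
      case 2
      then show ?thesis using b(1)[OF 2] 2 by (intro UN_I[of "Some w"]) (auto simp: I_def T_def)
    qed
  qed
  obtain e where e: "e > 0" "(\<Union>x\<in>cball z0 R. ball x e) \<subseteq> (\<Union>i\<in>I. T i)"
    using compact_subset_open_imp_ball_epsilon_subset[OF compact_cball o c] by blast
  have "ball z0 (R + e) \<subseteq> (\<Union>x\<in>cball z0 R. ball x e)"
  proof
    fix w assume w: "w \<in> ball z0 (R + e)"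
    show "w \<in> (\<Union>x\<in>cball z0 R. ball x e)"
    proof (cases "dist z0 w \<le> R")
      case True
      then show ?thesis using e(1) by (intro UN_I[of w]) auto
    next
      case False
      define x where "x = z0 + (R / dist z0 w) *\<^sub>R (w - z0)"
      have d: "dist z0 w > 0" "dist z0 w = norm (w - z0)" using False R by (auto simp: dist_norm norm_minus_commute)
      have "dist z0 x = R" using d R by (simp add: x_def dist_norm)
      moreover have "x - w = (R / dist z0 w - 1) *\<^sub>R (w - z0)" by (simp add: x_def algebra_simps)
      then have "dist x w = \<bar>R / dist z0 w - 1\<bar> * dist z0 w" using d by (simp add: dist_norm[of x])
      moreover have "R / dist z0 w - 1 \<le> 0" using False d(1) by simp
      then have "\<bar>R / dist z0 w - 1\<bar> * dist z0 w = (1 - R / dist z0 w) * dist z0 w" by (simp only: abs_of_nonpos) simp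
      moreover have "(1 - R / dist z0 w) * dist z0 w = dist z0 w - R" using d(1) by (simp add: left_diff_distrib)
      ultimately show ?thesis using w by (intro UN_I[of x]) auto
    qed
  qed
  then have "local_section (ball z0 (R + e)) g" by (intro local_section_subset[OF g(1)] subset_trans[OF _ e(2)])
  moreover have "g z0 = s z0"
  proof -
    have "None \<in> I" "z0 \<in> T None" using R by (auto simp: I_def T_def)
    then show ?thesis using bspec[OF bspec[OF g(2)], of None z0] by (simp add: S_def)
  qed
  ultimately show ?thesis using e(1) by (intro exI[of _ "R + e"] exI[of _ g]) auto
qed

text \<open>Sections through \<open>p\<^sub>0\<close> over concentric discs agree by uniqueness and paste to one over the union of
the discs. Were the radii bounded, this would be a disc of maximal radius, and could be extended.\<close>

lemma global_local_section:
  assumes rad: "has_radial_limits" and p0: "p0 \<in> topspace X"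
  shows "\<exists>s. local_section UNIV s \<and> s (P p0) = p0"
proof -
  let ?z0 = "P p0"
  define \<R> where "\<R> = {R. R > 0 \<and> (\<exists>s. local_section (ball ?z0 R) s \<and> s ?z0 = p0)}"
  obtain U r \<kappa> where sh: "sheet U ?z0 r \<kappa>" "p0 \<in> U" using sheet_exists[OF openin_topspace p0] by blast
  have r: "r \<in> \<R>" unfolding \<R>_def
    using sheet_local_section[OF sh(1)] sheetD(2)[OF sh(1)] sheetD(6)[OF sh(1,2)] by blast
  have "\<forall>R\<in>\<R>. \<exists>s. local_section (ball ?z0 R) s \<and> s ?z0 = p0" by (simp add: \<R>_def)
  from bchoice[OF this] obtain S where S0: "\<forall>R\<in>\<R>. local_section (ball ?z0 R) (S R) \<and> S R ?z0 = p0" by blast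
  note S = bspec[OF S0]
  have "\<exists>g. local_section (\<Union>R\<in>\<R>. ball ?z0 R) g \<and> (\<forall>R\<in>\<R>. \<forall>x\<in>ball ?z0 R. g x = S R x)"
  proof (rule local_section_pasting)
    show "S R x = S R' x" if "R \<in> \<R>" "R' \<in> \<R>" "x \<in> ball ?z0 R" "x \<in> ball ?z0 R'" for R R' x
    proof (rule local_section_unique[of "ball ?z0 R \<inter> ball ?z0 R'" _ _ ?z0])
      show "local_section (ball ?z0 R \<inter> ball ?z0 R') (S R)" "local_section (ball ?z0 R \<inter> ball ?z0 R') (S R')"
        using S[OF that(1)] S[OF that(2)] local_section_subset by blast+
      show "connected (ball ?z0 R \<inter> ball ?z0 R')" by (simp add: convex_connected convex_Int)
      show "?z0 \<in> ball ?z0 R \<inter> ball ?z0 R'" using that(1,2) by (simp add: \<R>_def)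
      show "S R ?z0 = S R' ?z0" using S that(1,2) by simp
    qed (use that in auto)
  qed (use S in auto)
  then obtain g where g: "local_section (\<Union>R\<in>\<R>. ball ?z0 R) g" "\<forall>R\<in>\<R>. \<forall>x\<in>ball ?z0 R. g x = S R x" by blast
  have gz0: "g ?z0 = p0" using bspec[OF bspec[OF g(2) r], of ?z0] S[OF r] r by (simp add: \<R>_def)
  have unb: "\<exists>R\<in>\<R>. R > B" for B
  proof (rule ccontr)
    assume "\<not> (\<exists>R\<in>\<R>. R > B)"
    then have bdd: "bdd_above \<R>" by (intro bdd_aboveI[of _ B]) force
    define R1 where "R1 = Sup \<R>"
    have R1: "R1 \<ge> r" "r > 0" using cSup_upper[OF r bdd] r by (auto simp: R1_def \<R>_def)
    have "ball ?z0 R1 \<subseteq> (\<Union>R\<in>\<R>. ball ?z0 R)"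
    proof
      fix x assume "x \<in> ball ?z0 R1"
      then have "dist ?z0 x < Sup \<R>" by (simp add: R1_def)
      then obtain R where "R \<in> \<R>" "dist ?z0 x < R" using less_cSupD[of \<R>] r by blast
      then show "x \<in> (\<Union>R\<in>\<R>. ball ?z0 R)" by auto
    qed
    then have "local_section (ball ?z0 R1) g" by (rule local_section_subset[OF g(1)])
    then obtain R' s' where s': "R' > R1" "local_section (ball ?z0 R') s'" "s' ?z0 = g ?z0"
      using local_section_extend[OF rad, of R1 ?z0 g] R1 by auto
    then have "R' \<in> \<R>" using gz0 R1 by (auto simp: \<R>_def)
    then have "R' \<le> R1" unfolding R1_def by (rule cSup_upper[OF _ bdd])
    then show False using s'(1) by simp
  qed
  have "(\<Union>R\<in>\<R>. ball ?z0 R) = UNIV"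
  proof -
    have "x \<in> (\<Union>R\<in>\<R>. ball ?z0 R)" for x using unb[of "dist ?z0 x"] by auto
    then show ?thesis by blast
  qed
  then show ?thesis using g(1) gz0 by auto
qed

text \<open>The image of the global section \<open>s\<close> is the set where \<open>s \<circ> P\<close> is the identity, which is closed in a
Hausdorff space. It is open because \<open>P\<close> is injective on sheets, and so it is the connected surface.\<close>

lemma bij_if_radial_limits:
  assumes "has_radial_limits"
  shows "bij_betw P (topspace X) UNIV"
proof -
  obtain p0 where p0: "p0 \<in> topspace X" using nonempty by blast
  obtain s where s: "local_section UNIV s" "s (P p0) = p0" using global_local_section[OF assms p0] by blast
  have c: "continuous_map euclidean X s" and Ps: "\<And>z. P (s z) = z" using s(1) by (auto simp: local_section_def)
  have csP: "continuous_map X X (s \<circ> P)" by (rule continuous_map_compose[OF P_continuous c])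
  let ?S = "{q \<in> topspace X. (s \<circ> P) q = q}"
  have "closedin X ?S"
    using closedin_continuous_maps_eq[OF Hausdorff csP continuous_map_id] by simp
  moreover have "openin X ?S"
  proof (subst openin_subopen, intro ballI)
    fix q assume q: "q \<in> ?S"
    then obtain U r \<kappa> where sh: "sheet U (P q) r \<kappa>" "q \<in> U" using sheet_exists[OF openin_topspace] by blast
    let ?T = "U \<inter> {x \<in> topspace X. (s \<circ> P) x \<in> U}"
    have "openin X ?T" by (intro openin_Int sheetD(1)[OF sh(1)] openin_continuous_map_preimage[OF csP])
    moreover have "q \<in> ?T" using q sh(2) by simp
    moreover have "?T \<subseteq> ?S"
    proof
      fix x assume x: "x \<in> ?T"
      then have "\<kappa> (P x) = x" "\<kappa> (P (s (P x))) = s (P x)" using sheetD(6)[OF sh(1)] by auto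
      then show "x \<in> ?S" using x by (simp add: Ps)
    qed
    ultimately show "\<exists>T. openin X T \<and> q \<in> T \<and> T \<subseteq> ?S" by blast
  qed
  ultimately have "?S = {} \<or> ?S = topspace X" using connected unfolding connected_space_clopen_in by blast
  moreover have "p0 \<in> ?S" using p0 s(2) by simp
  ultimately have S: "?S = topspace X" by blast
  show ?thesis
  proof (rule bij_betwI[of _ _ _ s])
    show "P \<in> topspace X \<rightarrow> UNIV" by simp
    show "s \<in> UNIV \<rightarrow> topspace X" using local_section_in_X[OF s(1)] by simp
    show "s (P x) = x" if "x \<in> topspace X" for x using S that by auto
    show "P (s y) = y" for y by (rule Ps)
  qed
qed

end

section \<open>Lengths of curves\<close>

lemma partition_mono:
  fixes \<tau> :: "nat \<Rightarrow> real"
  assumes "\<forall>i<n. \<tau> i < \<tau> (Suc i)" "i \<le> j" "j \<le> n"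
  shows "\<tau> i \<le> \<tau> j"
  using assms(2,3)
proof (induction j)
  case (Suc j)
  show ?case
  proof (cases "i = Suc j")
    case False
    then have "\<tau> i \<le> \<tau> j" using Suc by simp
    also have "\<tau> j < \<tau> (Suc j)" using assms(1) Suc.prems(2) by simp
    finally show ?thesis by simp
  qed simp
qed simp

lemma partition_cover:
  fixes \<tau> :: "nat \<Rightarrow> real"
  assumes "\<tau> 0 \<le> t" "t < \<tau> n"
  shows "\<exists>i<n. \<tau> i \<le> t \<and> t < \<tau> (Suc i)"
  using assms(2)
proof (induction n)
  case (Suc n)
  then show ?case by (cases "t < \<tau> n") (auto simp: not_less less_Suc_eq)
qed (use assms(1) in simp)

text \<open>Smoothness at the end points refers to an extension, so the one-sided derivative is continuous up to
the boundary. This makes the speed of a piecewise smooth curve integrable.\<close>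

lemma smooth_on_interval_C1:
  fixes c :: "real \<Rightarrow> 'b::euclidean_space"
  assumes ab: "a < b" and sm: "smooth_on {a..b} c"
  defines "c' \<equiv> \<lambda>t. vector_derivative c (at t within {a..b})"
  shows "continuous_on {a..b} c'" "\<And>t. t \<in> {a..b} \<Longrightarrow> (c has_vector_derivative c' t) (at t within {a..b})"
proof -
  have key: "\<exists>W. open W \<and> t \<in> W \<and> continuous_on ({a..b} \<inter> W) c' \<and>
     (\<forall>s\<in>{a..b} \<inter> W. (c has_vector_derivative c' s) (at s within {a..b}))" if t: "t \<in> {a..b}" for t
  proof -
    obtain W g where W: "open W" "t \<in> W" "\<forall>n. Ck_on n W g" "\<forall>y\<in>{a..b} \<inter> W. g y = c y"
      using sm t by (rule smooth_onE)
    have d: "(c has_vector_derivative frechet_derivative g (at s) 1) (at s within {a..b})" if s: "s \<in> {a..b} \<inter> W" for s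
    proof -
      have D: "(g has_derivative frechet_derivative g (at s)) (at s)"
        using Ck_on_Suc_has_derivative[of 0 W g s] W(3) s by blast
      have "(g has_derivative frechet_derivative g (at s)) (at s within {a..b})"
        using D by (rule has_derivative_at_withinI)
      then have "(c has_derivative frechet_derivative g (at s)) (at s within {a..b})"
      proof -
        obtain e where "e > 0" "ball s e \<subseteq> W" using W(1) s open_contains_ball_eq[of W] by blast
        then show ?thesis using \<open>(g has_derivative frechet_derivative g (at s)) (at s within {a..b})\<close> W(4) s
          by (intro has_derivative_transform_within[of g _ s "{a..b}" e c]) (auto simp: subset_iff dist_commute)
      qed
      moreover have "frechet_derivative g (at s) = (\<lambda>h. h *\<^sub>R frechet_derivative g (at s) 1)"
      proof (rule ext)
        show "frechet_derivative g (at s) h = h *\<^sub>R frechet_derivative g (at s) 1" for h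
          using linear_scale[OF has_derivative_linear[OF D], of h 1] by simp
      qed
      ultimately show ?thesis unfolding has_vector_derivative_def by (rule has_derivative_eq_rhs)
    qed
    have e: "c' s = frechet_derivative g (at s) 1" if s: "s \<in> {a..b} \<inter> W" for s
      unfolding c'_def using vector_derivative_within_closed_interval[OF ab _ d[OF s]] s by simp
    have "Ck_on 0 W (\<lambda>s. frechet_derivative g (at s) 1)" using W(3)[rule_format, of "Suc 0"] by simp
    then have "continuous_on ({a..b} \<inter> W) (\<lambda>s. frechet_derivative g (at s) 1)"
      by (auto intro: continuous_on_subset)
    then have "continuous_on ({a..b} \<inter> W) c'" by (rule continuous_on_eq) (use e in simp)
    then show ?thesis using W(1,2) d e by (intro exI[of _ W]) auto
  qed
  show "(c has_vector_derivative c' t) (at t within {a..b})" if t: "t \<in> {a..b}" for t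
    using key[OF t] t by blast
  show "continuous_on {a..b} c'"
    unfolding continuous_on_eq_continuous_within
  proof
    fix t assume t: "t \<in> {a..b}"
    then obtain W where W: "open W" "t \<in> W" "continuous_on ({a..b} \<inter> W) c'" using key by blast
    then have "continuous (at t within {a..b} \<inter> W) c'" using t by (simp add: continuous_on_eq_continuous_within)
    moreover have "at t within {a..b} \<inter> W = at t within {a..b}"
      by (rule at_within_nhd[OF W(2,1)]) blast
    ultimately show "continuous (at t within {a..b}) c'" by simp
  qed
qed

context null_graph_surface
begin

abbreviation "velocity \<gamma> t \<equiv> vector_derivative (P \<circ> \<gamma>) (at t)"
abbreviation "speed \<gamma> t \<equiv> sqrt (inner52 (vector_derivative (f \<circ> \<gamma>) (at t)) (vector_derivative (f \<circ> \<gamma>) (at t)))"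

lemma pathin_preimage_open:
  assumes "pathin X \<gamma>" "openin X U"
  obtains W where "open W" "{t \<in> {0..1}. \<gamma> t \<in> U} = {0..1} \<inter> W"
  using openin_continuous_map_preimage[OF assms(1)[unfolded pathin_def] assms(2)]
  by (auto simp: openin_open)

lemma pathin_P_continuous: "pathin X \<gamma> \<Longrightarrow> continuous_on {0..1} (P \<circ> \<gamma>)"
  using continuous_map_compose[OF _ P_continuous, of "top_of_set {0..1}" \<gamma>] by (simp add: pathin_def)

lemma pathin_in_X: "pathin X \<gamma> \<Longrightarrow> t \<in> {0..1} \<Longrightarrow> \<gamma> t \<in> topspace X"
  unfolding pathin_def using continuous_map_funspace by fastforce

text \<open>Charts and \<open>P\<close> differ by local diffeomorphisms, so the smoothness of a curve in all charts amounts to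
that of its image in the plane.\<close>

lemma smooth_piece_iff:
  assumes \<gamma>: "pathin X \<gamma>" and ab: "{a..b} \<subseteq> {0..1}"
  shows "(\<forall>(V, \<psi>)\<in>A. smooth_on {t\<in>{a..b}. \<gamma> t \<in> \<psi> ` V} (inv_into V \<psi> \<circ> \<gamma>)) \<longleftrightarrow> smooth_on {a..b} (P \<circ> \<gamma>)"
proof
  assume L: "\<forall>(V, \<psi>)\<in>A. smooth_on {t\<in>{a..b}. \<gamma> t \<in> \<psi> ` V} (inv_into V \<psi> \<circ> \<gamma>)"
  show "smooth_on {a..b} (P \<circ> \<gamma>)"
  proof (rule smooth_on_local)
    fix t assume t: "t \<in> {a..b}"
    then have "\<gamma> t \<in> topspace X" using pathin_in_X[OF \<gamma>] ab by blast
    then obtain V \<psi> u where c: "(V, \<psi>) \<in> A" "u \<in> V" "\<psi> u = \<gamma> t" by (rule chart_exists)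
    obtain W where W: "open W" "{t \<in> {0..1}. \<gamma> t \<in> \<psi> ` V} = {0..1} \<inter> W"
      by (rule pathin_preimage_open[OF \<gamma> chart_image_open[OF c(1)]])
    have sub: "{a..b} \<inter> W \<subseteq> {t\<in>{a..b}. \<gamma> t \<in> \<psi> ` V}" using W(2) ab by blast
    have "smooth_on {t\<in>{a..b}. \<gamma> t \<in> \<psi> ` V} (\<lambda>t. (P \<circ> \<psi>) ((inv_into V \<psi> \<circ> \<gamma>) t))"
      by (rule smooth_on_compose[OF bspec[OF L c(1), unfolded prod.case] P_chart_smooth[OF c(1)]])
        (auto intro: inv_into_into)
    then have "smooth_on ({a..b} \<inter> W) (\<lambda>t. (P \<circ> \<psi>) ((inv_into V \<psi> \<circ> \<gamma>) t))"
      using sub by (rule smooth_on_subset)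
    moreover have "(P \<circ> \<psi>) ((inv_into V \<psi> \<circ> \<gamma>) s) = (P \<circ> \<gamma>) s" if "s \<in> {a..b} \<inter> W" for s
    proof -
      have "\<gamma> s \<in> \<psi> ` V" using sub that by blast
      then show ?thesis by (simp add: f_inv_into_f)
    qed
    ultimately have "smooth_on ({a..b} \<inter> W) (P \<circ> \<gamma>)" by (subst smooth_on_cong[symmetric]) auto
    moreover have "t \<in> {0..1} \<inter> W" unfolding W(2)[symmetric] using t ab c by (auto intro!: image_eqI[of _ \<psi> u])
    ultimately show "\<exists>W. open W \<and> t \<in> W \<and> smooth_on ({a..b} \<inter> W) (P \<circ> \<gamma>)"
      using W(1) by (intro exI[of _ W]) simp
  qed
next
  assume R: "smooth_on {a..b} (P \<circ> \<gamma>)"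
  show "\<forall>(V, \<psi>)\<in>A. smooth_on {t\<in>{a..b}. \<gamma> t \<in> \<psi> ` V} (inv_into V \<psi> \<circ> \<gamma>)"
  proof (intro ballI, unfold split_paired_all prod.case)
    fix V \<psi> assume c: "(V, \<psi>) \<in> A"
    let ?S = "{t\<in>{a..b}. \<gamma> t \<in> \<psi> ` V}"
    show "smooth_on ?S (inv_into V \<psi> \<circ> \<gamma>)"
    proof (rule smooth_on_local)
      fix t assume t: "t \<in> ?S"
      then have "\<gamma> t \<in> \<psi> ` V" by simp
      from sheet_exists[OF chart_image_open[OF c] this]
      obtain U r \<kappa> where sh: "sheet U (P (\<gamma> t)) r \<kappa>" "\<gamma> t \<in> U" "U \<subseteq> \<psi> ` V" by blast
      obtain W where W: "open W" "{t \<in> {0..1}. \<gamma> t \<in> U} = {0..1} \<inter> W"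
        by (rule pathin_preimage_open[OF \<gamma> sheetD(1)[OF sh(1)]])
      have inU: "\<gamma> s \<in> U" if "s \<in> ?S \<inter> W" for s using that W(2) ab by blast
      have "smooth_on (?S \<inter> W) (\<lambda>t. (inv_into V \<psi> \<circ> \<kappa>) ((P \<circ> \<gamma>) t))"
      proof (rule smooth_on_compose[OF smooth_on_subset[OF R] sheet_smooth[OF sh(1) c]])
        show "(P \<circ> \<gamma>) ` (?S \<inter> W) \<subseteq> {z \<in> ball (P (\<gamma> t)) r. \<kappa> z \<in> \<psi> ` V}"
        proof (rule image_subsetI)
          fix s assume s: "s \<in> ?S \<inter> W"
          from inU[OF s] sheetD(5,6)[OF sh(1) inU[OF s]] sh(3)
          show "(P \<circ> \<gamma>) s \<in> {z \<in> ball (P (\<gamma> t)) r. \<kappa> z \<in> \<psi> ` V}" by auto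
        qed
      qed auto
      moreover have "(inv_into V \<psi> \<circ> \<kappa>) ((P \<circ> \<gamma>) s) = (inv_into V \<psi> \<circ> \<gamma>) s" if "s \<in> ?S \<inter> W" for s
        using sheetD(6)[OF sh(1) inU[OF that]] by simp
      ultimately have "smooth_on (?S \<inter> W) (inv_into V \<psi> \<circ> \<gamma>)" by (subst smooth_on_cong[symmetric]) auto
      moreover have "t \<in> {0..1} \<inter> W" unfolding W(2)[symmetric] using t ab sh(2) by auto
      ultimately show "\<exists>W. open W \<and> t \<in> W \<and> smooth_on (?S \<inter> W) (inv_into V \<psi> \<circ> \<gamma>)"
        using W(1) by (intro exI[of _ W]) simp
    qed
  qed
qed

lemma piecewise_smooth_curve_iff:
  "piecewise_smooth_curve X A \<gamma> \<longleftrightarrow> pathin X \<gamma> \<and>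
     (\<exists>(n::nat) \<tau>. \<tau> 0 = 0 \<and> \<tau> n = 1 \<and> (\<forall>i<n. \<tau> i < \<tau> (Suc i) \<and> smooth_on {\<tau> i..\<tau> (Suc i)} (P \<circ> \<gamma>)))"
proof (cases "pathin X \<gamma>")
  case True
  define Y where "Y a b \<longleftrightarrow> (\<forall>(V, \<psi>)\<in>A. smooth_on {t\<in>{a..b}. \<gamma> t \<in> \<psi> ` V} (inv_into V \<psi> \<circ> \<gamma>))" for a b
  define Z where "Z a b \<longleftrightarrow> smooth_on {a..b} (P \<circ> \<gamma>)" for a b
  have YZ: "Y a b = Z a b" if "{a..b} \<subseteq> {0..1}" for a b
    unfolding Y_def Z_def by (rule smooth_piece_iff[OF True that])
  have sub: "{\<tau> i..\<tau> (Suc i)} \<subseteq> {0..1}"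
    if "\<tau> 0 = 0" "\<tau> n = 1" "\<forall>i<n. \<tau> i < \<tau> (Suc i)" "i < n" for i n and \<tau> :: "nat \<Rightarrow> real"
    using partition_mono[OF that(3), of 0 i] partition_mono[OF that(3), of "Suc i" n] that by auto
  have "(\<tau> 0 = 0 \<and> \<tau> n = 1 \<and> (\<forall>i<n. \<tau> i < \<tau> (Suc i) \<and> Y (\<tau> i) (\<tau> (Suc i)))) \<longleftrightarrow>
      (\<tau> 0 = 0 \<and> \<tau> n = 1 \<and> (\<forall>i<n. \<tau> i < \<tau> (Suc i) \<and> Z (\<tau> i) (\<tau> (Suc i))))" for n and \<tau> :: "nat \<Rightarrow> real"
    using YZ[OF sub[of \<tau> n]] by blast
  then show ?thesis
    unfolding piecewise_smooth_curve_def Y_def[symmetric] Z_def[symmetric] by presburger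
qed (simp add: piecewise_smooth_curve_def)

text \<open>Near \<open>t\<close> the curve is \<open>\<kappa> \<circ> (P \<circ> \<gamma>)\<close> for a sheet \<open>\<kappa>\<close>, so \<open>f \<circ> \<gamma>\<close> is differentiable at \<open>t\<close> and
\<open>induced_metric\<close> applies to the curve itself.\<close>

lemma speed_eq:
  assumes \<gamma>: "pathin X \<gamma>" and t: "0 < t" "t < 1" and v: "((P \<circ> \<gamma>) has_vector_derivative v) (at t)"
  shows "speed \<gamma> t = sqrt (hyp_metric (P (\<gamma> t)) v v)"
proof -
  have "\<gamma> t \<in> topspace X" using pathin_in_X[OF \<gamma>] t by simp
  then obtain U r \<kappa> where sh: "sheet U (P (\<gamma> t)) r \<kappa>" "\<gamma> t \<in> U" using sheet_exists[OF openin_topspace] by blast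
  obtain W where W: "open W" "{t \<in> {0..1}. \<gamma> t \<in> U} = {0..1} \<inter> W"
    by (rule pathin_preimage_open[OF \<gamma> sheetD(1)[OF sh(1)]])
  let ?B = "{0<..<1} \<inter> W"
  have inU: "\<gamma> s \<in> U" if "s \<in> ?B" for s
  proof -
    have "s \<in> {0..1} \<inter> W" using that by auto
    then show ?thesis unfolding W(2)[symmetric] by simp
  qed
  have "t \<in> {0..1} \<inter> W" unfolding W(2)[symmetric] using t sh(2) by auto
  then have B: "open ?B" "t \<in> ?B" using W(1) t by auto
  have im: "\<gamma> ` ?B \<subseteq> topspace X" using inU openin_subset[OF sheetD(1)[OF sh(1)]] by blast
  have "P (\<gamma> t) \<in> ball (P (\<gamma> t)) r" using sheetD(2)[OF sh(1)] by simp
  from smooth_on_has_derivative[OF open_ball sheet_f_smooth[OF sh(1)] this]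
  have Df: "((f \<circ> \<kappa>) has_derivative frechet_derivative (f \<circ> \<kappa>) (at (P (\<gamma> t)))) (at ((P \<circ> \<gamma>) t))" by simp
  define D where "D h = frechet_derivative (f \<circ> \<kappa>) (at (P (\<gamma> t))) (h *\<^sub>R v)" for h
  have "((\<lambda>s. (f \<circ> \<kappa>) ((P \<circ> \<gamma>) s)) has_derivative D) (at t)"
    using has_derivative_compose[OF v[unfolded has_vector_derivative_def] Df] unfolding D_def[abs_def] .
  then have D: "((f \<circ> \<gamma>) has_derivative D) (at t)"
  proof (rule has_derivative_transform_within_open[OF _ B])
    fix s assume "s \<in> ?B"
    then show "(f \<circ> \<kappa>) ((P \<circ> \<gamma>) s) = (f \<circ> \<gamma>) s" using sheetD(6)[OF sh(1) inU] by simp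
  qed
  have "D h = h *\<^sub>R D 1" for h
    using linear_scale[OF has_derivative_linear[OF D], of h 1] by simp
  then have "D = (\<lambda>h. h *\<^sub>R D 1)" by (rule ext)
  with D have "((f \<circ> \<gamma>) has_vector_derivative D 1) (at t)"
    unfolding has_vector_derivative_def by (rule has_derivative_eq_rhs)
  then have 1: "vector_derivative (f \<circ> \<gamma>) (at t) = D 1" by (rule vector_derivative_at)
  have "coords2 \<circ> D = (\<lambda>h. h *\<^sub>R v)"
    using has_derivative_unique[OF induced_metric(1)[OF B im D] v[unfolded has_vector_derivative_def]] .
  then have "coords2 (D 1) = v" by (auto simp: fun_eq_iff dest: spec[of _ 1])
  then show ?thesis unfolding 1 using induced_metric(4)[OF B im D, of 1 1] by simp
qed

lemma continuous_on_speed: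
  assumes "continuous_on S c" "continuous_on S v"
  shows "continuous_on S (\<lambda>t. sqrt (hyp_metric (c t) (v t) (v t)))"
  unfolding hyp_metric_def
  by (intro continuous_intros assms) (use one_plus_inner_pos in \<open>auto simp: less_imp_neq[symmetric]\<close>)

lemma piecewise_smooth_speed:
  assumes "piecewise_smooth_curve X A \<gamma>"
  shows "\<exists>S. finite S \<and> (\<forall>t\<in>{0..1} - S. 0 < t \<and> t < 1 \<and> ((P \<circ> \<gamma>) has_vector_derivative velocity \<gamma> t) (at t) \<and>
      speed \<gamma> t = sqrt (hyp_metric (P (\<gamma> t)) (velocity \<gamma> t) (velocity \<gamma> t))) \<and> speed \<gamma> integrable_on {0..1}"
proof -
  obtain n \<tau> where \<gamma>: "pathin X \<gamma>" and \<tau>: "\<tau> 0 = 0" "\<tau> (n::nat) = 1"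
    "\<forall>i<n. \<tau> i < \<tau> (Suc i) \<and> smooth_on {\<tau> i..\<tau> (Suc i)} (P \<circ> \<gamma>)"
    using assms unfolding piecewise_smooth_curve_iff by blast
  have inc: "\<forall>i<n. \<tau> i < \<tau> (Suc i)" using \<tau>(3) by blast
  have bnd: "0 \<le> \<tau> i" "\<tau> (Suc i) \<le> 1" if "i < n" for i
    using partition_mono[OF inc, of 0 i] partition_mono[OF inc, of "Suc i" n] that \<tau>(1,2) by auto
  have piece: "((P \<circ> \<gamma>) has_vector_derivative velocity \<gamma> t) (at t) \<and>
      velocity \<gamma> t = vector_derivative (P \<circ> \<gamma>) (at t within {\<tau> i..\<tau> (Suc i)}) \<and>
      speed \<gamma> t = sqrt (hyp_metric (P (\<gamma> t)) (velocity \<gamma> t) (velocity \<gamma> t))"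
    if i: "i < n" and t: "\<tau> i < t" "t < \<tau> (Suc i)" for i t
  proof -
    have lt: "\<tau> i < \<tau> (Suc i)" and sm: "smooth_on {\<tau> i..\<tau> (Suc i)} (P \<circ> \<gamma>)" using \<tau>(3) i by auto
    let ?v = "vector_derivative (P \<circ> \<gamma>) (at t within {\<tau> i..\<tau> (Suc i)})"
    have "((P \<circ> \<gamma>) has_vector_derivative ?v) (at t within {\<tau> i..\<tau> (Suc i)})"
      by (rule smooth_on_interval_C1(2)[OF lt sm]) (use t in simp)
    moreover have "at t within {\<tau> i..\<tau> (Suc i)} = at t"
      by (rule at_within_interior) (use t in simp)
    ultimately have v: "((P \<circ> \<gamma>) has_vector_derivative ?v) (at t)" by simp
    then have e: "velocity \<gamma> t = ?v" by (rule vector_derivative_at)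
    have "speed \<gamma> t = sqrt (hyp_metric (P (\<gamma> t)) ?v ?v)"
      by (rule speed_eq[OF \<gamma> _ _ v]) (use t bnd[OF i] in auto)
    then show ?thesis using v e by simp
  qed
  have int: "speed \<gamma> integrable_on {\<tau> i..\<tau> (Suc i)}" if i: "i < n" for i
  proof -
    have lt: "\<tau> i < \<tau> (Suc i)" and sm: "smooth_on {\<tau> i..\<tau> (Suc i)} (P \<circ> \<gamma>)" using \<tau>(3) i by auto
    let ?v = "\<lambda>t. vector_derivative (P \<circ> \<gamma>) (at t within {\<tau> i..\<tau> (Suc i)})"
    have "continuous_on {\<tau> i..\<tau> (Suc i)} (\<lambda>t. sqrt (hyp_metric ((P \<circ> \<gamma>) t) (?v t) (?v t)))"
      by (intro continuous_on_speed smooth_on_imp_continuous_on[OF sm] smooth_on_interval_C1(1)[OF lt sm])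
    then have "(\<lambda>t. sqrt (hyp_metric ((P \<circ> \<gamma>) t) (?v t) (?v t))) integrable_on {\<tau> i..\<tau> (Suc i)}"
      by (rule integrable_continuous_real)
    note I = this
    show ?thesis
    proof (rule integrable_spike_finite[of "{\<tau> i, \<tau> (Suc i)}", OF _ _ I])
      fix t assume "t \<in> {\<tau> i..\<tau> (Suc i)} - {\<tau> i, \<tau> (Suc i)}"
      then have "\<tau> i < t" "t < \<tau> (Suc i)" by auto
      from piece[OF i this] show "speed \<gamma> t = sqrt (hyp_metric ((P \<circ> \<gamma>) t) (?v t) (?v t))" by simp
    qed simp
  qed
  have "speed \<gamma> integrable_on {0..\<tau> k}" if "k \<le> n" for k
    using that
  proof (induction k)
    case 0
    have "speed \<gamma> integrable_on cbox 0 0" by (rule integrable_on_refl)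
    then show ?case unfolding \<tau>(1) by (simp only: cbox_interval)
  next
    case (Suc k)
    have "0 \<le> \<tau> k" "\<tau> k \<le> \<tau> (Suc k)" using bnd[of k] inc Suc.prems by (auto simp: Suc_le_eq intro: less_imp_le)
    moreover have "speed \<gamma> integrable_on {0..\<tau> k}" by (rule Suc.IH) (use Suc.prems in simp)
    moreover have "speed \<gamma> integrable_on {\<tau> k..\<tau> (Suc k)}" by (rule int) (use Suc.prems in simp)
    ultimately show ?case by (rule Henstock_Kurzweil_Integration.integrable_combine)
  qed
  from this[of n] have I: "speed \<gamma> integrable_on {0..1}" by (simp add: \<tau>(2))
  have S: "0 < t \<and> t < 1 \<and> ((P \<circ> \<gamma>) has_vector_derivative velocity \<gamma> t) (at t) \<and>
      speed \<gamma> t = sqrt (hyp_metric (P (\<gamma> t)) (velocity \<gamma> t) (velocity \<gamma> t))" if t: "t \<in> {0..1} - \<tau> ` {..n}" for t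
  proof -
    have ne: "t \<noteq> \<tau> i" if "i \<le> n" for i using t that by auto
    have "\<tau> 0 \<le> t" "t < \<tau> n" using t \<tau>(1,2) ne[of n] by auto
    from partition_cover[OF this] obtain i where i: "i < n" "\<tau> i \<le> t" "t < \<tau> (Suc i)" by blast
    then have "\<tau> i < t" using ne[of i] by simp
    moreover have "0 < t" "t < 1" using t ne[of 0] ne[of n] \<tau>(1,2) by auto
    ultimately show ?thesis using piece[OF i(1) _ i(3)] by blast
  qed
  then show ?thesis using I by (intro exI[of _ "\<tau> ` {..n}"]) auto
qed

text \<open>At break points and at the two ends the vector derivative is an arbitrary vector. Replacing the
integrand by \<open>0\<close> there does not change the integral.\<close>

lemma curve_length_spike:
  assumes "finite S"
  shows "curve_length f \<gamma> = integral {0..1} (\<lambda>t. if t \<in> S then 0 else speed \<gamma> t)"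
  unfolding curve_length_def
  by (rule integral_spike[of S]) (use assms in auto)

lemma curve_length_nonneg:
  assumes "piecewise_smooth_curve X A \<gamma>"
  shows "curve_length f \<gamma> \<ge> 0"
proof -
  obtain S where S: "finite S" "\<forall>t\<in>{0..1} - S. speed \<gamma> t = sqrt (hyp_metric (P (\<gamma> t)) (velocity \<gamma> t) (velocity \<gamma> t))"
    "speed \<gamma> integrable_on {0..1}"
    using piecewise_smooth_speed[OF assms] by blast
  have "0 \<le> (if t \<in> S then 0 else speed \<gamma> t)" if "t \<in> {0..1}" for t
    using that S(2) hyp_metric_nonneg by auto
  moreover have "(\<lambda>t. if t \<in> S then 0 else speed \<gamma> t) integrable_on {0..1}"
    by (rule integrable_spike_finite[OF S(1) _ S(3)]) simp
  ultimately show ?thesis unfolding curve_length_spike[OF S(1)] by (intro integral_nonneg) auto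
qed

lemma curve_length_le:
  assumes "piecewise_smooth_curve X A \<gamma>" "\<And>t. 0 < t \<Longrightarrow> t < 1 \<Longrightarrow> norm (velocity \<gamma> t) \<le> B"
  shows "curve_length f \<gamma> \<le> B"
proof -
  obtain S where S: "finite S" "\<forall>t\<in>{0..1} - S. 0 < t \<and> t < 1 \<and> speed \<gamma> t = sqrt (hyp_metric (P (\<gamma> t)) (velocity \<gamma> t) (velocity \<gamma> t))"
    "speed \<gamma> integrable_on {0..1}"
    using piecewise_smooth_speed[OF assms(1)] by blast
  have B: "B \<ge> 0" using assms(2)[of "1/2"] norm_ge_zero[of "velocity \<gamma> (1/2)"] by linarith
  have le: "(if t \<in> S then 0 else speed \<gamma> t) \<le> B" if "t \<in> {0..1}" for t
  proof (cases "t \<in> S")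
    case False
    then have t: "0 < t" "t < 1" "speed \<gamma> t = sqrt (hyp_metric (P (\<gamma> t)) (velocity \<gamma> t) (velocity \<gamma> t))"
      using S(2) that by blast+
    have "speed \<gamma> t \<le> sqrt (velocity \<gamma> t \<bullet> velocity \<gamma> t)" unfolding t(3) by (intro real_sqrt_le_mono hyp_metric_le)
    also have "\<dots> \<le> B" using assms(2)[OF t(1,2)] by (simp add: norm_eq_sqrt_inner)
    finally show ?thesis using False by simp
  qed (use B in simp)
  have "(\<lambda>t. if t \<in> S then 0 else speed \<gamma> t) integrable_on {0..1}"
    by (rule integrable_spike_finite[OF S(1) _ S(3)]) simp
  then have "integral {0..1} (\<lambda>t. if t \<in> S then 0 else speed \<gamma> t) \<le> integral {0..1} (\<lambda>t::real. B)"
    by (rule integral_le[OF _ integrable_const_ivl le])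
  then show ?thesis unfolding curve_length_spike[OF S(1)] by simp
qed

text \<open>Where \<open>1 + |P|\<^sup>2 \<le> M\<^sup>2\<close>, the hyperbolic length of a vector is at least \<open>1/M\<close> times the Euclidean one, by
\<open>hyp_metric_ge\<close>. Integration of the velocity of \<open>P \<circ> \<gamma>\<close> gives the displacement.\<close>

lemma displacement_le_curve_length:
  assumes pw: "piecewise_smooth_curve X A \<gamma>" and t0: "0 \<le> t0" "t0 \<le> 1" and M: "M > 0"
    and bound: "\<And>t. t0 \<le> t \<Longrightarrow> t \<le> 1 \<Longrightarrow> 1 + P (\<gamma> t) \<bullet> P (\<gamma> t) \<le> M\<^sup>2"
  shows "norm (P (\<gamma> 1) - P (\<gamma> t0)) \<le> M * curve_length f \<gamma>"
proof -
  obtain S where S: "finite S" "\<forall>t\<in>{0..1} - S. 0 < t \<and> t < 1 \<and> ((P \<circ> \<gamma>) has_vector_derivative velocity \<gamma> t) (at t) \<and>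
      speed \<gamma> t = sqrt (hyp_metric (P (\<gamma> t)) (velocity \<gamma> t) (velocity \<gamma> t))" "speed \<gamma> integrable_on {0..1}"
    using piecewise_smooth_speed[OF pw] by blast
  have \<gamma>: "pathin X \<gamma>" using pw by (simp add: piecewise_smooth_curve_def)
  define sp where "sp t = (if t \<in> S then 0 else speed \<gamma> t)" for t
  define v where "v t = (if t \<in> S then 0 else velocity \<gamma> t)" for t
  have sp0: "sp t \<ge> 0" if "t \<in> {0..1}" for t using that S(2) hyp_metric_nonneg by (auto simp: sp_def)
  have spI: "sp integrable_on {0..1}" unfolding sp_def[abs_def]
    by (rule integrable_spike_finite[OF S(1) _ S(3)]) simp
  have spI': "sp integrable_on {t0..1}" by (rule integrable_subinterval_real[OF spI]) (use t0 in auto)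
  have "(velocity \<gamma> has_integral ((P \<circ> \<gamma>) 1 - (P \<circ> \<gamma>) t0)) {t0..1}"
  proof (rule fundamental_theorem_of_calculus_interior_strong[OF S(1) t0(2)])
    show "((P \<circ> \<gamma>) has_vector_derivative velocity \<gamma> t) (at t)" if "t \<in> {t0<..<1} - S" for t
      using S(2) that t0 by auto
    show "continuous_on {t0..1} (P \<circ> \<gamma>)"
      by (rule continuous_on_subset[OF pathin_P_continuous[OF \<gamma>]]) (use t0 in auto)
  qed
  then have vI: "(v has_integral (P (\<gamma> 1) - P (\<gamma> t0))) {t0..1}"
    by (intro has_integral_spike_finite[OF S(1), of _ v "velocity \<gamma>"]) (auto simp: v_def)
  have le: "norm (v t) \<le> M * sp t" if t: "t \<in> {t0..1}" for t
  proof (cases "t \<in> S")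
    case False
    have "speed \<gamma> t = sqrt (hyp_metric (P (\<gamma> t)) (velocity \<gamma> t) (velocity \<gamma> t))" using S(2) False t t0 by auto
    moreover have "(velocity \<gamma> t \<bullet> velocity \<gamma> t) / M\<^sup>2 \<le> hyp_metric (P (\<gamma> t)) (velocity \<gamma> t) (velocity \<gamma> t)"
    proof -
      have "(velocity \<gamma> t \<bullet> velocity \<gamma> t) / M\<^sup>2 \<le> (velocity \<gamma> t \<bullet> velocity \<gamma> t) / (1 + P (\<gamma> t) \<bullet> P (\<gamma> t))"
        using bound[of t] t one_plus_inner_pos[of "P (\<gamma> t)"] M by (intro divide_left_mono mult_pos_pos) auto
      then show ?thesis using hyp_metric_ge order.trans by blast
    qed
    ultimately have "sqrt ((velocity \<gamma> t \<bullet> velocity \<gamma> t) / M\<^sup>2) \<le> speed \<gamma> t" by simp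
    then have "norm (velocity \<gamma> t) / M \<le> speed \<gamma> t" using M by (simp add: real_sqrt_divide norm_eq_sqrt_inner)
    then show ?thesis using False M by (simp add: v_def sp_def divide_le_eq mult.commute)
  qed (simp add: v_def sp_def)
  have "norm (P (\<gamma> 1) - P (\<gamma> t0)) = norm (integral {t0..1} v)" using integral_unique[OF vI] by simp
  also have "\<dots> \<le> integral {t0..1} (\<lambda>t. M * sp t)"
  proof (rule integral_norm_bound_integral)
    show "v integrable_on {t0..1}" using vI by blast
    show "(\<lambda>t. M * sp t) integrable_on {t0..1}" using integrable_on_cmult_left[OF spI', of M] by simp
  qed (rule le)
  also have "\<dots> = M * integral {t0..1} sp" by simp
  also have "\<dots> \<le> M * integral {0..1} sp"
    using M t0 sp0 by (intro mult_left_mono integral_subset_le spI spI') auto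
  also have "\<dots> = M * curve_length f \<gamma>" unfolding curve_length_spike[OF S(1)] sp_def ..
  finally show ?thesis .
qed

lemma dist_bdd_below: "bdd_below {curve_length f \<gamma> | \<gamma>. piecewise_smooth_curve X A \<gamma> \<and> \<gamma> 0 = p \<and> \<gamma> 1 = q}"
  using curve_length_nonneg by (intro bdd_belowI[of _ 0]) auto

text \<open>The hyperbolic length of a vector is at most the Euclidean one, so the lift of a segment is no longer
than the segment.\<close>

lemma segment_curve:
  assumes s: "local_section (ball z0 R) s" and ab: "a \<in> ball z0 R" "b \<in> ball z0 R"
  shows "piecewise_smooth_curve X A (\<lambda>t. s (a + t *\<^sub>R (b - a)))"
    "induced_dist X A f (s a) (s b) \<le> norm (b - a)"
proof -
  define c where "c t = a + t *\<^sub>R (b - a)" for t :: real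
  let ?\<gamma> = "\<lambda>t. s (c t)"
  have cB: "c t \<in> ball z0 R" if "t \<in> {0..1}" for t
  proof -
    have "c t = (1 - t) *\<^sub>R a + t *\<^sub>R b" by (simp add: c_def algebra_simps)
    then show ?thesis using convexD_alt[OF convex_ball ab, of t] that by simp
  qed
  have Pc: "P (s (c t)) = c t" if "t \<in> {0..1}" for t using s cB[OF that] by (simp add: local_section_def)
  have smc: "smooth_on S c" for S
  proof (rule smooth_on_subset[of UNIV])
    show "smooth_on UNIV c" unfolding smooth_on_open_iff[OF open_UNIV] c_def
      by (intro allI Ck_on_add Ck_on_scaleR Ck_on_const Ck_on_bounded_linear bounded_linear_ident open_UNIV)
  qed simp
  have cc: "continuous_on {0..1} c" by (rule smooth_on_imp_continuous_on[OF smc])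
  then have cm: "continuous_map (top_of_set {0..1}) (top_of_set (ball z0 R)) c"
    using cB by (auto simp: continuous_map_in_subtopology)
  have "pathin X ?\<gamma>"
    unfolding pathin_def using continuous_map_compose[OF cm conjunct1[OF s[unfolded local_section_def]]] by (simp add: o_def)
  moreover have "smooth_on {0..1} (P \<circ> ?\<gamma>)"
    using smc Pc by (subst smooth_on_cong[of _ _ c]) auto
  ultimately show pw: "piecewise_smooth_curve X A (\<lambda>t. s (a + t *\<^sub>R (b - a)))"
    unfolding piecewise_smooth_curve_iff c_def[symmetric]
    by (intro conjI exI[of _ "Suc 0"] exI[of _ "\<lambda>i. if i = 0 then 0 else 1 :: real"]) auto
  have "curve_length f ?\<gamma> \<le> norm (b - a)"
  proof (rule curve_length_le)
    show "piecewise_smooth_curve X A ?\<gamma>" using pw by (simp add: c_def)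
    fix t :: real assume t: "0 < t" "t < 1"
    have "(c has_vector_derivative (b - a)) (at t)" unfolding c_def
      by (auto intro!: derivative_eq_intros)
    then have "((P \<circ> ?\<gamma>) has_vector_derivative (b - a)) (at t)"
    proof (rule has_vector_derivative_transform_within_open[of _ _ _ "{0<..<1}"])
      show "c y = (P \<circ> ?\<gamma>) y" if "y \<in> {0<..<1}" for y using Pc[of y] that by simp
    qed (use t in auto)
    then show "norm (velocity ?\<gamma> t) \<le> norm (b - a)" using vector_derivative_at by fastforce
  qed
  moreover have "induced_dist X A f (s a) (s b) \<le> curve_length f ?\<gamma>"
    unfolding induced_dist_def
  proof (rule cInf_lower[OF _ dist_bdd_below])
    show "curve_length f ?\<gamma> \<in> {curve_length f \<gamma> |\<gamma>. piecewise_smooth_curve X A \<gamma> \<and> \<gamma> 0 = s a \<and> \<gamma> 1 = s b}"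
      using pw by (auto simp: c_def intro!: exI[of _ ?\<gamma>])
  qed
  ultimately show "induced_dist X A f (s a) (s b) \<le> norm (b - a)" by linarith
qed

section \<open>Completeness\<close>

text \<open>The infimum of the empty set is an unspecified real number. A bound on the induced distance therefore
yields a curve only if the two points are known to be joined by one.\<close>

definition joined :: "'a \<Rightarrow> 'a \<Rightarrow> bool" where
  "joined p q \<longleftrightarrow> (\<exists>\<gamma>. piecewise_smooth_curve X A \<gamma> \<and> \<gamma> 0 = p \<and> \<gamma> 1 = q)"

lemma joined_refl: assumes "p \<in> topspace X" shows "joined p p"
proof -
  have "smooth_on S (P \<circ> (\<lambda>t::real. p))" for S
    unfolding o_def using smooth_on_subset[of UNIV "\<lambda>t. P p" S] smooth_on_open_iff[OF open_UNIV, of "\<lambda>t::real. P p"]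
      Ck_on_const[OF open_UNIV] by blast
  then have "piecewise_smooth_curve X A (\<lambda>t. p)"
    unfolding piecewise_smooth_curve_iff
    using assms by (intro conjI exI[of _ "Suc 0"] exI[of _ "\<lambda>i. if i = 0 then 0 else 1 :: real"]) auto
  then show ?thesis unfolding joined_def by blast
qed

text \<open>The given curve, run through at double speed, is followed by the lift of a segment inside the sheet.\<close>

lemma joined_sheet:
  assumes r: "joined p q" and sh: "sheet U z0 r \<kappa>" "q \<in> U" "q' \<in> U"
  shows "joined p q'"
proof -
  obtain \<gamma> where \<gamma>: "piecewise_smooth_curve X A \<gamma>" "\<gamma> 0 = p" "\<gamma> 1 = q" using r unfolding joined_def by blast
  define \<delta> where "\<delta> t = \<kappa> (P q + t *\<^sub>R (P q' - P q))" for t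
  have \<delta>: "piecewise_smooth_curve X A \<delta>" unfolding \<delta>_def
    by (rule segment_curve(1)[OF sheet_local_section[OF sh(1)]]) (use sheetD(5)[OF sh(1)] sh in auto)
  have \<delta>01: "\<delta> 0 = q" "\<delta> 1 = q'" using sheetD(6)[OF sh(1)] sh by (simp_all add: \<delta>_def)
  obtain n \<tau> where p\<gamma>: "pathin X \<gamma>" and \<tau>: "\<tau> 0 = 0" "\<tau> (n::nat) = 1"
    "\<forall>i<n. \<tau> i < \<tau> (Suc i) \<and> smooth_on {\<tau> i..\<tau> (Suc i)} (P \<circ> \<gamma>)"
    using \<gamma>(1) unfolding piecewise_smooth_curve_iff by blast
  obtain m \<upsilon> where p\<delta>: "pathin X \<delta>" and \<upsilon>: "\<upsilon> 0 = 0" "\<upsilon> (m::nat) = 1"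
    "\<forall>i<m. \<upsilon> i < \<upsilon> (Suc i) \<and> smooth_on {\<upsilon> i..\<upsilon> (Suc i)} (P \<circ> \<delta>)"
    using \<delta> unfolding piecewise_smooth_curve_iff by blast
  define \<eta> where "\<eta> t = (if t \<le> 1 / 2 then \<gamma> (2 * t) else \<delta> (2 * t - 1))" for t :: real
  define \<rho> where "\<rho> i = (if i \<le> n then \<tau> i / 2 else (1 + \<upsilon> (i - n)) / 2)" for i
  have inc: "\<forall>i<n. \<tau> i < \<tau> (Suc i)" "\<forall>i<m. \<upsilon> i < \<upsilon> (Suc i)" using \<tau>(3) \<upsilon>(3) by auto
  have \<rho>n: "\<rho> i = (1 + \<upsilon> (i - n)) / 2" if "n \<le> i" for i
    using that \<tau>(2) \<upsilon>(1) by (cases "i = n") (auto simp: \<rho>_def)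
  have "pathin X \<eta>"
    unfolding pathin_def \<eta>_def
  proof (rule continuous_map_cases_le)
    show "continuous_map (top_of_set {0..1}) euclideanreal (\<lambda>t. t)" by simp
    show "continuous_map (top_of_set {0..1}) euclideanreal (\<lambda>t. 1 / 2)" by simp
    have 1: "continuous_map (top_of_set {0..1/2}) (top_of_set {0..1}) (\<lambda>t::real. 2 * t)"
      by (auto simp: continuous_map_in_subtopology intro!: continuous_intros)
    have 2: "continuous_map (top_of_set {1/2..1}) (top_of_set {0..1}) (\<lambda>t::real. 2 * t - 1)"
      by (auto simp: continuous_map_in_subtopology intro!: continuous_intros)
    have e: "{0..1} \<inter> {t \<in> topspace (top_of_set {0..1}). t \<le> 1/2} = {0..1/2::real}"
      "{0..1} \<inter> {t \<in> topspace (top_of_set {0..1}). 1/2 \<le> t} = {1/2..1::real}" by auto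
    show "continuous_map (subtopology (top_of_set {0..1}) {t \<in> topspace (top_of_set {0..1}). t \<le> 1/2}) X (\<lambda>t. \<gamma> (2 * t))"
      unfolding subtopology_subtopology e
      using continuous_map_compose[OF 1 p\<gamma>[unfolded pathin_def]] by (simp only: o_def)
    show "continuous_map (subtopology (top_of_set {0..1}) {t \<in> topspace (top_of_set {0..1}). 1/2 \<le> t}) X (\<lambda>t. \<delta> (2 * t - 1))"
      unfolding subtopology_subtopology e
      using continuous_map_compose[OF 2 p\<delta>[unfolded pathin_def]] by (simp only: o_def)
    show "\<gamma> (2 * t) = \<delta> (2 * t - 1)" if "t = 1/2" for t
    proof -
      have "2 * t = 1" "2 * t - 1 = 0" using that by simp_all
      then show ?thesis using \<gamma>(3) \<delta>01(1) by metis
    qed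
  qed
  moreover have "\<rho> 0 = 0" "\<rho> (n + m) = 1" using \<tau>(1) \<rho>n[of "n + m"] \<upsilon>(2) by (simp_all add: \<rho>_def)
  moreover have "\<rho> i < \<rho> (Suc i) \<and> smooth_on {\<rho> i..\<rho> (Suc i)} (P \<circ> \<eta>)" if i: "i < n + m" for i
  proof (cases "i < n")
    case True
    have e: "\<rho> i = \<tau> i / 2" "\<rho> (Suc i) = \<tau> (Suc i) / 2" using True by (simp_all add: \<rho>_def)
    have le1: "\<tau> (Suc i) \<le> 1" using partition_mono[OF inc(1), of "Suc i" n] True \<tau>(2) by simp
    have "smooth_on {\<rho> i..\<rho> (Suc i)} (\<lambda>t. (P \<circ> \<gamma>) (2 * t))"
    proof (rule smooth_on_compose[where g = "\<lambda>t. 2 * t" and f = "P \<circ> \<gamma>"])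
      show "smooth_on {\<rho> i..\<rho> (Suc i)} (\<lambda>t. 2 * t)"
        by (rule smooth_on_bounded_linear) (rule bounded_linear_mult_right)
      show "smooth_on {\<tau> i..\<tau> (Suc i)} (P \<circ> \<gamma>)" using \<tau>(3) True by blast
      show "(\<lambda>t. 2 * t) ` {\<rho> i..\<rho> (Suc i)} \<subseteq> {\<tau> i..\<tau> (Suc i)}" unfolding e by auto
    qed
    moreover have "(P \<circ> \<gamma>) (2 * t) = (P \<circ> \<eta>) t" if "t \<in> {\<rho> i..\<rho> (Suc i)}" for t
      using that le1 unfolding e by (auto simp: \<eta>_def)
    ultimately have "smooth_on {\<rho> i..\<rho> (Suc i)} (P \<circ> \<eta>)" by (subst smooth_on_cong[symmetric]) auto
    then show ?thesis using inc(1) True unfolding e by auto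
  next
    case False
    define j where "j = i - n"
    have j: "j < m" "Suc i - n = Suc j" using i False by (auto simp: j_def)
    have e: "\<rho> i = (1 + \<upsilon> j) / 2" "\<rho> (Suc i) = (1 + \<upsilon> (Suc j)) / 2"
      using \<rho>n[of i] \<rho>n[of "Suc i"] False j(2) by (simp_all add: j_def)
    have ge0: "0 \<le> \<upsilon> j" using partition_mono[OF inc(2), of 0 j] j(1) \<upsilon>(1) by simp
    have "smooth_on {\<rho> i..\<rho> (Suc i)} (\<lambda>t. (P \<circ> \<delta>) (2 * t - 1))"
    proof (rule smooth_on_compose[where g = "\<lambda>t. 2 * t - 1" and f = "P \<circ> \<delta>"])
      have "smooth_on UNIV (\<lambda>t::real. 2 * t - 1)"
        unfolding smooth_on_open_iff[OF open_UNIV]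
        by (intro allI Ck_on_diff Ck_on_mult Ck_on_const Ck_on_bounded_linear bounded_linear_ident open_UNIV)
      then show "smooth_on {\<rho> i..\<rho> (Suc i)} (\<lambda>t. 2 * t - 1)" by (rule smooth_on_subset) simp
      show "smooth_on {\<upsilon> j..\<upsilon> (Suc j)} (P \<circ> \<delta>)" using \<upsilon>(3) j by blast
      show "(\<lambda>t. 2 * t - 1) ` {\<rho> i..\<rho> (Suc i)} \<subseteq> {\<upsilon> j..\<upsilon> (Suc j)}" unfolding e by auto
    qed
    moreover have "(P \<circ> \<delta>) (2 * t - 1) = (P \<circ> \<eta>) t" if "t \<in> {\<rho> i..\<rho> (Suc i)}" for t
    proof (cases "t = 1 / 2")
      case True
      then have "2 * t = 1" "2 * t - 1 = 0" by simp_all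
      then have "\<eta> t = \<delta> (2 * t - 1)" using True \<gamma>(3) \<delta>01(1) unfolding \<eta>_def by metis
      then show ?thesis by simp
    next
      case False
      then show ?thesis using that ge0 unfolding e by (auto simp: \<eta>_def)
    qed
    ultimately have "smooth_on {\<rho> i..\<rho> (Suc i)} (P \<circ> \<eta>)" by (subst smooth_on_cong[symmetric]) auto
    then show ?thesis using inc(2) j(1) unfolding e by auto
  qed
  ultimately have "piecewise_smooth_curve X A \<eta>" unfolding piecewise_smooth_curve_iff by blast
  moreover have "\<eta> 0 = p" "\<eta> 1 = q'" using \<gamma>(2) \<delta>01 by (simp_all add: \<eta>_def)
  ultimately show ?thesis unfolding joined_def by blast
qed

lemma joined_all:
  assumes "p \<in> topspace X" "q \<in> topspace X" shows "joined p q"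
proof -
  have "joined p q = joined p p"
  proof (rule connected_space_locally_constant[OF connected assms])
    fix q assume "q \<in> topspace X"
    then obtain U r \<kappa> where sh: "sheet U (P q) r \<kappa>" "q \<in> U" using sheet_exists[OF openin_topspace] by blast
    have "joined p q' = joined p q" if "q' \<in> U" for q'
      using joined_sheet[OF _ sh(1) sh(2) that] joined_sheet[OF _ sh(1) that sh(2)] by blast
    then show "\<exists>U. openin X U \<and> q \<in> U \<and> (\<forall>q'\<in>U. joined p q' = joined p q)"
      using sheetD(1)[OF sh(1)] sh(2) by blast
  qed
  then show ?thesis using joined_refl[OF assms(1)] by simp
qed

text \<open>Consider a curve from \<open>q \<notin> U\<close> to \<open>p\<close>, and the last time \<open>t\<^sub>0\<close> at which it is outside the part \<open>W\<close> of the
sheet over the disc of radius \<open>r/2\<close>. At that time it is over the boundary circle, because the part \<open>K\<close>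
over the closed disc is compact, hence closed. From then on it stays over the closed disc, where
\<open>1 + |P|\<^sup>2 \<le> M\<^sup>2\<close>, and its image in the plane moves by \<open>r/2\<close>. Its length is then at least \<open>(r/2)/M\<close>.\<close>

lemma dist_small_in_sheet:
  assumes sh: "sheet U (P p) r \<kappa>" "p \<in> U" and q: "q \<in> topspace X"
    and M: "M = sqrt (1 + (norm (P p) + r / 2)\<^sup>2)" and d: "induced_dist X A f q p < r / 2 / M"
  shows "q \<in> U"
proof (rule ccontr)
  assume qU: "q \<notin> U"
  have r: "r > 0" by (rule sheetD(2)[OF sh(1)])
  have M0: "M > 0" "M\<^sup>2 = 1 + (norm (P p) + r / 2)\<^sup>2"
    unfolding M by (simp_all add: add_pos_nonneg)
  have p: "p \<in> topspace X" using sh openin_subset[OF sheetD(1)[OF sh(1)]] by blast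
  have "{curve_length f \<gamma> |\<gamma>. piecewise_smooth_curve X A \<gamma> \<and> \<gamma> 0 = q \<and> \<gamma> 1 = p} \<noteq> {}"
    using joined_all[OF q p] unfolding joined_def by blast
  from cInf_lessD[OF this d[unfolded induced_dist_def]]
  obtain \<gamma> where \<gamma>: "piecewise_smooth_curve X A \<gamma>" "\<gamma> 0 = q" "\<gamma> 1 = p" "curve_length f \<gamma> < r / 2 / M" by blast
  have path: "pathin X \<gamma>" using \<gamma>(1) by (simp add: piecewise_smooth_curve_def)
  define W where "W = {x \<in> U. P x \<in> ball (P p) (r / 2)}"
  define K where "K = \<kappa> ` cball (P p) (r / 2)"
  have cb: "cball (P p) (r / 2) \<subseteq> ball (P p) r" using r by auto
  have "W = U \<inter> {x \<in> topspace X. P x \<in> ball (P p) (r / 2)}"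
    using openin_subset[OF sheetD(1)[OF sh(1)]] by (auto simp: W_def)
  then have Wo: "openin X W"
    using openin_continuous_map_preimage[OF P_continuous, of "ball (P p) (r / 2)"] sheetD(1)[OF sh(1)] by auto
  have "compactin (top_of_set (ball (P p) r)) (cball (P p) (r / 2))"
    using cb by (simp add: compactin_subtopology)
  then have "compactin X K" unfolding K_def by (rule image_compactin[OF _ sheetD(7)[OF sh(1)]])
  then have Kc: "closedin X K" by (rule compactin_imp_closedin[OF Hausdorff])
  have WK: "W \<subseteq> K"
  proof
    fix x assume x: "x \<in> W"
    then have "x = \<kappa> (P x)" "P x \<in> cball (P p) (r / 2)" using sheetD(6)[OF sh(1), of x] by (auto simp: W_def)
    then show "x \<in> K" unfolding K_def by blast
  qed
  define C where "C = {t \<in> {0..1}. \<gamma> t \<in> topspace X - W}"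
  have "closedin (top_of_set {0..1}) C"
    unfolding C_def using closedin_continuous_map_preimage[OF path[unfolded pathin_def], of "topspace X - W"] Wo by auto
  then have "compact C" using closedin_compact[OF compact_Icc] by blast
  moreover have "0 \<in> C" using q qU \<gamma>(2) by (auto simp: C_def W_def)
  ultimately obtain t0 where t0: "t0 \<in> C" "\<forall>t\<in>C. t \<le> t0" using compact_attains_sup[of C] by blast
  have pW: "p \<in> W" using sh r by (simp add: W_def)
  have t01: "0 \<le> t0" "t0 \<le> 1" "t0 \<noteq> 1" using t0(1) \<gamma>(3) pW by (auto simp: C_def)
  have inW: "\<gamma> t \<in> W" if "t0 < t" "t \<le> 1" for t
  proof (rule ccontr)
    assume "\<gamma> t \<notin> W"
    then have "t \<in> C" using that t01 pathin_in_X[OF path, of t] by (auto simp: C_def)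
    then show False using t0(2) that by force
  qed
  have "\<gamma> t0 \<in> K"
  proof -
    have "closedin (top_of_set {0..1}) {t \<in> {0..1}. \<gamma> t \<in> K}"
      using closedin_continuous_map_preimage[OF path[unfolded pathin_def] Kc] by simp
    then have "closed {t \<in> {0..1}. \<gamma> t \<in> K}" using closedin_closed_trans closed_atLeastAtMost by blast
    moreover have "{t0<..1} \<subseteq> {t \<in> {0..1}. \<gamma> t \<in> K}" using inW WK t01 by auto
    ultimately have "closure {t0<..1} \<subseteq> {t \<in> {0..1}. \<gamma> t \<in> K}" by (rule closure_minimal[rotated])
    moreover have "closure {t0<..1} = {t0..1}" using t01 by (intro closure_greaterThanAtMost) simp
    ultimately show ?thesis using t01 by auto
  qed
  then obtain z where z: "z \<in> cball (P p) (r / 2)" "\<gamma> t0 = \<kappa> z" unfolding K_def by blast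
  have zb: "z \<in> ball (P p) r" using z(1) cb by blast
  then have Pz: "P (\<gamma> t0) = z" "\<gamma> t0 \<in> U" using sheetD(3,4)[OF sh(1)] z(2) by auto
  moreover have "\<gamma> t0 \<notin> W" using t0(1) by (simp add: C_def)
  ultimately have "dist (P p) z = r / 2" using z(1) by (auto simp: W_def)
  then have displ: "norm (P (\<gamma> 1) - P (\<gamma> t0)) = r / 2" using Pz \<gamma>(3) by (simp add: dist_norm)
  have "1 + P (\<gamma> t) \<bullet> P (\<gamma> t) \<le> M\<^sup>2" if "t0 \<le> t" "t \<le> 1" for t
  proof -
    have "P (\<gamma> t) \<in> cball (P p) (r / 2)"
    proof (cases "t = t0")
      case True
      then show ?thesis using Pz z(1) by simp
    next
      case False
      then show ?thesis using inW[of t] that by (auto simp: W_def)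
    qed
    then have "norm (P (\<gamma> t)) \<le> norm (P p) + r / 2"
      using norm_triangle_ineq2[of "P (\<gamma> t)" "P p"] by (simp add: dist_norm norm_minus_commute)
    then have "(norm (P (\<gamma> t)))\<^sup>2 \<le> (norm (P p) + r / 2)\<^sup>2" by (rule power_mono) simp
    then show ?thesis by (simp add: M0(2) power2_norm_eq_inner)
  qed
  from displacement_le_curve_length[OF \<gamma>(1) t01(1,2) M0(1) this]
  have "r / 2 \<le> M * curve_length f \<gamma>" unfolding displ by simp
  also have "\<dots> < M * (r / 2 / M)" using \<gamma>(4) M0(1) by (intro mult_strict_left_mono)
  also have "\<dots> = r / 2" using M0(1) by simp
  finally show False by simp
qed

text \<open>Points on the lifted radius form a Cauchy sequence by \<open>segment_curve\<close>. Their limit in the induced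
distance is a limit in the topology of the surface by \<open>dist_small_in_sheet\<close>, since every
neighbourhood contains a sheet.\<close>

lemma complete_imp_radial_limits:
  assumes compl: "complete_surface X A f"
  shows "has_radial_limits"
  unfolding has_radial_limits_def
proof (intro allI impI)
  fix z0 R s z assume R: "R > 0" and s: "local_section (ball z0 R) s" and z: "dist z0 z = R"
  define T where "T n = 1 - 1 / (real n + 2)" for n
  have T: "0 < T n" "T n < 1" for n by (simp_all add: T_def field_simps)
  have Tlim: "T \<longlonglongrightarrow> 1"
  proof -
    have "(\<lambda>n. 1 - 1 / (real n + 2)) \<longlonglongrightarrow> 1" by real_asymp
    then show ?thesis by (simp add: T_def[abs_def])
  qed
  define c where "c t = z0 + t *\<^sub>R (z - z0)" for t
  have nz: "norm (z - z0) = R" using z by (simp add: dist_norm norm_minus_commute)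
  have cB: "c (T n) \<in> ball z0 R" for n
    using T[of n] nz R by (simp add: c_def dist_norm)
  define x where "x n = s (c (T n))" for n
  have xX: "x n \<in> topspace X" for n unfolding x_def by (rule local_section_in_X[OF s cB])
  have dle: "induced_dist X A f (x m) (x n) \<le> \<bar>T n - T m\<bar> * R" for m n
  proof -
    have "c (T n) - c (T m) = (T n - T m) *\<^sub>R (z - z0)" by (simp add: c_def algebra_simps)
    then have "norm (c (T n) - c (T m)) = \<bar>T n - T m\<bar> * R" by (simp add: nz)
    then show ?thesis using segment_curve(2)[OF s cB cB, of m n] by (simp add: x_def)
  qed
  have "\<forall>\<epsilon>>0. \<exists>N. \<forall>m\<ge>N. \<forall>n\<ge>N. induced_dist X A f (x m) (x n) < \<epsilon>"
  proof (intro allI impI)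
    fix \<epsilon> :: real assume e: "\<epsilon> > 0"
    have "Cauchy T" using Tlim by (rule LIMSEQ_imp_Cauchy)
    then obtain N where N: "\<And>m n. m \<ge> N \<Longrightarrow> n \<ge> N \<Longrightarrow> dist (T m) (T n) < \<epsilon> / R"
      using e R unfolding Cauchy_def by (meson divide_pos_pos)
    have "induced_dist X A f (x m) (x n) < \<epsilon>" if "m \<ge> N" "n \<ge> N" for m n
    proof -
      have "\<bar>T n - T m\<bar> * R < \<epsilon>" using N[OF that] R by (simp add: dist_real_def abs_minus_commute pos_less_divide_eq)
      then show ?thesis using dle[of m n] by linarith
    qed
    then show "\<exists>N. \<forall>m\<ge>N. \<forall>n\<ge>N. induced_dist X A f (x m) (x n) < \<epsilon>" by blast
  qed
  moreover have "range x \<subseteq> topspace X" using xX by blast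
  ultimately obtain p where p: "p \<in> topspace X" "(\<lambda>n. induced_dist X A f (x n) p) \<longlonglongrightarrow> 0"
    using compl unfolding complete_surface_def by blast
  have "\<exists>t. 0 < t \<and> t < 1 \<and> 1 - \<delta> < t \<and> s (z0 + t *\<^sub>R (z - z0)) \<in> Op" if Op: "openin X Op" "p \<in> Op" and d: "\<delta> > 0" for Op \<delta>
  proof -
    obtain U r \<kappa> where sh: "sheet U (P p) r \<kappa>" "p \<in> U" "U \<subseteq> Op" using sheet_exists[OF Op] by blast
    define M where "M = sqrt (1 + (norm (P p) + r / 2)\<^sup>2)"
    have "M > 0" by (simp add: M_def add_pos_nonneg)
    then have "r / 2 / M > 0" using sheetD(2)[OF sh(1)] by simp
    with p(2) have "\<forall>\<^sub>F n in sequentially. induced_dist X A f (x n) p < r / 2 / M" by (rule order_tendstoD)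
    moreover have "\<forall>\<^sub>F n in sequentially. 1 - \<delta> < T n" using Tlim by (rule order_tendstoD) (use d in simp)
    ultimately have "\<forall>\<^sub>F n in sequentially. induced_dist X A f (x n) p < r / 2 / M \<and> 1 - \<delta> < T n"
      by (rule eventually_conj)
    then obtain n where n: "induced_dist X A f (x n) p < r / 2 / M" "1 - \<delta> < T n"
      using eventually_happens'[OF sequentially_bot] by blast
    have "x n \<in> U" by (rule dist_small_in_sheet[OF sh(1,2) xX M_def n(1)])
    then show ?thesis using T[of n] n(2) sh(3) by (intro exI[of _ "T n"]) (auto simp: x_def c_def)
  qed
  then show "\<exists>p\<in>topspace X. \<forall>Op \<delta>. openin X Op \<longrightarrow> p \<in> Op \<longrightarrow> \<delta> > 0 \<longrightarrow>
        (\<exists>t. 0 < t \<and> t < 1 \<and> 1 - \<delta> < t \<and> s (z0 + t *\<^sub>R (z - z0)) \<in> Op)" using p(1) by blast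
qed

end

theorem theorem3p6:
  fixes X :: "'a topology" and A :: "'a atlas" and f :: "'a \<Rightarrow> real^5" and \<sigma> :: real
  assumes orientation: "\<sigma> = 1 \<or> \<sigma> = -1"
    and surface: "spacelike_surface_H41 X A f"
    and isotropic: "plus_isotropic \<sigma> A f"
  shows "(complete_surface X A f \<longrightarrow> isometric_to_H2 X A f) \<and>
    (\<exists>\<Phi>. isometry_H41 \<Phi> \<and>
      (\<forall>p\<in>topspace X. \<exists>U h W l. p \<in> U \<and> diffeo_H2 X A U h W \<and> smooth_on H2 l \<and>
        (\<forall>q\<in>U. \<Phi> (f q) = i_map l (h q))))"
proof -
  interpret spacelike_surface X A f by (unfold_locales) (rule surface)
  obtain \<Phi> where \<Phi>: "isometry_H41 \<Phi>" "null_graph_surface X A f \<Phi>"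
    by (rule normal_form[OF orientation isotropic])
  interpret null_graph_surface X A f \<Phi> by (rule \<Phi>(2))
  have "isometric_to_H2 X A f" if "complete_surface X A f"
    by (intro isometric_if_bij bij_if_radial_limits complete_imp_radial_limits that)
  moreover have "\<exists>U h W l. p \<in> U \<and> diffeo_H2 X A U h W \<and> smooth_on H2 l \<and> (\<forall>q\<in>U. \<Phi> (f q) = i_map l (h q))"
    if "p \<in> topspace X" for p
    using local_graph[OF that] by blast
  ultimately show ?thesis using \<Phi>(1) by blast
qed

end
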